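(* Let $\mathcal{X}$ be a finite state space, let $\mu$ be a target distribution on $\mathcal{X}$ with $\mu(x)>0$ for all $x\in\mathcal{X}$, and let $Q$ be the generator of an irreducible continuous-time Markov chain on $\mathcal{X}$ (the proposal chain). Let $M_1=M_1(Q,\mu)$ and $M_2=M_2(Q,\mu)$ be the two Metropolis-Hastings generators. Then: (1) (Hitting times) For $\lambda>0$ and $A\subseteq\mathcal{X}$, $$\mathbb{E}_{\mu}(e^{-\lambda \tau_A(M_1)}) \leq \mathbb{E}_{\mu}(e^{-\lambda \tau_A(M_2)}).$$ In particular, $\mathbb{E}_{\mu}(\tau_A(M_1)) \geq \mathbb{E}_{\mu}(\tau_A(M_2))$. Furthermore, $t_{av}(M_1,\mu)\geq t_{av}(M_2,\mu)$. (2) (Total variation mixing time) There exists a positive constant $C_\mu$ that depends on $\mu$ such that $$t_{mix}(M_2,\mu,1/4)\leq C_\mu\, t_{mix}(M_1,\mu,1/4).$$ That is, $t_{mix}(M_2,\mu,1/4)\lesssim_\mu t_{mix}(M_1,\mu,1/4)$. (3) (Spectral gap) $\lambda_2(M_1,\mu)\leq\lambda_2(M_2,\mu)$. That is, the exponential $\ell^2$-convergence rate of chain $M_2$ is faster than that of chain $M_1$, or $t_{rel}(M_1,\mu)\geq t_{rel}(M_2,\mu)$. (4) (Asymptotic variance) For $h\in\ell^2_0(\mu)=\{h:\mu(h)=0\}$, $$\sigma^2(h,M_1,\mu)\geq\sigma^2(h,M_2,\mu).$$ (5) (Large deviations) For any probability distribution $\nu$ on $\mathcal{X}$, $I(M_1,\nu)\leq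 I(M_2,\nu)$. That is, the deviations for chain $M_2$ from the invariant distribution are asymptotically less likely than for $M_1$. (6) (Capacity) For any disjoint $A,B\subseteq\mathcal{X}$, $$\mathrm{cap}(A,B,M_1,\mu)\leq\mathrm{cap}(A,B,M_2,\mu).$$ In particular, if we take $A=\{x\}$ and $B=\{y\}$, then $t_{com}^{x,y}(M_1)\geq t_{com}^{x,y}(M_2)$.
   Context: A Markov generator on $\mathcal{X}$ is a real matrix with nonnegative off-diagonal entries and zero row sums. Metropolis-Hastings generators: for $x\neq y$, $$M_1(x,y)=\min\Big\{Q(x,y),\tfrac{\mu(y)}{\mu(x)}Q(y,x)\Big\},\qquad M_2(x,y)=\max\Big\{Q(x,y),\tfrac{\mu(y)}{\mu(x)}Q(y,x)\Big\},$$ and $M_i(x,x)=-\sum_{z\neq x}M_i(x,z)$ for $i=1,2$. Both are reversible with respect to $\mu$. Below, $G$ is a generator on $\mathcal{X}$ with stationary distribution $\pi$, $X=(X_t)_{t\geq0}$ is the associated continuous-time chain and $(P_t)_{t\geq 0}$ its transition semigroup. $\mathbb{P}_x,\mathbb{E}_x$ refer to the chain started at $x$, and $\mathbb{E}_\pi$ to initial law $\pi$. Write $\pi(f)=\sum_x f(x)\pi(x)$ and $\langle f,g\rangle_\pi=\sum_x f(x)g(x)\pi(x)$ for real functions on $\mathcal{X}$. The convention $\inf\emptyset=\infty$ is used. - Hitting time: $\tau_A(G)=\inf\{t\geq0: X_t\in A\}$; first return time: $\tau_A^+(G)=\inf\{t>0: X_t\in A\text{ and there exists } s\in(0,t)\text{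 such that }X_s\neq X_0\}$; $\tau_y=\tau_{\{y\}}$, $\tau_y^+=\tau_{\{y\}}^+$. - Commute time: $t_{com}^{x,y}(G)=\mathbb{E}_x(\tau_y(G))+\mathbb{E}_y(\tau_x(G))$. - Average hitting time: $t_{av}(G,\pi)=\sum_{x,y}\mathbb{E}_x(\tau_y(G))\pi(x)\pi(y)$. - Mixing time: $t_{mix}(G,\pi,\epsilon)=\inf\{t\geq0:\sup_x\|P_t(x,\cdot)-\pi\|_{TV}<\epsilon\}$, with $\|\nu-\pi\|_{TV}=\frac12\sum_x|\nu(x)-\pi(x)|$. The notation $a\lesssim_\mu b$ means $a\leq C_\mu b$ for a positive constant $C_\mu$ depending on $\mu$. - Spectral gap: $\lambda_2(G,\pi)=\inf\{\langle -Gf,f\rangle_\pi:\pi(f)=0,\ \pi(f^2)=1\}$; relaxation time $t_{rel}(G,\pi)=1/\lambda_2(G,\pi)$. - Asymptotic variance: for $f$ with $\pi(f)=0$, $\sigma^2(f,G,\pi)=-2\langle f,g\rangle_\pi$, where $g$ solves the Poisson equation $Gg=f$. - Large deviation rate function: $I(G,\nu)=\sup_{u>0}\big(-\sum_{x}\nu(x)\frac{Gu(x)}{u(x)}\big)$, the supremum being over strictly positive functions $u$ on $\mathcal{X}$. - Capacity: for disjoint $A,B\subseteq\mathcal{X}$, $\mathrm{cap}(A,B,G,\pi)=\sum_{x\in A}\pi(x)\,\mathbb{P}_x(\tau_A^+(G)>\tau_B^+(G))$.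
   Formalization: In (6), capacity carries the exit rate −G(x,x) in each summand, since without it the inequality fails; the commute-time inequality is stated only when M_1 is irreducible, since it can fail otherwise. σ² is taken as infinite when the Poisson equation has no solution. *)

theory Defs
  imports "HOL-Probability.Probability"
begin

section \<open>Generators and Metropolis--Hastings generators\<close>

definition is_generator :: "('a::finite \<Rightarrow> 'a \<Rightarrow> real) \<Rightarrow> bool" where
  "is_generator G \<longleftrightarrow> (\<forall>x y. x \<noteq> y \<longrightarrow> 0 \<le> G x y) \<and> (\<forall>x. (\<Sum>y\<in>UNIV. G x y) = 0)"

text \<open>Diagonal entries of a generator are nonpositive, so only genuine jumps \<open>x \<noteq> y\<close> contribute.\<close>

definition irreducible_gen :: "('a::finite \<Rightarrow> 'a \<Rightarrow> real) \<Rightarrow> bool" where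
  "irreducible_gen G \<longleftrightarrow> (\<forall>x y. (x, y) \<in> {(a, b). 0 < G a b}\<^sup>*)"

definition MH1_rate :: "('a \<Rightarrow> 'a \<Rightarrow> real) \<Rightarrow> 'a pmf \<Rightarrow> 'a \<Rightarrow> 'a \<Rightarrow> real" where
  "MH1_rate Q \<mu> x y = min (Q x y) (pmf \<mu> y / pmf \<mu> x * Q y x)"

definition MH2_rate :: "('a \<Rightarrow> 'a \<Rightarrow> real) \<Rightarrow> 'a pmf \<Rightarrow> 'a \<Rightarrow> 'a \<Rightarrow> real" where
  "MH2_rate Q \<mu> x y = max (Q x y) (pmf \<mu> y / pmf \<mu> x * Q y x)"

definition MH1 :: "('a::finite \<Rightarrow> 'a \<Rightarrow> real) \<Rightarrow> 'a pmf \<Rightarrow> 'a \<Rightarrow> 'a \<Rightarrow> real" where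
  "MH1 Q \<mu> x y =
     (if x = y then - (\<Sum>z\<in>UNIV - {x}. MH1_rate Q \<mu> x z) else MH1_rate Q \<mu> x y)"

definition MH2 :: "('a::finite \<Rightarrow> 'a \<Rightarrow> real) \<Rightarrow> 'a pmf \<Rightarrow> 'a \<Rightarrow> 'a \<Rightarrow> real" where
  "MH2 Q \<mu> x y =
     (if x = y then - (\<Sum>z\<in>UNIV - {x}. MH2_rate Q \<mu> x z) else MH2_rate Q \<mu> x y)"

section \<open>The continuous-time chain\<close>

text \<open>
  The chain with generator \<open>G\<close> is realised by its jump chain and holding times. A sample
  point is a pair of an initial state and an i.i.d. stream of pairs \<open>(e, \<phi>)\<close>: \<open>e\<close> is
  a standard exponential variable, and \<open>\<phi>\<close> is an independent random self-map of the state space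
  whose values \<open>\<phi> x\<close> are independent with the law \<open>jump_pmf G x\<close> of the jump out of \<open>x\<close>.
  From state \<open>x\<close> the chain waits for a time \<open>e / (- G x x)\<close>, which is exponential of
  rate \<open>- G x x\<close> (forever if \<open>x\<close> is absorbing), and then moves to \<open>\<phi> x\<close>.
\<close>

type_synonym 'a sample = "'a \<times> (real \<times> ('a \<Rightarrow> 'a)) stream"

definition jump_pmf :: "('a::finite \<Rightarrow> 'a \<Rightarrow> real) \<Rightarrow> 'a \<Rightarrow> 'a pmf" where
  "jump_pmf G x =
     (if G x x = 0 then return_pmf x
      else embed_pmf (\<lambda>y. if y = x then 0 else G x y / (- G x x)))"

definition noise :: "('a::finite \<Rightarrow> 'a \<Rightarrow> real) \<Rightarrow> (real \<times> ('a \<Rightarrow> 'a)) measure" where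
  "noise G =
     density lborel (exponential_density 1) \<Otimes>\<^sub>M
     measure_pmf (Pi_pmf UNIV undefined (jump_pmf G))"

definition chain :: "('a::finite \<Rightarrow> 'a \<Rightarrow> real) \<Rightarrow> 'a pmf \<Rightarrow> 'a sample measure" where
  "chain G \<nu> = measure_pmf \<nu> \<Otimes>\<^sub>M stream_space (noise G)"

abbreviation chain_from :: "('a::finite \<Rightarrow> 'a \<Rightarrow> real) \<Rightarrow> 'a \<Rightarrow> 'a sample measure" where
  "chain_from G x \<equiv> chain G (return_pmf x)"

primrec jump_chain :: "'a sample \<Rightarrow> nat \<Rightarrow> 'a" where
  "jump_chain \<omega> 0 = fst \<omega>"
| "jump_chain \<omega> (Suc n) = snd (snd \<omega> !! n) (jump_chain \<omega> n)"

definition holding_time :: "('a \<Rightarrow> 'a \<Rightarrow> real) \<Rightarrow> 'a sample \<Rightarrow> nat \<Rightarrow> ennreal" where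
  "holding_time G \<omega> n =
     (let x = jump_chain \<omega> n
      in if G x x = 0 then \<infinity> else ennreal (fst (snd \<omega> !! n) / (- G x x)))"

definition jump_time :: "('a \<Rightarrow> 'a \<Rightarrow> real) \<Rightarrow> 'a sample \<Rightarrow> nat \<Rightarrow> ennreal" where
  "jump_time G \<omega> n = (\<Sum>k<n. holding_time G \<omega> k)"

text \<open>
  The least \<open>n\<close> below is the number of jumps up to time \<open>t\<close>. It exists for all \<open>t\<close> outside a null
  set of \<open>\<omega>\<close>, since the rates of a finite chain are bounded.
\<close>

definition X :: "('a \<Rightarrow> 'a \<Rightarrow> real) \<Rightarrow> real \<Rightarrow> 'a sample \<Rightarrow> 'a" where
  "X G t \<omega> = jump_chain \<omega> (LEAST n. ennreal t < jump_time G \<omega> (Suc n))"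

definition trans_prob :: "('a::finite \<Rightarrow> 'a \<Rightarrow> real) \<Rightarrow> real \<Rightarrow> 'a \<Rightarrow> 'a \<Rightarrow> real" where
  "trans_prob G t x y = \<P>(\<omega> in chain_from G x. X G t \<omega> = y)"

section \<open>Hitting times and mixing time\<close>

definition hit_time :: "('a \<Rightarrow> 'a \<Rightarrow> real) \<Rightarrow> 'a set \<Rightarrow> 'a sample \<Rightarrow> ennreal" where
  "hit_time G A \<omega> = Inf {ennreal t |t. 0 \<le> t \<and> X G t \<omega> \<in> A}"

definition return_time :: "('a \<Rightarrow> 'a \<Rightarrow> real) \<Rightarrow> 'a set \<Rightarrow> 'a sample \<Rightarrow> ennreal" where
  "return_time G A \<omega> =
     Inf {ennreal t |t. 0 < t \<and> X G t \<omega> \<in> A \<and> (\<exists>s. 0 < s \<and> s < t \<and> X G s \<omega> \<noteq> X G 0 \<omega>)}"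

text \<open>\<open>exp_neg l \<tau>\<close> is \<open>e\<^sup>-\<^sup>l\<^sup>\<tau>\<close>, with value \<open>0\<close> at \<open>\<tau> = \<infinity>\<close> (for \<open>l > 0\<close>).\<close>

definition exp_neg :: "real \<Rightarrow> ennreal \<Rightarrow> real" where
  "exp_neg l \<tau> = (if \<tau> = \<infinity> then 0 else exp (- l * enn2real \<tau>))"

definition t_com :: "('a::finite \<Rightarrow> 'a \<Rightarrow> real) \<Rightarrow> 'a \<Rightarrow> 'a \<Rightarrow> ennreal" where
  "t_com G x y =
     (\<integral>\<^sup>+\<omega>. hit_time G {y} \<omega> \<partial>chain_from G x) + (\<integral>\<^sup>+\<omega>. hit_time G {x} \<omega> \<partial>chain_from G y)"

definition t_av :: "('a::finite \<Rightarrow> 'a \<Rightarrow> real) \<Rightarrow> 'a pmf \<Rightarrow> ennreal" where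
  "t_av G \<pi> =
     (\<Sum>x\<in>UNIV. \<Sum>y\<in>UNIV.
        (\<integral>\<^sup>+\<omega>. hit_time G {y} \<omega> \<partial>chain_from G x) * ennreal (pmf \<pi> x) * ennreal (pmf \<pi> y))"

definition tv_dist :: "('a::finite \<Rightarrow> real) \<Rightarrow> ('a \<Rightarrow> real) \<Rightarrow> real" where
  "tv_dist p q = 1 / 2 * (\<Sum>x\<in>UNIV. \<bar>p x - q x\<bar>)"

definition t_mix :: "('a::finite \<Rightarrow> 'a \<Rightarrow> real) \<Rightarrow> 'a pmf \<Rightarrow> real \<Rightarrow> ennreal" where
  "t_mix G \<pi> \<epsilon> =
     Inf {ennreal t |t. 0 \<le> t \<and> (SUP x. tv_dist (trans_prob G t x) (pmf \<pi>)) < \<epsilon>}"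

section \<open>Spectral gap, asymptotic variance, large deviations, capacity\<close>

definition gen_apply :: "('a::finite \<Rightarrow> 'a \<Rightarrow> real) \<Rightarrow> ('a \<Rightarrow> real) \<Rightarrow> 'a \<Rightarrow> real" where
  "gen_apply G f x = (\<Sum>y\<in>UNIV. G x y * f y)"

definition mean :: "'a::finite pmf \<Rightarrow> ('a \<Rightarrow> real) \<Rightarrow> real" where
  "mean \<pi> f = (\<Sum>x\<in>UNIV. f x * pmf \<pi> x)"

definition ip :: "'a::finite pmf \<Rightarrow> ('a \<Rightarrow> real) \<Rightarrow> ('a \<Rightarrow> real) \<Rightarrow> real" where
  "ip \<pi> f g = (\<Sum>x\<in>UNIV. f x * g x * pmf \<pi> x)"

text \<open>
  Extended values are needed: the gap is \<open>\<infinity>\<close> on a one-point space, and it is \<open>0\<close>, with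
  \<open>t_rel = \<infinity>\<close>, for a reducible reversible chain.
\<close>

definition spectral_gap :: "('a::finite \<Rightarrow> 'a \<Rightarrow> real) \<Rightarrow> 'a pmf \<Rightarrow> ereal" where
  "spectral_gap G \<pi> =
     (INF f\<in>{f. mean \<pi> f = 0 \<and> mean \<pi> (\<lambda>x. (f x)\<^sup>2) = 1}.
        ereal (ip \<pi> (\<lambda>x. - gen_apply G f x) f))"

definition t_rel :: "('a::finite \<Rightarrow> 'a \<Rightarrow> real) \<Rightarrow> 'a pmf \<Rightarrow> ereal" where
  "t_rel G \<pi> = 1 / spectral_gap G \<pi>"

text \<open>
  For \<open>\<pi>\<close>-reversible \<open>G\<close> the value does not depend on the chosen solution of the Poisson
  equation. If \<open>G\<close> is reducible there may be no solution; the limiting variance is then infinite.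
\<close>

definition asym_var :: "('a::finite \<Rightarrow> real) \<Rightarrow> ('a \<Rightarrow> 'a \<Rightarrow> real) \<Rightarrow> 'a pmf \<Rightarrow> ereal" where
  "asym_var f G \<pi> =
     (if \<exists>g. gen_apply G g = f then ereal (- 2 * ip \<pi> f (SOME g. gen_apply G g = f)) else \<infinity>)"

definition ld_rate :: "('a::finite \<Rightarrow> 'a \<Rightarrow> real) \<Rightarrow> 'a pmf \<Rightarrow> ereal" where
  "ld_rate G \<nu> =
     (SUP u\<in>{u. \<forall>x. 0 < u x}. ereal (- (\<Sum>x\<in>UNIV. pmf \<nu> x * (gen_apply G u x / u x))))"

text \<open>
  The factor \<open>- G x x\<close> is the rate of leaving \<open>x\<close>. The continuous-time capacity needs it: it makes
  \<open>cap A B G \<pi>\<close> the minimum of the Dirichlet form over \<open>f\<close> with \<open>f = 1\<close> on \<open>A\<close> and \<open>f = 0\<close> on \<open>B\<close>,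
  and gives \<open>t_com G x y = 1 / cap {x} {y} G \<pi>\<close> for irreducible reversible \<open>G\<close>. The sum of
  \<open>\<pi>(x) P\<^sub>x(\<tau>\<^sub>A > \<tau>\<^sub>B)\<close> (return times) without this factor is the discrete-time formula; it is invariant
  under speeding up \<open>G\<close>, and it is not monotone in the off-diagonal rates.
\<close>

definition cap :: "'a set \<Rightarrow> 'a set \<Rightarrow> ('a::finite \<Rightarrow> 'a \<Rightarrow> real) \<Rightarrow> 'a pmf \<Rightarrow> real" where
  "cap A B G \<pi> =
     (\<Sum>x\<in>A. pmf \<pi> x * (- G x x) *
        \<P>(\<omega> in chain_from G x. return_time G A \<omega> > return_time G B \<omega>))"

end

theory Submission
  imports Defs
begin

text \<open>
  All the comparisons rest on one fact. Write \<open>M\<^sub>1\<close> and \<open>M\<^sub>2\<close> for the two Metropolis--Hastings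
  generators and \<open>\<E>\<^sub>i(f, g) = \<langle>- M\<^sub>i f, g\<rangle>\<close> for their Dirichlet forms on \<open>\<ell>\<^sup>2(\<mu>)\<close>. Both are reversible, so
  \<open>\<E>\<^sub>i(f, f) = 1/2 \<Sum> \<mu>(x) M\<^sub>i(x, y) (f(x) - f(y))\<^sup>2\<close> involves the off-diagonal rates only, and since
  \<open>min \<le> max\<close> this gives \<open>\<E>\<^sub>1(f, f) \<le> \<E>\<^sub>2(f, f)\<close> for every \<open>f\<close> (the Peskun order). What remains is to
  express each quantity by an energy, or by an optimum over functions in which \<open>\<E>\<close> occurs once.

  \<^item> Laplace transforms: \<open>u(x) = E\<^sub>x exp(- \<lambda> \<tau>\<^sub>A)\<close> solves \<open>G u = \<lambda> u\<close> off \<open>A\<close> and is \<open>1\<close> on \<open>A\<close>, so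
    \<open>\<lambda> \<mu>(u)\<close> is the minimum of \<open>\<lambda> \<langle>f, f\<rangle> + \<E>(f, f)\<close> over \<open>f = 1\<close> on \<open>A\<close> (\<open>killed_energy_minimal\<close>).
    Expected hitting times are limits of \<open>(1 - E exp(- \<lambda> \<tau>)) / \<lambda>\<close> as \<open>\<lambda> \<rightarrow> 0\<close>, and \<open>t_av\<close> is a mixture
    of the times \<open>E\<^sub>\<mu> \<tau>\<^sub>y\<close>.
  \<^item> Capacity: \<open>P\<^sub>x(\<tau>\<^sub>B < \<tau>\<^sub>A)\<close> is the equilibrium potential, and the capacity is the minimal energy of
    a function that is \<open>0\<close> on \<open>A\<close> and \<open>1\<close> on \<open>B\<close> (\<open>cap_eq_dirichlet\<close>, \<open>cap_minimal\<close>).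
  \<^item> Asymptotic variance and commute time: both are, up to a factor, energies \<open>\<E>(g, g)\<close> of the solution
    of a Poisson equation whose source is the same for both generators, and such an energy is the maximum of
    \<open>2 \<E>(g, f) - \<E>(f, f)\<close>, where \<open>\<E>(g, f)\<close> depends on the source and \<open>f\<close> only (\<open>energy_dual\<close>).
  \<^item> Large deviations: the rate is \<open>\<E>(\<phi>, \<phi>)\<close> for \<open>\<phi> = sqrt(\<nu> / \<mu>)\<close> (\<open>ld_rate_eq\<close>).
  \<^item> Spectral gap: it is defined as such a minimum.
  \<^item> Mixing: if \<open>M\<^sub>1\<close> has mixed at time \<open>t\<close> then \<open>\<langle>f, f\<rangle> \<le> C t \<E>\<^sub>1(f, f)\<close> for centred \<open>f\<close>, with \<open>C\<close>
    depending on \<open>\<mu>\<close> only (\<open>poincare_of_mixing\<close>). The same inequality then holds for \<open>\<E>\<^sub>2\<close>, and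
    it makes the variance under \<open>M\<^sub>2\<close> decay at rate \<open>2 / (C t)\<close> (\<open>mixing_of_poincare\<close>).

  The probabilistic input is the equations satisfied by Laplace transforms, hitting probabilities
  and transition probabilities of the chain. They come from conditioning on the first jump
  (\<open>first_step\<close>): the noise after the first jump is distributed as the whole noise, and each path
  functional at hand is an explicit function of the first holding time and of the same functional
  of the restarted path.
\<close>

section \<open>Sample paths\<close>

definition after_jump :: "'a sample \<Rightarrow> 'a sample" where
  "after_jump \<omega> = (snd (shd (snd \<omega>)) (fst \<omega>), stl (snd \<omega>))"

text \<open>
  A condition on the noise alone, inherited by the noise after the first jump. Positive variables
  make all holding times positive, and an infinite sum excludes explosion because the rates of a
  finite chain are bounded.
\<close>

definition good_noise :: "(real \<times> ('a \<Rightarrow> 'a)) stream \<Rightarrow> bool" where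
  "good_noise s \<longleftrightarrow> (\<forall>k. 0 < fst (s !! k)) \<and> (\<Sum>k. ennreal (fst (s !! k))) = \<infinity>"

lemma jump_chain_shift: "jump_chain \<omega> (Suc n) = jump_chain (after_jump \<omega>) n"
proof (induction n)
  case 0
  show ?case by (simp add: after_jump_def)
next
  case (Suc n)
  have "jump_chain \<omega> (Suc (Suc n)) = snd (snd \<omega> !! Suc n) (jump_chain \<omega> (Suc n))" by simp
  then show ?case unfolding Suc by (simp add: after_jump_def)
qed

lemma holding_time_shift: "holding_time G \<omega> (Suc n) = holding_time G (after_jump \<omega>) n"
  by (simp add: holding_time_def Let_def jump_chain_shift after_jump_def del: jump_chain.simps)

lemma jump_time_0 [simp]: "jump_time G \<omega> 0 = 0"
  by (simp add: jump_time_def)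

lemma jump_time_shift:
  "jump_time G \<omega> (Suc n) = holding_time G \<omega> 0 + jump_time G (after_jump \<omega>) n"
  unfolding jump_time_def by (simp add: sum.lessThan_Suc_shift holding_time_shift del: sum.lessThan_Suc)

lemma jump_time_mono: "m \<le> n \<Longrightarrow> jump_time G \<omega> m \<le> jump_time G \<omega> n"
  unfolding jump_time_def by (intro sum_mono2) auto

text \<open>
  Right-continuity of the path. It holds for every sample point, even where \<open>LEAST\<close> ranges over an
  empty set: after an explosion the path sits at one fixed (arbitrary) state. Having it without
  exceptional sets makes hitting and return times measurable as they stand, not just almost surely
  equal to measurable functions.
\<close>

lemma X_right_constant:
  assumes "0 \<le> t"
  shows "\<exists>\<epsilon>>0. \<forall>s. t \<le> s \<and> s < t + \<epsilon> \<longrightarrow> X G s \<omega> = X G t \<omega>"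
proof (cases "\<exists>n. ennreal t < jump_time G \<omega> (Suc n)")
  case True
  define n where "n = (LEAST n. ennreal t < jump_time G \<omega> (Suc n))"
  have n: "ennreal t < jump_time G \<omega> (Suc n)"
    unfolding n_def using True by (rule LeastI_ex)
  obtain r where r: "ennreal t < r" "r < jump_time G \<omega> (Suc n)"
    using dense[OF n] by blast
  obtain r' where r': "r = ennreal r'" "0 \<le> r'"
    using r(2) by (cases r) auto
  have tr: "t < r'" using r(1) r' assms by (simp add: ennreal_less_iff)
  have "X G s \<omega> = X G t \<omega>" if s: "t \<le> s" "s < t + (r' - t)" for s
  proof -
    have "(LEAST n. ennreal s < jump_time G \<omega> (Suc n)) = n"
    proof (rule Least_equality)
      have "ennreal s \<le> ennreal r'" using s by (simp add: ennreal_leI)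
      then show "ennreal s < jump_time G \<omega> (Suc n)" using r(2) r'(1) by auto
    next
      fix m assume "ennreal s < jump_time G \<omega> (Suc m)"
      moreover have "ennreal t \<le> ennreal s" using s by (simp add: ennreal_leI)
      ultimately have "ennreal t < jump_time G \<omega> (Suc m)" by simp
      then show "n \<le> m" unfolding n_def by (rule Least_le)
    qed
    then show ?thesis unfolding X_def n_def[symmetric] by simp
  qed
  moreover have "0 < r' - t" using tr by simp
  ultimately show ?thesis by blast
next
  case False
  have "X G s \<omega> = X G t \<omega>" if s: "t \<le> s" for s
  proof -
    have "ennreal t \<le> ennreal s" using s by (simp add: ennreal_leI)
    moreover have t: "jump_time G \<omega> (Suc n) \<le> ennreal t" for n
      using False by (simp add: not_less)
    ultimately have "jump_time G \<omega> (Suc n) \<le> ennreal s" for n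
      by (rule order_trans[rotated])
    with t have "(\<lambda>n. ennreal s < jump_time G \<omega> (Suc n)) = (\<lambda>n. ennreal t < jump_time G \<omega> (Suc n))"
      by (auto simp: fun_eq_iff dest: leD)
    then show ?thesis unfolding X_def by simp
  qed
  then show ?thesis by (meson zero_less_one)
qed

lemma sum_noise_unbounded:
  assumes "good_noise s"
  shows "\<exists>n. ennreal t < (\<Sum>k<n. ennreal (fst (s !! k)))"
proof -
  have "(SUP n. \<Sum>k<n. ennreal (fst (s !! k))) = \<infinity>"
    using assms unfolding good_noise_def suminf_eq_SUP by simp
  then show ?thesis
    using less_SUP_iff[of "ennreal t" "\<lambda>n. \<Sum>k<n. ennreal (fst (s !! k))" UNIV] by simp
qed

lemma good_noise_stl:
  assumes "good_noise s"
  shows "good_noise (stl s)"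
proof -
  have pos: "0 < fst (s !! k)" for k using assms by (simp add: good_noise_def)
  have pos': "0 < fst (stl s !! k)" for k using pos[of "Suc k"] by simp
  have "(\<Sum>k. ennreal (fst (s !! k))) = ennreal (fst (s !! 0)) + (\<Sum>k. ennreal (fst (stl s !! k)))"
    using suminf_offset[of "\<lambda>k. ennreal (fst (s !! k))" 1] by simp
  then have "(\<Sum>k. ennreal (fst (stl s !! k))) = \<top>"
    using assms unfolding good_noise_def infinity_ennreal_def by (metis ennreal_add_eq_top ennreal_neq_top)
  then show ?thesis using pos' unfolding good_noise_def by auto
qed

lemma good_noise_shift: "good_noise (snd \<omega>) \<Longrightarrow> good_noise (snd (after_jump \<omega>))"
  by (simp add: after_jump_def good_noise_stl)

locale generator =
  fixes G :: "'a::finite \<Rightarrow> 'a \<Rightarrow> real"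
  assumes gen: "is_generator G"
begin

lemma off_nonneg: "x \<noteq> y \<Longrightarrow> 0 \<le> G x y"
  using gen by (auto simp: is_generator_def)

lemma row_sum: "(\<Sum>y\<in>UNIV. G x y) = 0"
  using gen by (auto simp: is_generator_def)

lemma diag: "G x x = - (\<Sum>y\<in>UNIV - {x}. G x y)"
  using row_sum[of x] by (simp add: sum.remove[of UNIV x])

lemma diag_nonpos: "G x x \<le> 0"
  unfolding diag by (auto intro!: sum_nonneg off_nonneg)

lemma absorbing_row: "G x x = 0 \<Longrightarrow> G x y = 0"
proof (cases "x = y")
  case False
  assume "G x x = 0"
  then have "(\<Sum>y\<in>UNIV - {x}. G x y) = 0" using diag[of x] by simp
  then show ?thesis using False off_nonneg
    by (subst (asm) sum_nonneg_eq_0_iff) auto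
qed auto

text \<open>
  The sum of \<open>1 - G x x\<close> is a convenient positive bound for all exit rates.
\<close>

lemma holding_time_ge:
  assumes "good_noise (snd \<omega>)"
  shows "ennreal (fst (snd \<omega> !! k) / (\<Sum>x\<in>UNIV. 1 - G x x)) \<le> holding_time G \<omega> k"
proof -
  let ?x = "jump_chain \<omega> k"
  have pos: "0 < fst (snd \<omega> !! k)" using assms by (simp add: good_noise_def)
  have "- G ?x ?x \<le> 1 - G ?x ?x" by simp
  also have "\<dots> \<le> (\<Sum>x\<in>UNIV. 1 - G x x)"
    using diag_nonpos by (intro member_le_sum) (auto simp: diag_nonpos order_trans[OF diag_nonpos])
  finally have *: "- G ?x ?x \<le> (\<Sum>x\<in>UNIV. 1 - G x x)" .
  show ?thesis
    using pos * diag_nonpos[of ?x]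
    by (auto simp: holding_time_def Let_def simp del: divide_minus_right
        intro!: ennreal_leI divide_left_mono mult_pos_pos)
qed

lemma holding_time_pos:
  assumes "good_noise (snd \<omega>)"
  shows "0 < holding_time G \<omega> k"
proof -
  have "0 < fst (snd \<omega> !! k)" using assms by (simp add: good_noise_def)
  then show ?thesis
    using diag_nonpos[of "jump_chain \<omega> k"]
    by (auto simp: holding_time_def Let_def simp del: divide_minus_right intro!: divide_pos_pos)
qed

lemma no_explosion:
  assumes "good_noise (snd \<omega>)"
  shows "\<exists>n. ennreal t < jump_time G \<omega> (Suc n)"
proof -
  define c where "c = (\<Sum>x\<in>UNIV. 1 - G x x)"
  have c: "0 < c" unfolding c_def
    by (intro sum_pos) (auto simp: order.strict_trans1[OF diag_nonpos])
  have pos: "0 < fst (snd \<omega> !! k)" for k using assms by (simp add: good_noise_def)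
  obtain n where n: "ennreal (\<bar>t\<bar> * c) < (\<Sum>k<n. ennreal (fst (snd \<omega> !! k)))"
    using sum_noise_unbounded[OF assms] by blast
  have "ennreal (\<bar>t\<bar> * c) < ennreal (\<Sum>k<n. fst (snd \<omega> !! k))"
    using n pos by (subst sum_ennreal[symmetric]) (auto intro: less_imp_le)
  then have "\<bar>t\<bar> * c < (\<Sum>k<n. fst (snd \<omega> !! k))"
    by (rule ennreal_less_iff[THEN iffD1, rotated]) (use c in auto)
  then have "\<bar>t\<bar> < (\<Sum>k<n. fst (snd \<omega> !! k) / c)"
    using c by (simp add: sum_divide_distrib[symmetric] pos_less_divide_eq)
  then have "ennreal \<bar>t\<bar> < ennreal (\<Sum>k<n. fst (snd \<omega> !! k) / c)"
    by (simp add: ennreal_less_iff)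
  also have "\<dots> = (\<Sum>k<n. ennreal (fst (snd \<omega> !! k) / c))"
    using pos c by (subst sum_ennreal) (auto intro: less_imp_le)
  also have "\<dots> \<le> jump_time G \<omega> n"
    unfolding jump_time_def c_def by (intro sum_mono holding_time_ge assms)
  also have "\<dots> \<le> jump_time G \<omega> (Suc n)" by (rule jump_time_mono) simp
  finally have "ennreal \<bar>t\<bar> < jump_time G \<omega> (Suc n)" .
  moreover have "ennreal t \<le> ennreal \<bar>t\<bar>" by (simp add: ennreal_leI)
  ultimately show ?thesis by (intro exI[of _ n]) (rule order.strict_trans1)
qed

lemma X_before_jump:
  assumes "ennreal t < holding_time G \<omega> 0"
  shows "X G t \<omega> = fst \<omega>"
proof -
  have "(LEAST n. ennreal t < jump_time G \<omega> (Suc n)) = 0"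
    using assms by (intro Least_equality) (auto simp: jump_time_shift)
  then show ?thesis by (simp add: X_def)
qed

text \<open>
  The Markov property at the level of paths: after the first jump, at time \<open>r\<close>, the path runs
  through the restarted path. Without an upper bound on the jump times the two minima behind \<open>X\<close>
  would both be arbitrary and need not match, hence the restriction to good noise.
\<close>

lemma X_after_jump:
  assumes good: "good_noise (snd \<omega>)" and h: "holding_time G \<omega> 0 = ennreal r" "0 \<le> r" "r \<le> t"
  shows "X G t \<omega> = X G (t - r) (after_jump \<omega>)"
proof -
  have eq: "ennreal t < jump_time G \<omega> (Suc (Suc n)) \<longleftrightarrow>
        ennreal (t - r) < jump_time G (after_jump \<omega>) (Suc n)" for n
  proof -
    have "ennreal t = ennreal r + ennreal (t - r)" using h by (simp flip: ennreal_plus)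
    then show ?thesis
      unfolding jump_time_shift[of G \<omega>] h by simp
  qed
  have n0: "\<not> ennreal t < jump_time G \<omega> (Suc 0)"
    using h by (simp add: jump_time_shift ennreal_leI not_less)
  obtain n where "ennreal t < jump_time G \<omega> (Suc n)"
    using no_explosion[OF good] by blast
  then have "(LEAST n. ennreal t < jump_time G \<omega> (Suc n)) =
      Suc (LEAST n. ennreal t < jump_time G \<omega> (Suc (Suc n)))"
    using n0 by (rule Least_Suc)
  then show ?thesis
    unfolding X_def eq by (simp only: jump_chain_shift)
qed

lemma X_0: "good_noise (snd \<omega>) \<Longrightarrow> X G 0 \<omega> = fst \<omega>"
  by (intro X_before_jump) (simp add: holding_time_pos)

lemma hit_time_start:
  assumes "good_noise (snd \<omega>)" "fst \<omega> \<in> A"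
  shows "hit_time G A \<omega> = 0"
proof -
  have "hit_time G A \<omega> \<le> ennreal 0"
    unfolding hit_time_def using assms by (intro Inf_lower) (auto simp: X_0 intro!: exI[of _ 0])
  then show ?thesis by simp
qed

lemma hit_time_absorbing:
  assumes "fst \<omega> \<notin> A" "G (fst \<omega>) (fst \<omega>) = 0"
  shows "hit_time G A \<omega> = \<infinity>"
proof -
  have "X G t \<omega> = fst \<omega>" for t
    using assms by (intro X_before_jump) (simp add: holding_time_def)
  then show ?thesis using assms by (simp add: hit_time_def)
qed

lemma hit_time_pos:
  assumes "good_noise (snd \<omega>)" "fst \<omega> \<notin> A"
  shows "0 < hit_time G A \<omega>"
proof -
  have "holding_time G \<omega> 0 \<le> hit_time G A \<omega>"
    unfolding hit_time_def
  proof (intro Inf_greatest, clarify)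
    fix t assume "X G t \<omega> \<in> A"
    then show "holding_time G \<omega> 0 \<le> ennreal t"
      using assms(2) X_before_jump[of t \<omega>] by (cases "ennreal t < holding_time G \<omega> 0") auto
  qed
  then show ?thesis using holding_time_pos[OF assms(1), of 0] by simp
qed

lemma holding_time_0:
  assumes "good_noise (snd \<omega>)" "G (fst \<omega>) (fst \<omega>) \<noteq> 0"
  obtains r where "r = fst (shd (snd \<omega>)) / - G (fst \<omega>) (fst \<omega>)" "0 < r" "holding_time G \<omega> 0 = ennreal r"
proof -
  have "0 < fst (snd \<omega> !! 0)" using assms by (simp only: good_noise_def)
  moreover have "G (fst \<omega>) (fst \<omega>) < 0" using assms(2) diag_nonpos[of "fst \<omega>"] by simp
  ultimately show ?thesis
    using assms(2) by (intro that[OF refl]) (auto simp: holding_time_def Let_def intro: divide_pos_neg)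
qed

lemma Inf_shift_ennreal:
  assumes "S' = {t. r \<le> t \<and> t - r \<in> S}" "S \<subseteq> {0..}" "0 \<le> r"
  shows "Inf (ennreal ` S') = ennreal r + Inf (ennreal ` S)"
proof (cases "S = {}")
  case True
  then show ?thesis using assms by simp
next
  case False
  have "S' = (\<lambda>s. r + s) ` S"
    using assms(2) unfolding assms(1) by (force simp: image_iff)
  then have "ennreal ` S' = (\<lambda>s. ennreal (r + s)) ` S" by (simp only: image_image)
  also have "\<dots> = (\<lambda>s. ennreal r + ennreal s) ` S"
    using assms by (intro image_cong) (auto intro!: ennreal_plus)
  finally have "ennreal ` S' = (\<lambda>s. ennreal r + ennreal s) ` S" .
  then have "Inf (ennreal ` S') = (INF s\<in>S. ennreal r + ennreal s)" by simp
  also have "\<dots> = ennreal r + (INF s\<in>S. ennreal s)"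
  proof (rule antisym)
    let ?I = "INF s\<in>S. ennreal r + ennreal s"
    have "?I - ennreal r \<le> (INF s\<in>S. ennreal s)"
    proof (rule INF_greatest)
      fix s assume "s \<in> S"
      then have "?I \<le> ennreal r + ennreal s" by (rule INF_lower)
      then show "?I - ennreal r \<le> ennreal s" by (simp add: ennreal_minus_le_iff)
    qed
    then show "?I \<le> ennreal r + (INF s\<in>S. ennreal s)" by (simp add: ennreal_minus_le_iff)
    show "ennreal r + (INF s\<in>S. ennreal s) \<le> ?I"
      by (intro INF_greatest add_left_mono INF_lower)
  qed
  finally show ?thesis .
qed

lemma hit_time_eq_image: "hit_time G A \<omega> = Inf (ennreal ` {t. 0 \<le> t \<and> X G t \<omega> \<in> A})"
  unfolding hit_time_def by (rule arg_cong[where f = Inf]) auto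

lemma hit_time_step:
  assumes good: "good_noise (snd \<omega>)" and A: "fst \<omega> \<notin> A" and q: "G (fst \<omega>) (fst \<omega>) \<noteq> 0"
  shows "hit_time G A \<omega> =
    ennreal (fst (shd (snd \<omega>)) / - G (fst \<omega>) (fst \<omega>)) + hit_time G A (after_jump \<omega>)"
proof -
  obtain r where r: "r = fst (shd (snd \<omega>)) / - G (fst \<omega>) (fst \<omega>)" "0 < r" "holding_time G \<omega> 0 = ennreal r"
    using holding_time_0[OF good q] .
  have before: "X G t \<omega> = fst \<omega>" if "0 \<le> t" "t < r" for t
    using that r(2,3) by (intro X_before_jump) (simp add: ennreal_less_iff)
  have "0 \<le> t \<and> X G t \<omega> \<in> A \<longleftrightarrow> r \<le> t \<and> 0 \<le> t - r \<and> X G (t - r) (after_jump \<omega>) \<in> A" for t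
    using before[of t] A r(2) X_after_jump[OF good r(3), of t] by (cases "t < r") auto
  then have "{t. 0 \<le> t \<and> X G t \<omega> \<in> A} = {t. r \<le> t \<and> t - r \<in> {t. 0 \<le> t \<and> X G t (after_jump \<omega>) \<in> A}}"
    by blast
  then show ?thesis
    unfolding hit_time_eq_image r(1)[symmetric] using r(2) by (intro Inf_shift_ennreal) auto
qed

text \<open>
  Return times quantify over \<open>t > 0\<close>, hitting times over \<open>t \<ge> 0\<close>; right-continuity makes the two
  infima equal.
\<close>

lemma hit_time_eq_positive:
  "hit_time G A \<omega> = Inf (ennreal ` {t. 0 < t \<and> X G t \<omega> \<in> A})"
proof (rule antisym)
  show "hit_time G A \<omega> \<le> Inf (ennreal ` {t. 0 < t \<and> X G t \<omega> \<in> A})"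
    unfolding hit_time_eq_image by (intro Inf_superset_mono) auto
  show "Inf (ennreal ` {t. 0 < t \<and> X G t \<omega> \<in> A}) \<le> hit_time G A \<omega>"
    unfolding hit_time_eq_image
  proof (intro Inf_greatest, elim imageE, clarify)
    fix t :: real assume t: "0 \<le> t" "X G t \<omega> \<in> A"
    obtain \<epsilon> where \<epsilon>: "\<epsilon> > 0" "\<And>s. t \<le> s \<Longrightarrow> s < t + \<epsilon> \<Longrightarrow> X G s \<omega> = X G t \<omega>"
      using X_right_constant[OF t(1)] by metis
    show "Inf (ennreal ` {t. 0 < t \<and> X G t \<omega> \<in> A}) \<le> ennreal t"
    proof (rule ennreal_le_epsilon)
      fix e :: real assume e: "0 < e"
      define s where "s = t + min (\<epsilon> / 2) e"
      have s: "0 < s" "X G s \<omega> \<in> A" "s \<le> t + e"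
        using t e \<epsilon>(1) \<epsilon>(2)[of s] by (auto simp: s_def min_def)
      have "Inf (ennreal ` {t. 0 < t \<and> X G t \<omega> \<in> A}) \<le> ennreal s"
        using s by (intro Inf_lower) auto
      also have "\<dots> \<le> ennreal t + ennreal e"
        using s t e by (simp flip: ennreal_plus add: ennreal_leI)
      finally show "Inf (ennreal ` {t. 0 < t \<and> X G t \<omega> \<in> A}) \<le> ennreal t + ennreal e" .
    qed
  qed
qed

text \<open>
  At the first jump the chain really changes its state, so the side condition in the return time is
  met exactly after that jump, and what remains is an ordinary hitting time of the restarted path.
\<close>

lemma return_time_step:
  assumes good: "good_noise (snd \<omega>)" and q: "G (fst \<omega>) (fst \<omega>) \<noteq> 0"
    and moves: "fst (after_jump \<omega>) \<noteq> fst \<omega>"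
  shows "return_time G A \<omega> =
    ennreal (fst (shd (snd \<omega>)) / - G (fst \<omega>) (fst \<omega>)) + hit_time G A (after_jump \<omega>)"
proof -
  obtain r where r: "r = fst (shd (snd \<omega>)) / - G (fst \<omega>) (fst \<omega>)" "0 < r" "holding_time G \<omega> 0 = ennreal r"
    using holding_time_0[OF good q] .
  have before: "X G t \<omega> = fst \<omega>" if "0 \<le> t" "t < r" for t
    using that r by (intro X_before_jump) (simp add: ennreal_less_iff)
  have after: "X G t \<omega> = X G (t - r) (after_jump \<omega>)" if "r \<le> t" for t
    using that X_after_jump[OF good r(3)] r(2) by simp
  have at_r: "X G r \<omega> \<noteq> X G 0 \<omega>"
    using after[of r] before[of 0] r(2) moves X_0[OF good_noise_shift[OF good]] by simp
  have moved: "(\<exists>s. 0 < s \<and> s < t \<and> X G s \<omega> \<noteq> X G 0 \<omega>) \<longleftrightarrow> r < t" for t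
  proof
    assume "\<exists>s. 0 < s \<and> s < t \<and> X G s \<omega> \<noteq> X G 0 \<omega>"
    then obtain s where s: "0 < s" "s < t" "X G s \<omega> \<noteq> X G 0 \<omega>" by blast
    then have "\<not> s < r" using before[of s] before[of 0] r(2) by auto
    then show "r < t" using s by simp
  next
    assume "r < t"
    then show "\<exists>s. 0 < s \<and> s < t \<and> X G s \<omega> \<noteq> X G 0 \<omega>" using at_r r(2) by blast
  qed
  have "return_time G A \<omega> = Inf (ennreal ` {t. 0 < t \<and> X G t \<omega> \<in> A \<and> r < t})"
    unfolding return_time_def moved by (rule arg_cong[where f = Inf]) auto
  also have "\<dots> = ennreal r + Inf (ennreal ` {t. 0 < t \<and> X G t (after_jump \<omega>) \<in> A})"
    using r(2) after by (intro Inf_shift_ennreal) auto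
  finally show ?thesis unfolding r(1)[symmetric] hit_time_eq_positive .
qed

end

section \<open>Measurability of path functionals\<close>

text \<open>
  The \<open>\<sigma>\<close>-algebra of \<open>chain G \<nu>\<close> does not depend on \<open>G\<close> and \<open>\<nu>\<close>, so measurability is stated once, on
  this measure space.
\<close>

abbreviation sample_space :: "'a::finite sample measure" where
  "sample_space \<equiv> count_space UNIV \<Otimes>\<^sub>M stream_space (borel \<Otimes>\<^sub>M count_space UNIV)"

lemma space_sample_space [simp]: "space sample_space = UNIV"
  by (simp add: space_pair_measure space_stream_space)

lemma sets_noise [measurable_cong]:
  "sets (noise G) = sets (borel \<Otimes>\<^sub>M count_space UNIV)"
  unfolding noise_def by (intro sets_pair_measure_cong) auto

lemma sets_chain [measurable_cong]: "sets (chain G \<nu>) = sets sample_space"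
  unfolding chain_def
  by (intro sets_pair_measure_cong sets_stream_space_cong sets_noise) auto

lemma space_chain [simp]: "space (chain G \<nu>) = UNIV"
  using sets_eq_imp_space_eq[OF sets_chain] by simp

lemma measurable_jump_chain [measurable]:
  "(\<lambda>\<omega>. jump_chain \<omega> n) \<in> measurable sample_space (count_space (UNIV :: 'a::finite set))"
proof (induction n)
  case 0
  show ?case by simp
next
  case (Suc n)
  have "(\<lambda>\<omega>. \<phi> (jump_chain \<omega> n)) \<in> measurable sample_space (count_space (UNIV :: 'a set))" for \<phi> :: "'a \<Rightarrow> 'a"
    by (rule measurable_compose[OF Suc]) simp
  moreover have "(\<lambda>\<omega>. snd (snd \<omega> !! n)) \<in> measurable sample_space (count_space (UNIV :: ('a \<Rightarrow> 'a) set))"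
    by measurable
  ultimately have "(\<lambda>\<omega>. snd (snd \<omega> !! n) (jump_chain \<omega> n)) \<in> measurable sample_space (count_space (UNIV :: 'a set))"
    by (intro measurable_compose_countable[where f = "\<lambda>\<phi> \<omega>. \<phi> (jump_chain \<omega> n)"
          and g = "\<lambda>\<omega>. snd (snd \<omega> !! n)"])
  then show ?case by simp
qed

lemma measurable_holding_time [measurable]: "(\<lambda>\<omega>. holding_time G \<omega> n) \<in> borel_measurable sample_space"
proof -
  have "(\<lambda>\<omega>. if G x x = 0 then \<infinity> else ennreal (fst (snd \<omega> !! n) / - G x x)) \<in> borel_measurable sample_space" for x
    by measurable
  then show ?thesis unfolding holding_time_def Let_def
    using measurable_jump_chain by (rule measurable_compose_countable)
qed

lemma measurable_jump_time [measurable]: "(\<lambda>\<omega>. jump_time G \<omega> n) \<in> borel_measurable sample_space"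
  unfolding jump_time_def by measurable

lemma measurable_X [measurable]: "X G t \<in> measurable sample_space (count_space UNIV)"
  unfolding X_def by (rule measurable_compose_countable[OF measurable_jump_chain]) measurable

lemma measurable_X_pair [measurable]:
  "(\<lambda>(t, \<omega>). X G t \<omega>) \<in> measurable (borel \<Otimes>\<^sub>M sample_space) (count_space UNIV)"
proof -
  have "(\<lambda>p. jump_chain (snd p) (LEAST n. ennreal (fst p) < jump_time G (snd p) (Suc n)))
      \<in> measurable (borel \<Otimes>\<^sub>M sample_space) (count_space UNIV)"
    by (rule measurable_compose_countable[where f = "\<lambda>n p. jump_chain (snd p) n"]) measurable
  then show ?thesis by (simp add: X_def case_prod_unfold)
qed

lemma measurable_X_compose [measurable (raw)]:
  assumes [measurable]: "f \<in> borel_measurable M" "g \<in> measurable M sample_space"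
  shows "(\<lambda>x. X G (f x) (g x)) \<in> measurable M (count_space UNIV)"
  using measurable_compose[OF _ measurable_X_pair, of "\<lambda>x. (f x, g x)"] by simp

lemma rational_time_right:
  assumes "0 \<le> t" "0 < e"
  obtains r :: rat where "t < of_rat r" "of_rat r < t + e" "X G (of_rat r) \<omega> = X G t \<omega>"
proof -
  obtain \<epsilon> where \<epsilon>: "\<epsilon> > 0" "\<And>s. t \<le> s \<Longrightarrow> s < t + \<epsilon> \<Longrightarrow> X G s \<omega> = X G t \<omega>"
    using X_right_constant[OF assms(1)] by metis
  obtain r where "t < of_rat r" "of_rat r < t + min \<epsilon> e"
    using of_rat_dense[of t "t + min \<epsilon> e"] \<epsilon>(1) assms(2) by auto
  then show ?thesis using \<epsilon>(2)[of "of_rat r"] by (intro that[of r]) auto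
qed

text \<open>
  For a set of times that is dense to the right of each of its points, the infimum is already the
  infimum over rational times, a countable one.
\<close>

lemma Inf_times_eq_rational:
  assumes "\<And>t. P t \<Longrightarrow> 0 \<le> t"
    and right: "\<And>t e. P t \<Longrightarrow> 0 < e \<Longrightarrow> \<exists>r::rat. t \<le> of_rat r \<and> of_rat r < t + e \<and> P (of_rat r)"
  shows "Inf {ennreal t |t. P t} = (INF r::rat. if P (of_rat r) then ennreal (of_rat r) else \<infinity>)"
proof (rule antisym)
  show "Inf {ennreal t |t. P t} \<le> (INF r::rat. if P (of_rat r) then ennreal (of_rat r) else \<infinity>)"
    by (intro INF_greatest) (auto intro!: Inf_lower)
  show "(INF r::rat. if P (of_rat r) then ennreal (of_rat r) else \<infinity>) \<le> Inf {ennreal t |t. P t}"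
  proof (intro Inf_greatest, clarify)
    fix t assume t: "P t"
    show "(INF r::rat. if P (of_rat r) then ennreal (of_rat r) else \<infinity>) \<le> ennreal t"
    proof (rule ennreal_le_epsilon)
      fix e :: real assume e: "0 < e"
      obtain r :: rat where r: "t \<le> of_rat r" "of_rat r < t + e" "P (of_rat r)"
        using right[OF t e] by blast
      have "(INF r::rat. if P (of_rat r) then ennreal (of_rat r) else \<infinity>) \<le> ennreal (of_rat r)"
        using r(3) by (intro INF_lower2[of r]) auto
      also have "\<dots> \<le> ennreal t + ennreal e"
        using r e assms(1)[OF t] by (simp flip: ennreal_plus add: ennreal_leI)
      finally show "(INF r::rat. if P (of_rat r) then ennreal (of_rat r) else \<infinity>) \<le> ennreal t + ennreal e" .
    qed
  qed
qed

lemma measurable_hit_time [measurable]: "hit_time G A \<in> borel_measurable sample_space"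
proof -
  have "hit_time G A \<omega> = (INF r::rat. if 0 \<le> (of_rat r :: real) \<and> X G (of_rat r) \<omega> \<in> A
      then ennreal (of_rat r) else \<infinity>)" for \<omega>
    unfolding hit_time_def
  proof (rule Inf_times_eq_rational)
    fix t e :: real assume t: "0 \<le> t \<and> X G t \<omega> \<in> A" and e: "0 < e"
    obtain r where "t < of_rat r" "of_rat r < t + e" "X G (of_rat r) \<omega> = X G t \<omega>"
      using rational_time_right t e by metis
    then show "\<exists>r. t \<le> real_of_rat r \<and> real_of_rat r < t + e \<and>
        0 \<le> real_of_rat r \<and> X G (real_of_rat r) \<omega> \<in> A"
      using t by (intro exI[of _ r]) (auto simp del: zero_le_of_rat_iff)
  qed auto
  then show ?thesis by (subst measurable_cong) (assumption, measurable)
qed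

lemma measurable_return_time [measurable]: "return_time G A \<in> borel_measurable sample_space"
proof -
  have right: "(\<exists>s>0. s < t \<and> X G s \<omega> \<noteq> X G 0 \<omega>) \<longleftrightarrow>
      (\<exists>r::rat. 0 < (of_rat r :: real) \<and> of_rat r < t \<and> X G (of_rat r) \<omega> \<noteq> X G 0 \<omega>)" for t \<omega>
  proof
    assume "\<exists>s>0. s < t \<and> X G s \<omega> \<noteq> X G 0 \<omega>"
    then obtain s where s: "0 < s" "s < t" "X G s \<omega> \<noteq> X G 0 \<omega>" by blast
    then obtain r where "s < of_rat r" "of_rat r < s + (t - s)" "X G (of_rat r) \<omega> = X G s \<omega>"
      using rational_time_right[of s "t - s"] by (metis diff_gt_0_iff_gt less_imp_le)
    then show "\<exists>r::rat. 0 < (of_rat r :: real) \<and> of_rat r < t \<and> X G (of_rat r) \<omega> \<noteq> X G 0 \<omega>"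
      using s by (intro exI[of _ r]) (auto simp del: zero_less_of_rat_iff)
  qed blast
  have "return_time G A \<omega> = (INF r::rat. if 0 < (of_rat r :: real) \<and> X G (of_rat r) \<omega> \<in> A \<and>
      (\<exists>s>0. s < of_rat r \<and> X G s \<omega> \<noteq> X G 0 \<omega>) then ennreal (of_rat r) else \<infinity>)" for \<omega>
    unfolding return_time_def
  proof (rule Inf_times_eq_rational)
    fix t e :: real
    assume t: "0 < t \<and> X G t \<omega> \<in> A \<and> (\<exists>s>0. s < t \<and> X G s \<omega> \<noteq> X G 0 \<omega>)" and e: "0 < e"
    obtain r where "t < of_rat r" "of_rat r < t + e" "X G (of_rat r) \<omega> = X G t \<omega>"
      using rational_time_right t e by (metis less_imp_le)
    then show "\<exists>r. t \<le> real_of_rat r \<and> real_of_rat r < t + e \<and> 0 < real_of_rat r \<and>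
        X G (real_of_rat r) \<omega> \<in> A \<and> (\<exists>s>0. s < real_of_rat r \<and> X G s \<omega> \<noteq> X G 0 \<omega>)"
      using t by (intro exI[of _ r]) (auto simp del: zero_less_of_rat_iff intro: order.strict_trans)
  qed auto
  then have "return_time G A \<omega> = (INF r::rat. if 0 < (of_rat r :: real) \<and> X G (of_rat r) \<omega> \<in> A \<and>
      (\<exists>s::rat. 0 < (of_rat s :: real) \<and> (of_rat s :: real) < of_rat r \<and> X G (of_rat s) \<omega> \<noteq> X G 0 \<omega>)
      then ennreal (of_rat r) else \<infinity>)" for \<omega>
    unfolding right .
  then show ?thesis by (subst measurable_cong) (assumption, measurable)
qed

lemma measurable_exp_neg [measurable]: "exp_neg l \<in> borel_measurable borel"
  unfolding exp_neg_def[abs_def] by measurable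

lemma measurable_good_noise [measurable]:
  "Measurable.pred (stream_space (borel \<Otimes>\<^sub>M count_space UNIV)) good_noise"
  unfolding good_noise_def[abs_def] by measurable

lemma measurable_shift [measurable]: "(after_jump :: 'a::finite sample \<Rightarrow> _) \<in> measurable sample_space sample_space"
proof -
  have "(\<lambda>\<omega>. \<phi> (fst \<omega>)) \<in> measurable sample_space (count_space UNIV)" for \<phi> :: "'a \<Rightarrow> 'a"
    by (rule measurable_compose[OF measurable_fst]) simp
  moreover have "(\<lambda>\<omega>. snd (shd (snd \<omega>))) \<in> measurable sample_space (count_space (UNIV :: ('a \<Rightarrow> 'a) set))"
    by measurable
  ultimately have "(\<lambda>\<omega>. snd (shd (snd \<omega>)) (fst \<omega>)) \<in> measurable sample_space (count_space (UNIV :: 'a set))"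
    by (intro measurable_compose_countable[where f = "\<lambda>\<phi> \<omega>. \<phi> (fst \<omega>)"
          and g = "\<lambda>\<omega>. snd (shd (snd \<omega>))"])
  then show ?thesis unfolding after_jump_def[abs_def] by (rule measurable_Pair) measurable
qed

section \<open>Integration against the law of the chain\<close>

lemma prob_space_noise: "prob_space (noise G)"
proof -
  interpret E: prob_space "density lborel (exponential_density 1)"
    by (rule prob_space_exponential_density) simp
  interpret pair_prob_space "density lborel (exponential_density 1)"
    "measure_pmf (Pi_pmf UNIV undefined (jump_pmf G))"
    by unfold_locales
  show ?thesis unfolding noise_def by unfold_locales
qed

lemma prob_space_chain: "prob_space (chain G \<nu>)"
proof -
  interpret N: prob_space "noise G" by (rule prob_space_noise)
  interpret S: prob_space "stream_space (noise G)" by (rule N.prob_space_stream_space)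
  interpret pair_prob_space "measure_pmf \<nu>" "stream_space (noise G)" by unfold_locales
  show ?thesis unfolding chain_def by unfold_locales
qed

lemma nn_integral_noise:
  assumes [measurable]: "f \<in> borel_measurable (borel \<Otimes>\<^sub>M count_space UNIV)"
  shows "(\<integral>\<^sup>+p. f p \<partial>noise G) =
    (\<integral>\<^sup>+e. (\<integral>\<^sup>+\<phi>. f (e, \<phi>) \<partial>measure_pmf (Pi_pmf UNIV undefined (jump_pmf G)))
      \<partial>density lborel (exponential_density 1))"
proof -
  let ?E = "density lborel (exponential_density 1)"
  let ?J = "measure_pmf (Pi_pmf UNIV undefined (jump_pmf G))"
  have "sets (?E \<Otimes>\<^sub>M ?J) = sets (borel \<Otimes>\<^sub>M count_space UNIV)"
    using sets_noise[of G] unfolding noise_def .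
  then have "f \<in> borel_measurable (?E \<Otimes>\<^sub>M ?J)"
    using assms measurable_cong_sets by blast
  then show ?thesis unfolding noise_def by (subst measure_pmf.nn_integral_fst[symmetric]) auto
qed

lemma nn_integral_chain_UNIV:
  assumes [measurable]: "f \<in> borel_measurable sample_space"
  shows "(\<integral>\<^sup>+\<omega>. f \<omega> \<partial>chain G \<nu>) =
    (\<Sum>x\<in>UNIV. ennreal (pmf \<nu> x) * (\<integral>\<^sup>+s. f (x, s) \<partial>stream_space (noise G)))"
proof -
  interpret N: prob_space "noise G" by (rule prob_space_noise)
  interpret S: prob_space "stream_space (noise G)" by (rule N.prob_space_stream_space)
  have "f \<in> borel_measurable (chain G \<nu>)" by measurable
  then have "(\<integral>\<^sup>+\<omega>. f \<omega> \<partial>chain G \<nu>) =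
      (\<integral>\<^sup>+x. (\<integral>\<^sup>+s. f (x, s) \<partial>stream_space (noise G)) \<partial>measure_pmf \<nu>)"
    unfolding chain_def by (subst S.nn_integral_fst[symmetric]) auto
  also have "\<dots> = (\<Sum>x\<in>set_pmf \<nu>. (\<integral>\<^sup>+s. f (x, s) \<partial>stream_space (noise G)) * ennreal (pmf \<nu> x))"
    by (rule nn_integral_measure_pmf_finite) auto
  also have "\<dots> = (\<Sum>x\<in>UNIV. (\<integral>\<^sup>+s. f (x, s) \<partial>stream_space (noise G)) * ennreal (pmf \<nu> x))"
    by (rule sum.mono_neutral_left) (auto simp: set_pmf_iff)
  finally show ?thesis by (simp only: mult.commute)
qed

lemma nn_integral_chain_from:
  assumes "f \<in> borel_measurable sample_space"
  shows "(\<integral>\<^sup>+\<omega>. f \<omega> \<partial>chain_from G x) = (\<integral>\<^sup>+s. f (x, s) \<partial>stream_space (noise G))"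
proof -
  have "(\<integral>\<^sup>+\<omega>. f \<omega> \<partial>chain_from G x) =
      (\<Sum>y\<in>{x}. ennreal (pmf (return_pmf x) y) * (\<integral>\<^sup>+s. f (y, s) \<partial>stream_space (noise G)))"
    unfolding nn_integral_chain_UNIV[OF assms]
    by (rule sum.mono_neutral_right) (auto simp: indicator_def)
  then show ?thesis by simp
qed

lemma nn_integral_chain:
  assumes "f \<in> borel_measurable sample_space"
  shows "(\<integral>\<^sup>+\<omega>. f \<omega> \<partial>chain G \<nu>) = (\<Sum>x\<in>UNIV. ennreal (pmf \<nu> x) * (\<integral>\<^sup>+\<omega>. f \<omega> \<partial>chain_from G x))"
  using nn_integral_chain_UNIV[OF assms] nn_integral_chain_from[OF assms] by simp

lemma AE_chain_from:
  assumes "AE s in stream_space (noise G). P (x, s)" "Measurable.pred sample_space P"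
  shows "AE \<omega> in chain_from G x. P \<omega>"
proof -
  have [measurable]: "Measurable.pred sample_space P" by fact
  have "{\<omega> \<in> space sample_space. \<not> P \<omega>} \<in> sets sample_space" by measurable
  then have [measurable]: "{\<omega>. \<not> P \<omega>} \<in> sets sample_space" by simp
  have "emeasure (chain_from G x) {\<omega>. \<not> P \<omega>} = (\<integral>\<^sup>+\<omega>. indicator {\<omega>. \<not> P \<omega>} \<omega> \<partial>chain_from G x)"
    by (subst nn_integral_indicator) (auto simp: sets_chain)
  also have "\<dots> = (\<integral>\<^sup>+s. indicator {\<omega>. \<not> P \<omega>} (x, s) \<partial>stream_space (noise G))"
    by (rule nn_integral_chain_from) measurable
  also have "\<dots> = (\<integral>\<^sup>+s. 0 \<partial>stream_space (noise G))"
    using assms(1) by (intro nn_integral_cong_AE) (auto elim!: eventually_mono)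
  finally have "emeasure (chain_from G x) {\<omega>. \<not> P \<omega>} = 0" by simp
  then show ?thesis by (intro AE_I[of _ _ "{\<omega>. \<not> P \<omega>}"]) (auto simp: sets_chain)
qed

section \<open>First-step analysis\<close>

lemma exp_neg_nonneg [simp]: "0 \<le> exp_neg l \<tau>"
  by (simp add: exp_neg_def)

lemma exp_neg_le_1: "0 \<le> l \<Longrightarrow> exp_neg l \<tau> \<le> 1"
  by (simp add: exp_neg_def)

lemma exp_neg_add:
  assumes "0 \<le> r"
  shows "exp_neg l (ennreal r + \<tau>) = exp (- l * r) * exp_neg l \<tau>"
proof (cases \<tau>)
  case (real t)
  then have "ennreal r + \<tau> = ennreal (r + t)" using assms by simp
  then show ?thesis
    using real assms by (simp add: exp_neg_def exp_add[symmetric] algebra_simps del: ennreal_plus)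
qed (simp add: exp_neg_def)

lemma nn_integral_exp_exponential:
  assumes "0 < a + 1"
  shows "(\<integral>\<^sup>+e. ennreal (exp (- a * e)) \<partial>density lborel (exponential_density 1)) = ennreal (1 / (a + 1))"
proof -
  interpret E: prob_space "density lborel (exponential_density (a + 1))"
    by (rule prob_space_exponential_density) fact
  have "(\<integral>\<^sup>+e. ennreal (exp (- a * e)) \<partial>density lborel (exponential_density 1)) =
      (\<integral>\<^sup>+e. ennreal (exponential_density 1 e) * ennreal (exp (- a * e)) \<partial>lborel)"
    by (subst nn_integral_density) auto
  also have "\<dots> = (\<integral>\<^sup>+e. ennreal (1 / (a + 1)) * ennreal (exponential_density (a + 1) e) \<partial>lborel)"
  proof (rule nn_integral_cong)
    fix e :: real
    have "exponential_density 1 e * exp (- a * e) = 1 / (a + 1) * exponential_density (a + 1) e"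
      using assms by (simp add: exponential_density_def exp_add[symmetric] field_simps)
    then show "ennreal (exponential_density 1 e) * ennreal (exp (- a * e)) =
        ennreal (1 / (a + 1)) * ennreal (exponential_density (a + 1) e)"
      using assms exponential_density_nonneg[of 1 e] exponential_density_nonneg[OF assms, of e]
      by (simp only: ennreal_mult[symmetric] exp_ge_zero zero_le_divide_1_iff less_imp_le zero_less_one)
  qed
  also have "\<dots> = ennreal (1 / (a + 1)) * emeasure (density lborel (exponential_density (a + 1))) UNIV"
    by (subst nn_integral_cmult) (auto simp: emeasure_density)
  also have "emeasure (density lborel (exponential_density (a + 1))) UNIV = 1"
    using E.emeasure_space_1 by simp
  finally show ?thesis by simp
qed

lemma AE_exponential_pos: "AE e in density lborel (exponential_density 1). 0 < e"
proof -
  have "AE e in lborel. e \<noteq> (0::real)" by (rule AE_lborel_singleton)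
  then show ?thesis
    by (subst AE_density) (auto elim!: eventually_mono simp: exponential_density_def split: if_splits)
qed

lemma AE_noise:
  assumes [measurable]: "Measurable.pred (borel \<Otimes>\<^sub>M count_space UNIV) P"
    and P: "\<And>e \<phi>. 0 < e \<Longrightarrow> \<phi> \<in> set_pmf (Pi_pmf UNIV undefined (jump_pmf G)) \<Longrightarrow> P (e, \<phi>)"
  shows "AE p in noise G. P p"
proof -
  have sp: "space (noise G) = UNIV"
    using sets_eq_imp_space_eq[OF sets_noise, of G] by (simp add: space_pair_measure)
  have "{p \<in> space (borel \<Otimes>\<^sub>M count_space UNIV). \<not> P p} \<in> sets (borel \<Otimes>\<^sub>M count_space UNIV)"
    by measurable
  then have [measurable]: "{p. \<not> P p} \<in> sets (borel \<Otimes>\<^sub>M count_space UNIV)"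
    by (simp add: space_pair_measure)
  have "emeasure (noise G) {p. \<not> P p} = (\<integral>\<^sup>+p. indicator {p. \<not> P p} p \<partial>noise G)"
    by (subst nn_integral_indicator) (auto simp: sets_noise)
  also have "\<dots> = (\<integral>\<^sup>+e. (\<integral>\<^sup>+\<phi>. indicator {p. \<not> P p} (e, \<phi>)
      \<partial>measure_pmf (Pi_pmf UNIV undefined (jump_pmf G))) \<partial>density lborel (exponential_density 1))"
    by (rule nn_integral_noise) measurable
  also have "\<dots> = (\<integral>\<^sup>+e. 0 \<partial>density lborel (exponential_density 1))"
  proof (rule nn_integral_cong_AE, rule eventually_mono[OF AE_exponential_pos])
    fix e :: real assume "0 < e"
    then have "(\<integral>\<^sup>+\<phi>. indicator {p. \<not> P p} (e, \<phi>) \<partial>measure_pmf (Pi_pmf UNIV undefined (jump_pmf G))) =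
        (\<integral>\<^sup>+\<phi>. 0 \<partial>measure_pmf (Pi_pmf UNIV undefined (jump_pmf G)))"
      using P by (intro nn_integral_cong_AE) (auto simp: AE_measure_pmf_iff)
    then show "(\<integral>\<^sup>+\<phi>. indicator {p. \<not> P p} (e, \<phi>) \<partial>measure_pmf (Pi_pmf UNIV undefined (jump_pmf G))) = 0"
      by simp
  qed
  finally have "emeasure (noise G) {p. \<not> P p} = 0" by simp
  then show ?thesis by (intro AE_I[of _ _ "{p. \<not> P p}"]) (auto simp: sets_noise)
qed

text \<open>
  The sum of the independent exponential variables diverges because the mean of
  \<open>exp (- (e\<^sub>0 + e\<^sub>1 + \<dots>))\<close> is zero: removing \<open>e\<^sub>0\<close> does not change this mean, while it divides it by
  \<open>E exp (- e\<^sub>0) = 1/2\<close>.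
\<close>

lemma AE_good_noise: "AE s in stream_space (noise G). good_noise s"
proof -
  interpret N: prob_space "noise G" by (rule prob_space_noise)
  interpret S: prob_space "stream_space (noise G)" by (rule N.prob_space_stream_space)
  have pos: "AE p in noise G. 0 < fst p"
    by (rule AE_noise) auto
  have all_pos: "AE s in stream_space (noise G). \<forall>k. 0 < fst (s !! k)"
  proof -
    have "AE s in stream_space (noise G). stream_all (\<lambda>p. 0 < fst p) s"
      by (rule N.AE_stream_all[OF _ pos]) measurable
    then show ?thesis by (auto elim!: eventually_mono simp: snth_sset)
  qed
  define L where "L s = ennreal (exp_neg 1 (\<Sum>k. ennreal (fst (s !! k))))"
    for s :: "(real \<times> ('a \<Rightarrow> 'a)) stream"
  have [measurable]: "L \<in> borel_measurable (stream_space (borel \<Otimes>\<^sub>M count_space UNIV))"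
    unfolding L_def by measurable
  have L_Cons: "L (p ## s) = ennreal (exp (- fst p)) * L s" if "0 < fst p" for p s
  proof -
    have "(\<Sum>k. ennreal (fst ((p ## s) !! k))) = ennreal (fst p) + (\<Sum>k. ennreal (fst (s !! k)))"
      using suminf_offset[of "\<lambda>k. ennreal (fst ((p ## s) !! k))" 1] by simp
    then show ?thesis
      unfolding L_def using that by (simp add: exp_neg_add ennreal_mult)
  qed
  let ?I = "\<integral>\<^sup>+s. L s \<partial>stream_space (noise G)"
  have "?I = (\<integral>\<^sup>+p. (\<integral>\<^sup>+s. L (p ## s) \<partial>stream_space (noise G)) \<partial>noise G)"
    by (rule N.nn_integral_stream_space) measurable
  also have "\<dots> = (\<integral>\<^sup>+p. ennreal (exp (- fst p)) * ?I \<partial>noise G)"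
    by (rule nn_integral_cong_AE, rule eventually_mono[OF pos])
      (simp add: L_Cons nn_integral_cmult)
  also have "\<dots> = (\<integral>\<^sup>+p. ennreal (exp (- fst p)) \<partial>noise G) * ?I"
    by (rule nn_integral_multc) measurable
  also have "(\<integral>\<^sup>+p. ennreal (exp (- fst p)) \<partial>noise G) = ennreal (1 / 2)"
    using nn_integral_exp_exponential[of 1] by (subst nn_integral_noise) auto
  finally have half: "?I = ennreal (1 / 2) * ?I" .
  have "?I \<le> (\<integral>\<^sup>+s. 1 \<partial>stream_space (noise G))"
    unfolding L_def by (intro nn_integral_mono) (simp add: exp_neg_le_1 ennreal_leI flip: ennreal_1)
  then have "?I \<le> 1" by (simp add: S.emeasure_space_1)
  then obtain i where i: "?I = ennreal i" "0 \<le> i" by (cases ?I) (auto simp: top_unique)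
  have "i = 1 / 2 * i"
    using half i by (simp add: ennreal_mult[symmetric] del: ennreal_half)
  then have "?I = 0" using i by simp
  then have "AE s in stream_space (noise G). L s = 0"
    by (subst (asm) nn_integral_0_iff_AE) auto
  then show ?thesis
    using all_pos
  proof eventually_elim
    case (elim s)
    then have "exp_neg 1 (\<Sum>k. ennreal (fst (s !! k))) \<le> 0" by (simp add: L_def ennreal_eq_0_iff)
    then have "(\<Sum>k. ennreal (fst (s !! k))) = \<infinity>"
      by (auto simp: exp_neg_def split: if_splits)
    then show ?case using elim by (simp add: good_noise_def)
  qed
qed

context generator
begin

lemma pmf_jump:
  assumes "G x x \<noteq> 0"
  shows "pmf (jump_pmf G x) y = (if y = x then 0 else G x y / - G x x)"
proof -
  have neg: "G x x < 0" using assms diag_nonpos[of x] by simp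
  have "(\<Sum>y\<in>UNIV. if y = x then 0 else G x y / - G x x) = (\<Sum>y\<in>UNIV - {x}. G x y / - G x x)"
    by (rule sum.mono_neutral_cong_right) auto
  also have "\<dots> = 1"
    using neg diag[of x] by (simp add: sum_divide_distrib[symmetric] sum_negf)
  finally have "(\<integral>\<^sup>+y. ennreal (if y = x then 0 else G x y / - G x x) \<partial>count_space UNIV) = 1"
    using neg off_nonneg
    by (subst nn_integral_count_space_finite) (auto simp: sum_ennreal divide_nonneg_neg)
  then have "pmf (embed_pmf (\<lambda>y. if y = x then 0 else G x y / - G x x)) y = (if y = x then 0 else G x y / - G x x)"
    using neg off_nonneg by (intro pmf_embed_pmf) (auto simp: divide_nonneg_neg)
  then show ?thesis
    unfolding jump_pmf_def using assms by (simp only: if_False)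
qed

text \<open>
  Conditioning on the first jump. If on typical samples \<open>f\<close> is a function \<open>K\<close> of the first exponential
  variable and of the restarted sample, then the restarted sample can be integrated as a fresh chain
  from the state jumped to: the noise stream splits off its head as an independent factor, and the
  value at \<open>x\<close> of the random self-map has law \<open>jump_pmf G x\<close>.
\<close>

lemma first_step:
  assumes f[measurable]: "f \<in> borel_measurable sample_space"
    and K[measurable]: "(\<lambda>(e, \<omega>). K e \<omega>) \<in> borel_measurable (borel \<Otimes>\<^sub>M sample_space)"
    and q: "G x x \<noteq> 0"
    and step: "\<And>\<omega>. fst \<omega> = x \<Longrightarrow> good_noise (snd \<omega>) \<Longrightarrow> fst (after_jump \<omega>) \<noteq> x \<Longrightarrow>
      f \<omega> = K (fst (shd (snd \<omega>))) (after_jump \<omega>)"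
  shows "(\<integral>\<^sup>+\<omega>. f \<omega> \<partial>chain_from G x) =
    (\<integral>\<^sup>+e. (\<Sum>z\<in>UNIV. ennreal (pmf (jump_pmf G x) z) * (\<integral>\<^sup>+\<omega>. K e \<omega> \<partial>chain_from G z))
      \<partial>density lborel (exponential_density 1))"
proof -
  interpret N: prob_space "noise G" by (rule prob_space_noise)
  interpret S: prob_space "stream_space (noise G)" by (rule N.prob_space_stream_space)
  let ?S = "stream_space (noise G)"
  let ?J = "Pi_pmf UNIV undefined (jump_pmf G)"
  let ?E = "density lborel (exponential_density 1)"
  have comp: "map_pmf (\<lambda>\<phi>. \<phi> x) ?J = jump_pmf G x"
    by (simp add: Pi_pmf_component)
  have moves: "\<phi> x \<noteq> x" if "\<phi> \<in> set_pmf ?J" for \<phi>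
  proof -
    have "\<phi> x \<in> set_pmf (jump_pmf G x)" unfolding comp[symmetric] using that by simp
    then show ?thesis using q by (auto simp: set_pmf_iff pmf_jump)
  qed
  \<comment> \<open>excludes the null event that the random map fixes \<open>x\<close>; on it the return time would not be restarted\<close>
  have AE_moves: "AE s in ?S. snd (shd s) x \<noteq> x"
  proof -
    have [measurable]: "Measurable.pred (count_space UNIV) (\<lambda>\<phi>. \<phi> x \<noteq> x)" by simp
    have "AE s in ?S. stream_all (\<lambda>p. snd p x \<noteq> x) s"
      using moves by (intro N.AE_stream_all AE_noise) auto
    then show ?thesis by (auto elim!: eventually_mono simp: shd_sset)
  qed
  have Kx [measurable]: "(\<lambda>s. K (fst (shd s)) (after_jump (x, s))) \<in> borel_measurable (stream_space (borel \<Otimes>\<^sub>M count_space UNIV))"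
    by (rule measurable_compose[OF _ K, of "\<lambda>s. (fst (shd s), after_jump (x, s))", simplified]) measurable
  have Kx': "(\<lambda>s. K (fst (shd s)) (after_jump (x, s))) \<in> borel_measurable ?S"
    by measurable
  have Ke [measurable]: "K e \<in> borel_measurable sample_space" for e
    using measurable_compose[OF _ K, of "\<lambda>\<omega>. (e, \<omega>)"] by simp
  have "(\<integral>\<^sup>+\<omega>. f \<omega> \<partial>chain_from G x) = (\<integral>\<^sup>+s. f (x, s) \<partial>?S)"
    by (rule nn_integral_chain_from) fact
  also have "\<dots> = (\<integral>\<^sup>+s. K (fst (shd s)) (after_jump (x, s)) \<partial>?S)"
    using AE_good_noise AE_moves
    by (intro nn_integral_cong_AE, eventually_elim) (simp add: step after_jump_def)
  also have "\<dots> = (\<integral>\<^sup>+p. (\<integral>\<^sup>+s. K (fst p) (snd p x, s) \<partial>?S) \<partial>noise G)"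
    using N.nn_integral_stream_space[OF Kx'] by (simp add: after_jump_def)
  also have "\<dots> = (\<integral>\<^sup>+p. (\<integral>\<^sup>+\<omega>. K (fst p) \<omega> \<partial>chain_from G (snd p x)) \<partial>noise G)"
    by (simp add: nn_integral_chain_from)
  also have "\<dots> = (\<integral>\<^sup>+e. (\<integral>\<^sup>+\<phi>. (\<integral>\<^sup>+\<omega>. K e \<omega> \<partial>chain_from G (\<phi> x)) \<partial>measure_pmf ?J) \<partial>?E)"
  proof (subst nn_integral_noise)
    have "(\<lambda>p. \<integral>\<^sup>+\<omega>. K (fst p) \<omega> \<partial>chain_from G z) \<in> borel_measurable (borel \<Otimes>\<^sub>M count_space UNIV)" for z
    proof -
      interpret C: prob_space "chain_from G z" by (rule prob_space_chain)
      show ?thesis by measurable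
    qed
    moreover have "(\<lambda>p. snd p x) \<in> measurable (borel \<Otimes>\<^sub>M count_space UNIV) (count_space UNIV)"
      by (rule measurable_compose[OF measurable_snd]) simp
    ultimately show "(\<lambda>p. \<integral>\<^sup>+\<omega>. K (fst p) \<omega> \<partial>chain_from G (snd p x)) \<in> borel_measurable (borel \<Otimes>\<^sub>M count_space UNIV)"
      by (rule measurable_compose_countable)
  qed simp
  also have "\<dots> = (\<integral>\<^sup>+e. (\<integral>\<^sup>+z. (\<integral>\<^sup>+\<omega>. K e \<omega> \<partial>chain_from G z) \<partial>measure_pmf (jump_pmf G x)) \<partial>?E)"
    unfolding comp[symmetric] by simp
  also have "\<dots> = (\<integral>\<^sup>+e. (\<Sum>z\<in>UNIV. ennreal (pmf (jump_pmf G x) z) * (\<integral>\<^sup>+\<omega>. K e \<omega> \<partial>chain_from G z)) \<partial>?E)"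
  proof (rule nn_integral_cong)
    fix e
    have "(\<integral>\<^sup>+z. (\<integral>\<^sup>+\<omega>. K e \<omega> \<partial>chain_from G z) \<partial>measure_pmf (jump_pmf G x)) =
        (\<Sum>z\<in>set_pmf (jump_pmf G x). (\<integral>\<^sup>+\<omega>. K e \<omega> \<partial>chain_from G z) * ennreal (pmf (jump_pmf G x) z))"
      by (rule nn_integral_measure_pmf_finite) auto
    also have "\<dots> = (\<Sum>z\<in>UNIV. (\<integral>\<^sup>+\<omega>. K e \<omega> \<partial>chain_from G z) * ennreal (pmf (jump_pmf G x) z))"
      by (rule sum.mono_neutral_left) (auto simp: set_pmf_iff)
    finally show "(\<integral>\<^sup>+z. (\<integral>\<^sup>+\<omega>. K e \<omega> \<partial>chain_from G z) \<partial>measure_pmf (jump_pmf G x)) =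
        (\<Sum>z\<in>UNIV. ennreal (pmf (jump_pmf G x) z) * (\<integral>\<^sup>+\<omega>. K e \<omega> \<partial>chain_from G z))"
      by (simp only: mult.commute)
  qed
  finally show ?thesis .
qed

end

lemma ennreal_integral_chain:
  assumes [measurable]: "f \<in> borel_measurable sample_space"
    and f: "\<And>\<omega>. 0 \<le> f \<omega>" "\<And>\<omega>. f \<omega> \<le> (1::real)"
  shows "ennreal (\<integral>\<omega>. f \<omega> \<partial>chain G \<nu>) = (\<integral>\<^sup>+\<omega>. ennreal (f \<omega>) \<partial>chain G \<nu>)"
proof -
  interpret C: prob_space "chain G \<nu>" by (rule prob_space_chain)
  have "integrable (chain G \<nu>) f"
    using f by (intro C.integrable_const_bound[of _ 1]) auto
  then show ?thesis using f by (simp add: nn_integral_eq_integral)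
qed

lemma integral_chain_bounds:
  assumes [measurable]: "f \<in> borel_measurable sample_space"
    and f: "\<And>\<omega>. 0 \<le> f \<omega>" "\<And>\<omega>. f \<omega> \<le> (1::real)"
  shows "0 \<le> (\<integral>\<omega>. f \<omega> \<partial>chain G \<nu>)" "(\<integral>\<omega>. f \<omega> \<partial>chain G \<nu>) \<le> 1"
proof -
  interpret C: prob_space "chain G \<nu>" by (rule prob_space_chain)
  show "0 \<le> (\<integral>\<omega>. f \<omega> \<partial>chain G \<nu>)" using f by (intro integral_nonneg_AE) auto
  show "(\<integral>\<omega>. f \<omega> \<partial>chain G \<nu>) \<le> 1"
    using f by (intro C.integral_le_const C.integrable_const_bound[of _ 1]) auto
qed

lemma integral_chain:
  assumes m[measurable]: "f \<in> borel_measurable sample_space"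
    and f: "\<And>\<omega>. 0 \<le> f \<omega>" "\<And>\<omega>. f \<omega> \<le> (1::real)"
  shows "(\<integral>\<omega>. f \<omega> \<partial>chain G \<nu>) = (\<Sum>x\<in>UNIV. pmf \<nu> x * (\<integral>\<omega>. f \<omega> \<partial>chain_from G x))"
proof -
  note b = integral_chain_bounds[OF m f]
  have "ennreal (\<integral>\<omega>. f \<omega> \<partial>chain G \<nu>) =
      (\<Sum>x\<in>UNIV. ennreal (pmf \<nu> x) * ennreal (\<integral>\<omega>. f \<omega> \<partial>chain_from G x))"
    unfolding ennreal_integral_chain[OF m f] by (rule nn_integral_chain) measurable
  also have "\<dots> = ennreal (\<Sum>x\<in>UNIV. pmf \<nu> x * (\<integral>\<omega>. f \<omega> \<partial>chain_from G x))"
    using b by (simp add: ennreal_mult[symmetric] sum_ennreal)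
  finally show ?thesis
    using b by (subst (asm) ennreal_inj) (auto intro!: sum_nonneg)
qed

lemma prob_chain_integral:
  assumes "Measurable.pred sample_space P"
  shows "\<P>(\<omega> in chain H \<nu>. P \<omega>) = (\<integral>\<omega>. (if P \<omega> then 1 else 0) \<partial>chain H \<nu>)"
proof -
  have "(\<integral>\<omega>. (if P \<omega> then 1 else 0) \<partial>chain H \<nu>) = (\<integral>\<omega>. indicat_real {\<omega>. P \<omega>} \<omega> \<partial>chain H \<nu>)"
    by (intro Bochner_Integration.integral_cong) (auto simp: indicator_def)
  also have "\<dots> = \<P>(\<omega> in chain H \<nu>. P \<omega>)" by simp
  finally show ?thesis by simp
qed

lemma AE_chain_good:
  assumes [measurable]: "Measurable.pred sample_space P"
    and P: "\<And>\<omega>. fst \<omega> = x \<Longrightarrow> good_noise (snd \<omega>) \<Longrightarrow> P \<omega>"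
  shows "AE \<omega> in chain_from G x. P \<omega>"
proof (rule AE_chain_from)
  show "AE s in stream_space (noise G). P (x, s)"
    using AE_good_noise by (rule eventually_mono) (auto intro: P)
qed measurable

lemma integral_chain_const:
  assumes [measurable]: "f \<in> borel_measurable sample_space"
    and P: "\<And>\<omega>. fst \<omega> = x \<Longrightarrow> good_noise (snd \<omega>) \<Longrightarrow> f \<omega> = (c::real)"
  shows "(\<integral>\<omega>. f \<omega> \<partial>chain_from G x) = c"
proof -
  interpret C: prob_space "chain_from G x" by (rule prob_space_chain)
  have "AE \<omega> in chain_from G x. f \<omega> = c"
    using P by (intro AE_chain_good) auto
  then have "(\<integral>\<omega>. f \<omega> \<partial>chain_from G x) = (\<integral>\<omega>. c \<partial>chain_from G x)"
    by (intro integral_cong_AE) auto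
  then show ?thesis using C.prob_space by simp
qed

context generator
begin

text \<open>
  Averages over the jump law are what the generator computes, up to its diagonal term.
\<close>

lemma jump_average:
  assumes "G x x \<noteq> 0"
  shows "- G x x * (\<Sum>z\<in>UNIV. pmf (jump_pmf G x) z * u z) = gen_apply G u x - G x x * u x"
proof -
  have "- G x x * (\<Sum>z\<in>UNIV. pmf (jump_pmf G x) z * u z) = (\<Sum>z\<in>UNIV. if z = x then 0 else G x z * u z)"
    unfolding sum_distrib_left using assms by (intro sum.cong) (auto simp: pmf_jump)
  also have "\<dots> = (\<Sum>z\<in>UNIV - {x}. G x z * u z)"
    by (rule sum.mono_neutral_cong_right) auto
  also have "\<dots> = gen_apply G u x - G x x * u x"
    unfolding gen_apply_def by (subst sum.remove[of UNIV x]) auto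
  finally show ?thesis .
qed

text \<open>
  The discounted form of \<open>first_step\<close>. The factor \<open>1 / (a + 1)\<close> is the Laplace transform of a standard
  exponential variable at \<open>a\<close>; \<open>a = 0\<close> gives the undiscounted averages used for hitting probabilities.
\<close>

lemma first_step_product:
  assumes f[measurable]: "f \<in> borel_measurable sample_space" and g[measurable]: "g \<in> borel_measurable sample_space"
    and fb: "\<And>\<omega>. 0 \<le> f \<omega>" "\<And>\<omega>. f \<omega> \<le> (1::real)"
    and gb: "\<And>\<omega>. 0 \<le> g \<omega>" "\<And>\<omega>. g \<omega> \<le> (1::real)"
    and q: "G x x \<noteq> 0" and a: "0 \<le> a"
    and step: "\<And>\<omega>. fst \<omega> = x \<Longrightarrow> good_noise (snd \<omega>) \<Longrightarrow> fst (after_jump \<omega>) \<noteq> x \<Longrightarrow>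
      f \<omega> = exp (- a * fst (shd (snd \<omega>))) * g (after_jump \<omega>)"
  shows "(\<integral>\<omega>. f \<omega> \<partial>chain_from G x) =
    (\<Sum>z\<in>UNIV. pmf (jump_pmf G x) z * (\<integral>\<omega>. g \<omega> \<partial>chain_from G z)) / (a + 1)"
proof -
  note bf = integral_chain_bounds[OF f fb] and bg = integral_chain_bounds[OF g gb]
  let ?m = "\<Sum>z\<in>UNIV. pmf (jump_pmf G x) z * (\<integral>\<omega>. g \<omega> \<partial>chain_from G z)"
  have m: "0 \<le> ?m" using bg by (intro sum_nonneg) auto
  have "ennreal (\<integral>\<omega>. f \<omega> \<partial>chain_from G x) = (\<integral>\<^sup>+\<omega>. ennreal (f \<omega>) \<partial>chain_from G x)"
    by (rule ennreal_integral_chain[OF f fb])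
  also have "\<dots> = (\<integral>\<^sup>+e. (\<Sum>z\<in>UNIV. ennreal (pmf (jump_pmf G x) z) *
      (\<integral>\<^sup>+\<omega>. ennreal (exp (- a * e)) * ennreal (g \<omega>) \<partial>chain_from G z))
      \<partial>density lborel (exponential_density 1))"
    using q by (intro first_step) (auto simp: step ennreal_mult gb)
  also have "\<dots> = (\<integral>\<^sup>+e. ennreal ?m * ennreal (exp (- a * e)) \<partial>density lborel (exponential_density 1))"
  proof (rule nn_integral_cong)
    fix e
    have "(\<integral>\<^sup>+\<omega>. ennreal (exp (- a * e)) * ennreal (g \<omega>) \<partial>chain_from G z) =
        ennreal (exp (- a * e)) * ennreal (\<integral>\<omega>. g \<omega> \<partial>chain_from G z)" for z
      unfolding ennreal_integral_chain[OF g gb] by (rule nn_integral_cmult) measurable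
    then have "(\<Sum>z\<in>UNIV. ennreal (pmf (jump_pmf G x) z) *
        (\<integral>\<^sup>+\<omega>. ennreal (exp (- a * e)) * ennreal (g \<omega>) \<partial>chain_from G z)) =
      (\<Sum>z\<in>UNIV. ennreal (pmf (jump_pmf G x) z * (\<integral>\<omega>. g \<omega> \<partial>chain_from G z) * exp (- a * e)))"
      using bg by (simp add: ennreal_mult[symmetric] ac_simps)
    also have "\<dots> = ennreal (?m * exp (- a * e))"
      using bg by (subst sum_ennreal) (auto simp: sum_distrib_right)
    finally show "(\<Sum>z\<in>UNIV. ennreal (pmf (jump_pmf G x) z) *
        (\<integral>\<^sup>+\<omega>. ennreal (exp (- a * e)) * ennreal (g \<omega>) \<partial>chain_from G z)) =
      ennreal ?m * ennreal (exp (- a * e))"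
      using m by (simp add: ennreal_mult)
  qed
  also have "\<dots> = ennreal ?m * ennreal (1 / (a + 1))"
    using a by (subst nn_integral_cmult) (simp, simp only: nn_integral_exp_exponential[of a])
  also have "\<dots> = ennreal (?m / (a + 1))"
    using m a by (simp add: ennreal_mult[symmetric])
  finally show ?thesis
    using bf m a by (subst (asm) ennreal_inj) auto
qed

section \<open>Laplace transforms of hitting times, and capacities\<close>

definition laplace_hit :: "real \<Rightarrow> 'a set \<Rightarrow> 'a \<Rightarrow> real" where
  "laplace_hit l A x = (\<integral>\<omega>. exp_neg l (hit_time G A \<omega>) \<partial>chain_from G x)"

lemma laplace_hit_bounds: "0 \<le> l \<Longrightarrow> 0 \<le> laplace_hit l A x" "0 \<le> l \<Longrightarrow> laplace_hit l A x \<le> 1"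
  unfolding laplace_hit_def using integral_chain_bounds[of "\<lambda>\<omega>. exp_neg l (hit_time G A \<omega>)"]
  by (auto simp: exp_neg_le_1)

lemma laplace_hit_start: "x \<in> A \<Longrightarrow> laplace_hit l A x = 1"
  unfolding laplace_hit_def
  by (intro integral_chain_const) (auto simp: hit_time_start exp_neg_def)

text \<open>
  From \<open>x\<close> outside \<open>A\<close> the first holding time is exponential of rate \<open>q = - G x x\<close> and contributes the
  factor \<open>q / (q + l)\<close>; clearing denominators turns the first-step identity into the resolvent
  equation. At an absorbing point both sides vanish, as \<open>A\<close> is never hit.
\<close>

lemma laplace_hit_equation:
  assumes l: "0 < l" and x: "x \<notin> A"
  shows "gen_apply G (laplace_hit l A) x = l * laplace_hit l A x"
proof (cases "G x x = 0")
  case True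
  have "laplace_hit l A x = 0"
    unfolding laplace_hit_def using True x
    by (intro integral_chain_const) (auto simp: hit_time_absorbing exp_neg_def)
  then show ?thesis using absorbing_row[OF True] by (simp add: gen_apply_def)
next
  case False
  then have q: "0 < - G x x" using diag_nonpos[of x] by simp
  have "exp_neg l (hit_time G A \<omega>) = exp (- (l / - G x x) * fst (shd (snd \<omega>))) * exp_neg l (hit_time G A (after_jump \<omega>))"
    if "fst \<omega> = x" "good_noise (snd \<omega>)" for \<omega>
  proof -
    have "0 < fst (snd \<omega> !! 0)" using that by (simp only: good_noise_def)
    then have "0 \<le> fst (shd (snd \<omega>)) / - G x x" using q by (intro divide_nonneg_pos) auto
    then show ?thesis
      using hit_time_step[OF that(2), of A] that x False by (simp add: exp_neg_add mult.commute del: divide_minus_right)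
  qed
  then have "laplace_hit l A x =
      (\<Sum>z\<in>UNIV. pmf (jump_pmf G x) z * laplace_hit l A z) / (l / - G x x + 1)"
    unfolding laplace_hit_def using l q False
    by (intro first_step_product) (auto simp: exp_neg_le_1 simp del: divide_minus_right)
  moreover have "l / - G x x + 1 = (l - G x x) / - G x x"
    using q by (simp add: field_simps)
  ultimately have "(l - G x x) * laplace_hit l A x =
      - G x x * (\<Sum>z\<in>UNIV. pmf (jump_pmf G x) z * laplace_hit l A z)"
    using q l by (simp add: field_simps)
  then show ?thesis unfolding jump_average[OF False] by (simp add: algebra_simps)
qed

definition hits_before :: "'a set \<Rightarrow> 'a set \<Rightarrow> 'a \<Rightarrow> real" where
  "hits_before B A x = \<P>(\<omega> in chain_from G x. hit_time G A \<omega> > hit_time G B \<omega>)"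

lemma hits_before_integral:
  "hits_before B A x = (\<integral>\<omega>. (if hit_time G A \<omega> > hit_time G B \<omega> then 1 else 0) \<partial>chain_from G x)"
  unfolding hits_before_def by (rule prob_chain_integral) measurable

lemma hits_before_start:
  "x \<in> A \<Longrightarrow> hits_before B A x = 0"
  "x \<in> B \<Longrightarrow> x \<notin> A \<Longrightarrow> hits_before B A x = 1"
  unfolding hits_before_integral
  by (intro integral_chain_const; auto simp: hit_time_start hit_time_pos)+

lemma hits_before_equation:
  assumes x: "x \<notin> A" "x \<notin> B"
  shows "gen_apply G (hits_before B A) x = 0"
proof (cases "G x x = 0")
  case True
  then show ?thesis using absorbing_row[OF True] by (simp add: gen_apply_def)
next
  case False
  have "hits_before B A x = (\<Sum>z\<in>UNIV. pmf (jump_pmf G x) z * hits_before B A z) / (0 + 1)"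
    unfolding hits_before_integral using False x
    by (intro first_step_product) (auto simp: hit_time_step)
  then show ?thesis using jump_average[OF False, of "hits_before B A"] by (simp add: algebra_simps)
qed

text \<open>
  The first holding time is added to both return times, so it does not affect which one is smaller.
\<close>

lemma return_time_prob:
  assumes q: "G x x \<noteq> 0"
  shows "- G x x * \<P>(\<omega> in chain_from G x. return_time G A \<omega> > return_time G B \<omega>) =
    gen_apply G (hits_before B A) x - G x x * hits_before B A x"
proof -
  have "\<P>(\<omega> in chain_from G x. return_time G A \<omega> > return_time G B \<omega>) =
      (\<Sum>z\<in>UNIV. pmf (jump_pmf G x) z * hits_before B A z) / (0 + 1)"
    unfolding hits_before_integral using q
    by (subst prob_chain_integral, measurable, intro first_step_product) (auto simp: return_time_step)
  then show ?thesis using jump_average[OF q, of "hits_before B A"] by simp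
qed

text \<open>
  The exit rate in the definition of the capacity turns the jump law into the generator, and the
  hitting probability vanishes on \<open>A\<close>; so the capacity is the flux of the potential out of \<open>A\<close>.
\<close>

lemma cap_eq:
  assumes "A \<inter> B = {}"
  shows "cap A B G \<pi> = (\<Sum>x\<in>A. pmf \<pi> x * gen_apply G (hits_before B A) x)"
  unfolding cap_def
proof (rule sum.cong[OF refl])
  fix x assume x: "x \<in> A"
  show "pmf \<pi> x * (- G x x) * \<P>(\<omega> in chain_from G x. return_time G A \<omega> > return_time G B \<omega>) =
      pmf \<pi> x * gen_apply G (hits_before B A) x"
  proof (cases "G x x = 0")
    case True
    then show ?thesis using absorbing_row[OF True] by (simp add: gen_apply_def)
  next
    case False
    then show ?thesis using return_time_prob[OF False, where A = A and B = B] hits_before_start(1)[OF x, of B]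
      by (simp only: mult.assoc mult_zero_right diff_zero)
  qed
qed

section \<open>The transition semigroup\<close>

lemma trans_prob_integral:
  "trans_prob G t x y = (\<integral>\<omega>. (if X G t \<omega> = y then 1 else 0) \<partial>chain_from G x)"
  unfolding trans_prob_def by (rule prob_chain_integral) measurable

lemma trans_prob_bounds: "0 \<le> trans_prob G t x y" "trans_prob G t x y \<le> 1"
  unfolding trans_prob_integral by (rule integral_chain_bounds; auto)+

lemma trans_prob_0: "trans_prob G 0 x y = (if x = y then 1 else 0)"
  unfolding trans_prob_integral by (rule integral_chain_const) (auto simp: X_0)

lemma trans_prob_absorbing:
  assumes "G x x = 0" shows "trans_prob G t x y = (if x = y then 1 else 0)"
  unfolding trans_prob_integral using assms
  by (intro integral_chain_const) (auto simp: X_before_jump holding_time_def)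

lemma trans_prob_sum: "(\<Sum>y\<in>UNIV. trans_prob G t x y) = 1"
proof -
  interpret C: prob_space "chain_from G x" by (rule prob_space_chain)
  have "(\<Sum>y\<in>UNIV. trans_prob G t x y) = (\<integral>\<omega>. (\<Sum>y\<in>UNIV. if X G t \<omega> = y then 1 else 0) \<partial>chain_from G x)"
    unfolding trans_prob_integral
    by (subst Bochner_Integration.integral_sum)
      (auto intro!: C.integrable_const_bound[of _ 1])
  also have "\<dots> = 1" using C.prob_space by simp
  finally show ?thesis .
qed

lemma measurable_trans_prob [measurable]: "(\<lambda>t. trans_prob G t x y) \<in> borel_measurable borel"
proof -
  interpret C: prob_space "chain_from G x" by (rule prob_space_chain)
  have "sets (borel \<Otimes>\<^sub>M chain_from G x) = sets (borel \<Otimes>\<^sub>M sample_space)"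
    by (intro sets_pair_measure_cong sets_chain refl)
  then have [measurable]: "(\<lambda>p. X G (fst p) (snd p)) \<in> measurable (borel \<Otimes>\<^sub>M chain_from G x) (count_space UNIV)"
    using measurable_X_pair[of G] measurable_cong_sets by (force simp: case_prod_unfold)
  have "(\<lambda>p. if X G (fst p) (snd p) = y then 1 else 0 :: real) \<in> borel_measurable (borel \<Otimes>\<^sub>M chain_from G x)"
    by measurable
  then have "(\<lambda>t. \<integral>\<omega>. (if X G t \<omega> = y then 1 else 0 :: real) \<partial>chain_from G x) \<in> borel_measurable borel"
    by (intro C.borel_measurable_lebesgue_integral) (simp add: case_prod_unfold)
  then show ?thesis unfolding trans_prob_integral .
qed

end

lemma nn_integral_Icc_eq_integral:
  fixes \<phi> :: "real \<Rightarrow> real"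
  assumes [measurable]: "\<phi> \<in> borel_measurable borel"
    and b: "\<And>r. r \<in> {0..t} \<Longrightarrow> 0 \<le> \<phi> r" "\<And>r. r \<in> {0..t} \<Longrightarrow> \<phi> r \<le> B"
  shows "(\<integral>\<^sup>+r. ennreal (indicator {0..t} r * \<phi> r) \<partial>lborel) = ennreal (integral {0..t} \<phi>)"
    and "\<phi> integrable_on {0..t}" and "0 \<le> integral {0..t} \<phi>"
proof -
  have int: "set_integrable lborel {0..t} \<phi>"
    unfolding set_integrable_def using b
    by (intro integrableI_bounded_set_indicator[where B = B]) (auto simp: emeasure_lborel_Icc_eq)
  note eq = set_borel_integral_eq_integral[OF int]
  have "(\<integral>\<^sup>+r. ennreal (indicator {0..t} r * \<phi> r) \<partial>lborel) = ennreal (\<integral>r. indicator {0..t} r * \<phi> r \<partial>lborel)"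
    using int b unfolding set_integrable_def
    by (intro nn_integral_eq_integral) (auto simp: indicator_def)
  also have "(\<integral>r. indicator {0..t} r * \<phi> r \<partial>lborel) = integral {0..t} \<phi>"
    using eq(2) by (simp add: set_lebesgue_integral_def)
  finally show "(\<integral>\<^sup>+r. ennreal (indicator {0..t} r * \<phi> r) \<partial>lborel) = ennreal (integral {0..t} \<phi>)" .
  show "\<phi> integrable_on {0..t}" by (rule eq(1))
  then show "0 \<le> integral {0..t} \<phi>" using b by (intro integral_nonneg) auto
qed

context generator
begin

text \<open>
  Either the first jump comes after \<open>t\<close>, which has probability \<open>exp (- q t)\<close>, or it leaves a remaining
  time \<open>r\<close> in \<open>[0, t]\<close>, whose density is \<open>q exp (- q (t - r))\<close>, to a chain started at the new state.
  Multiplying by \<open>exp (q t)\<close> removes \<open>t\<close> from the integrand, so that the equation can be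
  differentiated. Its integrand contains \<open>G\<close> without the diagonal term.
\<close>

lemma trans_prob_renewal:
  assumes t: "0 \<le> t"
  shows "exp (- G x x * t) * trans_prob G t x y = (if x = y then 1 else 0) +
    integral {0..t} (\<lambda>r. exp (- G x x * r) *
      (gen_apply G (\<lambda>z. trans_prob G r z y) x - G x x * trans_prob G r x y))"
proof (cases "G x x = 0")
  case True
  then show ?thesis
    using absorbing_row[OF True] by (simp add: trans_prob_absorbing gen_apply_def)
next
  case False
  define q where "q = - G x x"
  have q: "0 < q" using False diag_nonpos[of x] by (simp add: q_def)
  define \<delta> where "\<delta> = (if x = y then 1 else 0 :: real)"
  have \<delta>: "0 \<le> \<delta>" "\<delta> \<le> 1" by (auto simp: \<delta>_def)
  define m where "m r = (\<Sum>z\<in>UNIV. pmf (jump_pmf G x) z * trans_prob G r z y)" for r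
  have m0: "0 \<le> m r" for r unfolding m_def by (intro sum_nonneg) (auto simp: trans_prob_bounds)
  have p1: "(\<Sum>z\<in>UNIV. pmf (jump_pmf G x) z) = 1" by (rule sum_pmf_eq_1) auto
  have m1: "m r \<le> 1" for r
  proof -
    have "m r \<le> (\<Sum>z\<in>UNIV. pmf (jump_pmf G x) z * 1)"
      unfolding m_def by (intro sum_mono mult_left_mono) (auto simp: trans_prob_bounds)
    then show ?thesis using p1 by simp
  qed
  have [measurable]: "m \<in> borel_measurable borel" unfolding m_def by measurable
  have qm: "q * m r = gen_apply G (\<lambda>z. trans_prob G r z y) x - G x x * trans_prob G r x y" for r
    using jump_average[OF False] by (simp add: q_def m_def)
  define h where "h e = (if e / q \<le> t then m (t - e / q) else \<delta>)" for e
  have h: "0 \<le> h e" for e using m0 \<delta> by (simp add: h_def)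
  have [measurable]: "h \<in> borel_measurable borel" unfolding h_def by measurable
  define K where "K e \<omega> = (if e / q \<le> t then if X G (t - e / q) \<omega> = y then 1 else 0 else \<delta>)" for e \<omega>
  have step: "(if X G t \<omega> = y then 1 else 0) = K (fst (shd (snd \<omega>))) (after_jump \<omega>)"
    if \<omega>: "fst \<omega> = x" "good_noise (snd \<omega>)" for \<omega>
  proof -
    have "G (fst \<omega>) (fst \<omega>) \<noteq> 0" using False \<omega> by simp
    then obtain r where r: "r = fst (shd (snd \<omega>)) / q" "0 < r" "holding_time G \<omega> 0 = ennreal r"
      by (rule holding_time_0[OF \<omega>(2)]) (simp add: \<omega> q_def)
    show ?thesis
    proof (cases "r \<le> t")
      case True
      then show ?thesis using X_after_jump[OF \<omega>(2) r(3) _ True] r by (simp add: K_def)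
    next
      case False
      then have "X G t \<omega> = x"
        using t r \<omega> by (subst X_before_jump) (auto simp: ennreal_less_iff)
      then show ?thesis using False r by (simp add: K_def \<delta>_def)
    qed
  qed
  have K_int: "(\<integral>\<^sup>+\<omega>. ennreal (K e \<omega>) \<partial>chain_from G z) =
      ennreal (if e / q \<le> t then trans_prob G (t - e / q) z y else \<delta>)" for e z
  proof (cases "e / q \<le> t")
    case True
    have "ennreal (\<integral>\<omega>. (if X G (t - e / q) \<omega> = y then 1 else 0) \<partial>chain_from G z) =
        (\<integral>\<^sup>+\<omega>. ennreal (if X G (t - e / q) \<omega> = y then 1 else 0) \<partial>chain_from G z)"
      by (rule ennreal_integral_chain) auto
    then show ?thesis using True by (simp only: K_def trans_prob_integral if_True)
  next
    case False
    interpret C: prob_space "chain_from G z" by (rule prob_space_chain)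
    show ?thesis using False C.emeasure_space_1 by (simp add: K_def)
  qed
  have average: "(\<Sum>z\<in>UNIV. ennreal (pmf (jump_pmf G x) z) * (\<integral>\<^sup>+\<omega>. ennreal (K e \<omega>) \<partial>chain_from G z)) = ennreal (h e)" for e
  proof -
    have "(\<Sum>z\<in>UNIV. ennreal (pmf (jump_pmf G x) z) * (\<integral>\<^sup>+\<omega>. ennreal (K e \<omega>) \<partial>chain_from G z)) =
        ennreal (\<Sum>z\<in>UNIV. pmf (jump_pmf G x) z * (if e / q \<le> t then trans_prob G (t - e / q) z y else \<delta>))"
      unfolding K_int using \<delta> trans_prob_bounds
      by (simp add: ennreal_mult[symmetric] sum_ennreal)
    also have "(\<Sum>z\<in>UNIV. pmf (jump_pmf G x) z * (if e / q \<le> t then trans_prob G (t - e / q) z y else \<delta>)) = h e"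
      using p1 by (simp add: h_def m_def sum_distrib_right[symmetric])
    finally show ?thesis .
  qed
  let ?\<phi> = "\<lambda>r. q * exp (- q * (t - r)) * m r"
  have \<phi>_int: "(\<integral>\<^sup>+r. ennreal (indicator {0..t} r * ?\<phi> r) \<partial>lborel) = ennreal (integral {0..t} ?\<phi>)"
    and int0: "0 \<le> integral {0..t} ?\<phi>"
  proof -
    have "?\<phi> r \<le> q * 1 * 1" if "r \<in> {0..t}" for r
      using that q m0 m1 by (intro mult_mono) auto
    then show "(\<integral>\<^sup>+r. ennreal (indicator {0..t} r * ?\<phi> r) \<partial>lborel) = ennreal (integral {0..t} ?\<phi>)"
      "0 \<le> integral {0..t} ?\<phi>"
      using q m0 nn_integral_Icc_eq_integral[of ?\<phi> t "q * 1 * 1"] by auto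
  qed
  have "ennreal (trans_prob G t x y) = (\<integral>\<^sup>+\<omega>. ennreal (if X G t \<omega> = y then 1 else 0) \<partial>chain_from G x)"
    unfolding trans_prob_integral by (subst ennreal_integral_chain) auto
  also have "\<dots> = (\<integral>\<^sup>+e. (\<Sum>z\<in>UNIV. ennreal (pmf (jump_pmf G x) z) * (\<integral>\<^sup>+\<omega>. ennreal (K e \<omega>) \<partial>chain_from G z))
      \<partial>density lborel (exponential_density 1))"
  proof (rule first_step)
    show "(\<lambda>(e, \<omega>). ennreal (K e \<omega>)) \<in> borel_measurable (borel \<Otimes>\<^sub>M sample_space)"
      unfolding K_def by measurable
  qed (use False step in auto)
  also have "\<dots> = (\<integral>\<^sup>+e. ennreal (h e) \<partial>density lborel (exponential_density 1))"
    unfolding average ..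
  also have "\<dots> = (\<integral>\<^sup>+e. ennreal (exponential_density 1 e * h e) \<partial>lborel)"
    by (subst nn_integral_density) (auto simp: ennreal_mult h exponential_density_nonneg)
  \<comment> \<open>the substitution \<open>e = q (t - r)\<close>: \<open>r\<close> is the time left after the first jump, negative if that jump comes after \<open>t\<close>\<close>
  also have "\<dots> = \<bar>- q\<bar> * (\<integral>\<^sup>+r. ennreal (exponential_density 1 (q * t + (- q) * r) * h (q * t + (- q) * r)) \<partial>lborel)"
    using q by (intro nn_integral_real_affine) auto
  also have "\<dots> = (\<integral>\<^sup>+r. ennreal q * ennreal (exponential_density 1 (q * (t - r)) * h (q * (t - r))) \<partial>lborel)"
    using q by (subst nn_integral_cmult) (auto simp: algebra_simps)
  also have "\<dots> = (\<integral>\<^sup>+r. ennreal (\<delta> * exp (- q * t)) * ennreal (exponential_density q (0 + (-1) * r)) +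
      ennreal (indicator {0..t} r * ?\<phi> r) \<partial>lborel)"
  proof (rule nn_integral_cong_AE, rule eventually_mono[OF AE_lborel_singleton[of 0]])
    fix r :: real assume r: "r \<noteq> 0"
    have "q * (exponential_density 1 (q * (t - r)) * h (q * (t - r))) =
        \<delta> * exp (- q * t) * exponential_density q (0 + (-1) * r) + indicator {0..t} r * ?\<phi> r"
    proof -
      have hv: "h (q * (t - r)) = (if 0 \<le> r then m r else \<delta>)" using q by (simp add: h_def)
      consider "r < 0" | "0 < r" "r \<le> t" | "t < r" using r by linarith
      then show ?thesis
      proof cases
        case 1
        then have "\<not> q * (t - r) < 0" using q t by (auto simp: not_less)
        then show ?thesis using 1 q
          by (simp add: exponential_density_def hv mult_exp_exp) (simp add: algebra_simps)
      next
        case 2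
        then have "\<not> q * (t - r) < 0" using q t by (auto simp: not_less)
        then show ?thesis using 2 q by (simp add: exponential_density_def hv)
      next
        case 3
        then have "q * (t - r) < 0" using q by (simp add: mult_less_0_iff)
        then show ?thesis using 3 t by (simp add: exponential_density_def)
      qed
    qed
    moreover have "0 \<le> indicator {0..t} r * ?\<phi> r" using q m0 by simp
    ultimately show "ennreal q * ennreal (exponential_density 1 (q * (t - r)) * h (q * (t - r))) =
        ennreal (\<delta> * exp (- q * t)) * ennreal (exponential_density q (0 + (-1) * r)) +
        ennreal (indicator {0..t} r * ?\<phi> r)"
      using q h \<delta> exponential_density_nonneg[of 1] exponential_density_nonneg[OF q]
      by (simp only: ennreal_mult[symmetric] ennreal_plus[symmetric] mult_nonneg_nonneg less_imp_le
          exp_ge_zero zero_less_one)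
  qed
  also have "\<dots> = ennreal (\<delta> * exp (- q * t)) * (\<integral>\<^sup>+r. ennreal (exponential_density q (0 + (-1) * r)) \<partial>lborel) +
      (\<integral>\<^sup>+r. ennreal (indicator {0..t} r * ?\<phi> r) \<partial>lborel)"
    by (subst nn_integral_add) (auto simp: nn_integral_cmult)
  also have "(\<integral>\<^sup>+r. ennreal (exponential_density q (0 + (-1) * r)) \<partial>lborel) = 1"
  proof -
    interpret E: prob_space "density lborel (exponential_density q)"
      by (rule prob_space_exponential_density) fact
    have "1 = (\<integral>\<^sup>+r. ennreal (exponential_density q r) \<partial>lborel)"
      using E.emeasure_space_1 by (simp add: emeasure_density)
    also have "\<dots> = \<bar>-1 :: real\<bar> * (\<integral>\<^sup>+r. ennreal (exponential_density q (0 + (-1) * r)) \<partial>lborel)"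
      by (rule nn_integral_real_affine) auto
    finally show ?thesis by simp
  qed
  also note \<phi>_int
  finally have "ennreal (trans_prob G t x y) = ennreal (\<delta> * exp (- q * t) + integral {0..t} ?\<phi>)"
    using int0 \<delta> by simp
  then have eq: "trans_prob G t x y = \<delta> * exp (- q * t) + integral {0..t} ?\<phi>"
    using int0 \<delta> trans_prob_bounds by (subst (asm) ennreal_inj) auto
  have "exp (q * t) * integral {0..t} ?\<phi> = integral {0..t} (\<lambda>r. exp (q * t) * ?\<phi> r)"
    by simp
  also have "\<dots> = integral {0..t} (\<lambda>r. exp (q * r) * (q * m r))"
    by (intro integral_cong) (simp add: exp_add[symmetric] algebra_simps)
  finally have "exp (q * t) * trans_prob G t x y = \<delta> + integral {0..t} (\<lambda>r. exp (q * r) * (q * m r))"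
    unfolding eq by (simp add: distrib_left exp_minus)
  then show ?thesis unfolding qm by (simp add: q_def \<delta>_def)
qed

text \<open>
  The renewal equation shows continuity for integrands that are merely bounded and measurable;
  continuity in turn is what makes the same equation differentiable.
\<close>

lemma trans_prob_continuous: "continuous_on {0..T} (\<lambda>t. trans_prob G t x y)"
proof -
  let ?k = "\<lambda>r. exp (- G x x * r) *
      (gen_apply G (\<lambda>z. trans_prob G r z y) x - G x x * trans_prob G r x y)"
  have k: "gen_apply G (\<lambda>z. trans_prob G r z y) x - G x x * trans_prob G r x y =
      (\<Sum>z\<in>UNIV - {x}. G x z * trans_prob G r z y)" for r
    unfolding gen_apply_def by (subst sum.remove[of UNIV x]) auto
  have "?k integrable_on {0..T}"
  proof (rule nn_integral_Icc_eq_integral(2))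
    show "?k \<in> borel_measurable borel" unfolding gen_apply_def by measurable
    fix r assume r: "r \<in> {0..T}"
    show "0 \<le> ?k r" unfolding k by (auto intro!: sum_nonneg mult_nonneg_nonneg simp: off_nonneg trans_prob_bounds)
    show "?k r \<le> exp (- G x x * T) * (\<Sum>z\<in>UNIV - {x}. G x z)" unfolding k
      using r diag_nonpos[of x]
      by (intro mult_mono sum_mono)
        (auto intro!: sum_nonneg mult_nonneg_nonneg mult_left_le simp: off_nonneg trans_prob_bounds mult_left_mono_neg)
  qed
  then have "continuous_on {0..T} (\<lambda>t. integral {0..t} ?k)"
    by (rule indefinite_integral_continuous_1)
  then have "continuous_on {0..T} (\<lambda>t. exp (G x x * t) * ((if x = y then 1 else 0) + integral {0..t} ?k))"
    by (intro continuous_intros) auto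
  moreover have "exp (G x x * t) * ((if x = y then 1 else 0) + integral {0..t} ?k) = trans_prob G t x y"
    if "t \<in> {0..T}" for t
    using that by (subst trans_prob_renewal[symmetric]) (auto simp: exp_minus)
  ultimately show ?thesis by (subst continuous_on_cong[OF refl, symmetric]) auto
qed

lemma kolmogorov_backward:
  assumes t: "0 \<le> t"
  shows "((\<lambda>t. trans_prob G t x y) has_real_derivative gen_apply G (\<lambda>z. trans_prob G t z y) x) (at t within {0..})"
proof -
  define T where "T = t + 1"
  define k where "k r = exp (- G x x * r) *
      (gen_apply G (\<lambda>z. trans_prob G r z y) x - G x x * trans_prob G r x y)" for r
  define I where "I t = integral {0..t} k" for t
  have "continuous_on {0..T} k"
    unfolding k_def gen_apply_def by (intro continuous_intros trans_prob_continuous)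
  then have "((\<lambda>t. I t) has_vector_derivative k t) (at t within {0..T})"
    unfolding I_def using t by (intro integral_has_vector_derivative) (auto simp: T_def)
  then have D: "((\<lambda>t. I t) has_real_derivative k t) (at t within {0..T})"
    by (simp add: has_real_derivative_iff_has_vector_derivative)
  let ?P = "\<lambda>t. exp (G x x * t) * ((if x = y then 1 else 0) + I t)"
  have P: "?P s = trans_prob G s x y" if "0 \<le> s" for s
  proof -
    have "exp (- G x x * s) * trans_prob G s x y = (if x = y then 1 else 0) + I s"
      unfolding I_def k_def by (rule trans_prob_renewal[OF that])
    from this[symmetric] show ?thesis by (simp only:) (simp add: exp_minus)
  qed
  have "(?P has_real_derivative
      exp (G x x * t) * k t + G x x * exp (G x x * t) * ((if x = y then 1 else 0) + I t)) (at t within {0..T})"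
    by (auto intro!: derivative_eq_intros D)
  moreover have "exp (G x x * t) * k t + G x x * exp (G x x * t) * ((if x = y then 1 else 0) + I t) =
      gen_apply G (\<lambda>z. trans_prob G t z y) x"
  proof -
    have "exp (G x x * t) * k t = gen_apply G (\<lambda>z. trans_prob G t z y) x - G x x * trans_prob G t x y"
      by (simp add: k_def exp_minus)
    then show ?thesis using P[OF t] by (simp only: mult.assoc) 
  qed
  ultimately have "(?P has_real_derivative gen_apply G (\<lambda>z. trans_prob G t z y) x) (at t within {0..T})"
    by (simp only:)
  then have "((\<lambda>t. trans_prob G t x y) has_real_derivative gen_apply G (\<lambda>z. trans_prob G t z y) x) (at t within {0..T})"
    by (rule has_field_derivative_transform_within[OF _ zero_less_one]) (use t in \<open>auto simp: T_def P\<close>)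
  moreover have "at t within {0..T} = at t within {0..}"
    by (rule at_within_nhd[of _ "{..<T}"]) (auto simp: T_def)
  ultimately show ?thesis by simp
qed

end

section \<open>Dirichlet forms\<close>

lemma gen_apply_diff: "gen_apply G (\<lambda>x. f x - g x) x = gen_apply G f x - gen_apply G g x"
  by (simp add: gen_apply_def algebra_simps sum_subtractf)

lemma gen_apply_scale: "gen_apply G (\<lambda>x. c * f x) x = c * gen_apply G f x"
  by (simp add: gen_apply_def sum_distrib_left ac_simps)

lemma (in generator) gen_apply_const [simp]: "gen_apply G (\<lambda>x. c) x = 0"
  by (simp add: gen_apply_def row_sum sum_distrib_right[symmetric])

definition dirichlet :: "('a::finite \<Rightarrow> 'a \<Rightarrow> real) \<Rightarrow> 'a pmf \<Rightarrow> ('a \<Rightarrow> real) \<Rightarrow> ('a \<Rightarrow> real) \<Rightarrow> real" where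
  "dirichlet G \<pi> f g = ip \<pi> (\<lambda>x. - gen_apply G f x) g"

locale reversible_generator = generator G for G :: "'a::finite \<Rightarrow> 'a \<Rightarrow> real" +
  fixes \<pi> :: "'a pmf"
  assumes positive: "\<And>x. 0 < pmf \<pi> x"
    and detailed_balance: "\<And>x y. pmf \<pi> x * G x y = pmf \<pi> y * G y x"
begin

abbreviation \<E> :: "('a \<Rightarrow> real) \<Rightarrow> ('a \<Rightarrow> real) \<Rightarrow> real" where
  "\<E> \<equiv> dirichlet G \<pi>"


text \<open>
  Expanding the product gives four double sums. Two vanish because the rows of \<open>G\<close> sum to zero, and the
  two mixed ones agree by detailed balance.
\<close>

lemma dirichlet_eq:
  "\<E> f g = (\<Sum>x\<in>UNIV. \<Sum>y\<in>UNIV. pmf \<pi> x * G x y * ((f x - f y) * (g x - g y))) / 2" (is "_ = ?S / 2")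
proof -
  let ?c = "\<lambda>x y. pmf \<pi> x * G x y"
  have row: "(\<Sum>y\<in>UNIV. ?c x y * k) = 0" for x k
    using row_sum[of x] by (simp add: sum_distrib_right[symmetric] sum_distrib_left[symmetric])
  have sym: "(\<Sum>x\<in>UNIV. \<Sum>y\<in>UNIV. ?c x y * k x y) = (\<Sum>x\<in>UNIV. \<Sum>y\<in>UNIV. ?c x y * k y x)" for k
    by (subst sum.swap) (simp add: detailed_balance)
  have "?S = (\<Sum>x\<in>UNIV. \<Sum>y\<in>UNIV. ?c x y * (f x * g x)) - (\<Sum>x\<in>UNIV. \<Sum>y\<in>UNIV. ?c x y * (f x * g y))
      - (\<Sum>x\<in>UNIV. \<Sum>y\<in>UNIV. ?c x y * (f y * g x)) + (\<Sum>x\<in>UNIV. \<Sum>y\<in>UNIV. ?c x y * (f y * g y))"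
    unfolding sum_subtractf[symmetric] sum.distrib[symmetric]
    by (intro sum.cong refl) (simp add: algebra_simps)
  also have "(\<Sum>x\<in>UNIV. \<Sum>y\<in>UNIV. ?c x y * (f y * g y)) = (\<Sum>x\<in>UNIV. \<Sum>y\<in>UNIV. ?c x y * (f x * g x))"
    by (rule sym)
  also have "(\<Sum>x\<in>UNIV. \<Sum>y\<in>UNIV. ?c x y * (f x * g y)) = (\<Sum>x\<in>UNIV. \<Sum>y\<in>UNIV. ?c x y * (f y * g x))"
    by (rule sym)
  also have "(\<Sum>x\<in>UNIV. \<Sum>y\<in>UNIV. ?c x y * (f y * g x)) = - \<E> f g"
    by (simp add: dirichlet_def ip_def gen_apply_def sum_distrib_left sum_distrib_right sum_negf ac_simps)
  finally show ?thesis by (simp add: row)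
qed

lemma dirichlet_commute: "\<E> f g = \<E> g f"
  unfolding dirichlet_eq by (simp add: mult.commute)

text \<open>
  Only the off-diagonal rates enter, all with nonnegative weight. This is why ordering the rates
  orders the forms.
\<close>

lemma dirichlet_off_diagonal:
  "\<E> f f = (\<Sum>x\<in>UNIV. \<Sum>y\<in>UNIV. if x = y then 0 else pmf \<pi> x * G x y * (f x - f y)\<^sup>2) / 2"
  unfolding dirichlet_eq by (intro arg_cong2[where f = divide] sum.cong refl) (auto simp: power2_eq_square)

lemma dirichlet_nonneg: "0 \<le> \<E> f f"
  unfolding dirichlet_off_diagonal
  by (intro divide_nonneg_pos sum_nonneg) (auto simp: off_nonneg)

lemma dirichlet_1 [simp]: "\<E> f (\<lambda>x. 1) = 0"
  by (subst dirichlet_commute) (simp add: dirichlet_def ip_def)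

lemma stationary: "(\<Sum>x\<in>UNIV. pmf \<pi> x * gen_apply G f x) = 0"
  using dirichlet_1[of f] by (simp add: dirichlet_def ip_def sum_negf mult.commute)

lemma dirichlet_diff: "\<E> (\<lambda>x. f x - g x) (\<lambda>x. f x - g x) = \<E> f f - 2 * \<E> f g + \<E> g g"
proof -
  have "\<E> (\<lambda>x. f x - g x) (\<lambda>x. f x - g x) = \<E> f f - \<E> f g - \<E> g f + \<E> g g"
    by (simp add: dirichlet_def ip_def gen_apply_diff algebra_simps sum.distrib sum_subtractf sum_negf)
  then show ?thesis using dirichlet_commute[of g f] by simp
qed

text \<open>
  Nonnegativity of the energy of \<open>f - g\<close>. All the variational principles below are instances.
\<close>

lemma energy_ge: "2 * \<E> f g - \<E> g g \<le> \<E> f f"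
  using dirichlet_nonneg[of "\<lambda>x. f x - g x"] dirichlet_diff[of f g] by simp

lemma ip_nonneg: "0 \<le> ip \<pi> f f"
  unfolding ip_def by (intro sum_nonneg) simp

section \<open>Variational principles\<close>

text \<open>
  With \<open>(l - G) u\<close> supported in \<open>A\<close>, pairing it with \<open>f\<close> sees only the values of \<open>f\<close> on \<open>A\<close>, so \<open>f\<close> can be
  replaced by the constant \<open>1\<close>, against which \<open>G u\<close> integrates to zero.
\<close>

lemma killed_energy:
  assumes u: "\<And>x. x \<notin> A \<Longrightarrow> gen_apply G u x = l * u x"
    and f: "\<And>x. x \<in> A \<Longrightarrow> f x = 1"
  shows "l * ip \<pi> u f + \<E> u f = l * mean \<pi> u"
proof -
  have "l * ip \<pi> u f + \<E> u f = (\<Sum>x\<in>UNIV. pmf \<pi> x * (l * u x - gen_apply G u x) * f x)"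
    by (simp add: dirichlet_def ip_def algebra_simps sum.distrib sum_subtractf sum_negf sum_distrib_left)
  also have "\<dots> = (\<Sum>x\<in>UNIV. pmf \<pi> x * (l * u x - gen_apply G u x) * 1)"
    using u f by (intro sum.cong refl) (metis diff_self mult_zero_left mult_zero_right)
  also have "\<dots> = l * mean \<pi> u - (\<Sum>x\<in>UNIV. pmf \<pi> x * gen_apply G u x)"
    by (simp add: mean_def algebra_simps sum_subtractf sum_distrib_left)
  finally show ?thesis by (simp add: stationary)
qed

text \<open>
  The Euler--Lagrange characterisation: by \<open>killed_energy\<close> the form \<open>l \<langle>\<cdot>, \<cdot>\<rangle> + \<E>\<close> takes the same value at
  \<open>(u, f)\<close> and at \<open>(u, u)\<close>, so its nonnegativity at \<open>f - u\<close> is the claim.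
\<close>

lemma killed_energy_minimal:
  assumes l: "0 \<le> l"
    and u: "\<And>x. x \<notin> A \<Longrightarrow> gen_apply G u x = l * u x" "\<And>x. x \<in> A \<Longrightarrow> u x = 1"
    and f: "\<And>x. x \<in> A \<Longrightarrow> f x = 1"
  shows "l * mean \<pi> u \<le> l * ip \<pi> f f + \<E> f f"
proof -
  have "0 \<le> l * ip \<pi> (\<lambda>x. f x - u x) (\<lambda>x. f x - u x)"
    using l ip_nonneg by (intro mult_nonneg_nonneg)
  also have "ip \<pi> (\<lambda>x. f x - u x) (\<lambda>x. f x - u x) = ip \<pi> f f - 2 * ip \<pi> u f + ip \<pi> u u"
    by (simp add: ip_def algebra_simps sum.distrib sum_subtractf sum_distrib_left)
  finally have "0 \<le> l * (ip \<pi> f f - 2 * ip \<pi> u f + ip \<pi> u u)" .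
  moreover have "2 * \<E> u f - \<E> u u \<le> \<E> f f"
    using energy_ge[of f u] by (simp add: dirichlet_commute)
  moreover have "l * ip \<pi> u f + \<E> u f = l * mean \<pi> u" by (rule killed_energy) fact+
  moreover have "l * ip \<pi> u u + \<E> u u = l * mean \<pi> u" by (rule killed_energy) fact+
  ultimately show ?thesis by (simp add: algebra_simps)
qed

text \<open>
  \<open>G u\<close> is supported in \<open>A \<union> B\<close> and has total \<open>\<pi>\<close>-mass zero, so the flux into \<open>B\<close>, seen by \<open>f\<close>, is the flux
  out of \<open>A\<close>.
\<close>

lemma capacity_energy:
  assumes AB: "A \<inter> B = {}"
    and u: "\<And>x. x \<notin> A \<Longrightarrow> x \<notin> B \<Longrightarrow> gen_apply G u x = 0"
    and f: "\<And>x. x \<in> A \<Longrightarrow> f x = 0" "\<And>x. x \<in> B \<Longrightarrow> f x = 1"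
  shows "\<E> u f = (\<Sum>x\<in>A. pmf \<pi> x * gen_apply G u x)"
proof -
  have "\<E> u f - (\<Sum>x\<in>A. pmf \<pi> x * gen_apply G u x) =
      \<E> u f - (\<Sum>x\<in>UNIV. if x \<in> A then pmf \<pi> x * gen_apply G u x else 0)"
    by (simp add: sum.If_cases)
  also have "\<dots> = - (\<Sum>x\<in>UNIV. pmf \<pi> x * gen_apply G u x)"
    unfolding dirichlet_def ip_def sum_subtractf[symmetric] sum_negf[symmetric]
    using AB u f by (intro sum.cong refl) (auto simp: mult.commute)
  finally show ?thesis by (simp add: stationary)
qed

lemma cap_eq_dirichlet:
  assumes AB: "A \<inter> B = {}"
  shows "cap A B G \<pi> = \<E> (hits_before B A) (hits_before B A)"
  using cap_eq[OF AB] AB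
  by (subst capacity_energy[OF AB hits_before_equation]) (auto intro!: hits_before_start)

lemma cap_minimal:
  assumes AB: "A \<inter> B = {}" and f: "\<And>x. x \<in> A \<Longrightarrow> f x = 0" "\<And>x. x \<in> B \<Longrightarrow> f x = 1"
  shows "cap A B G \<pi> \<le> \<E> f f"
proof -
  let ?u = "hits_before B A"
  have "\<E> ?u f = cap A B G \<pi>"
    using cap_eq[OF AB] capacity_energy[OF AB hits_before_equation f] by auto
  then show ?thesis
    using energy_ge[of f ?u] cap_eq_dirichlet[OF AB] by (simp add: dirichlet_commute)
qed

section \<open>Poisson equations\<close>

text \<open>
  Zero energy forces equal values along every edge of positive rate, hence along paths.
\<close>

lemma dirichlet_zero_constant:
  assumes irr: "irreducible_gen G" and D: "\<E> f f = 0"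
  shows "f x = f y"
proof -
  have nn: "0 \<le> (if x = y then 0 else pmf \<pi> x * G x y * (f x - f y)\<^sup>2)" for x y
    using positive off_nonneg by (auto intro!: mult_nonneg_nonneg less_imp_le)
  have step: "f a = f b" if "0 < G a b" for a b
  proof (rule ccontr)
    assume ab: "f a \<noteq> f b"
    have "0 < pmf \<pi> a * G a b * (f a - f b)\<^sup>2" using positive that ab by simp
    also have "\<dots> = (if a = b then 0 else pmf \<pi> a * G a b * (f a - f b)\<^sup>2)" using ab by auto
    also have "\<dots> \<le> (\<Sum>y\<in>UNIV. if a = y then 0 else pmf \<pi> a * G a y * (f a - f y)\<^sup>2)"
      using nn by (intro member_le_sum[of b UNIV "\<lambda>y. if a = y then 0 else pmf \<pi> a * G a y * (f a - f y)\<^sup>2"]) auto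
    also have "\<dots> \<le> (\<Sum>x\<in>UNIV. \<Sum>y\<in>UNIV. if x = y then 0 else pmf \<pi> x * G x y * (f x - f y)\<^sup>2)"
      using nn by (intro member_le_sum[of a UNIV "\<lambda>x. \<Sum>y\<in>UNIV. if x = y then 0 else pmf \<pi> x * G x y * (f x - f y)\<^sup>2"] sum_nonneg) auto
    also have "\<dots> = 0" using D unfolding dirichlet_off_diagonal by simp
    finally show False by simp
  qed
  have "(x, y) \<in> {(a, b). 0 < G a b}\<^sup>*" using irr by (simp add: irreducible_gen_def)
  then show ?thesis by induction (auto dest: step)
qed

text \<open>
  The equations at the points other than \<open>y\<close>, together with the value at \<open>y\<close>, form a square linear
  system. A solution of the homogeneous system has zero energy, hence is constant, hence zero.
\<close>

lemma solvable_off_point: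
  assumes irr: "irreducible_gen G"
  shows "\<exists>g. g y = 0 \<and> (\<forall>x. x \<noteq> y \<longrightarrow> gen_apply G g x = b x)"
proof -
  \<comment> \<open>the square system consisting of the value at \<open>y\<close> and of \<open>G f\<close> at the other points\<close>
  define L where "L v = (\<chi> z. if z = y then v $ y else gen_apply G (\<lambda>i. v $ i) z)" for v :: "real ^ 'a"
  have lin: "linear L"
    by (rule linearI)
      (auto simp: L_def vec_eq_iff gen_apply_def algebra_simps sum.distrib sum_distrib_left)
  have "v = 0" if "L v = 0" for v
  proof -
    let ?f = "\<lambda>i. v $ i"
    have eq: "(if z = y then v $ y else gen_apply G ?f z) = 0" for z
      using that by (simp add: L_def vec_eq_iff)
    have y: "?f y = 0" using eq[of y] by simp
    have off: "gen_apply G ?f z = 0" if "z \<noteq> y" for z using eq[of z] that by simp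
    have "\<E> ?f ?f = 0" unfolding dirichlet_def ip_def
      using y off by (intro sum.neutral ballI) (metis mult_zero_left mult_zero_right neg_0_equal_iff_equal)
    then have "?f z = ?f y" for z by (rule dirichlet_zero_constant[OF irr])
    then show "v = 0" using y by (simp add: vec_eq_iff)
  qed
  then have "inj L" using lin by (simp add: linear_injective_0)
  then have "surj L" using lin linear_injective_imp_surjective by blast
  then obtain v where v: "L v = (\<chi> z. if z = y then 0 else b z)" by (metis surjD)
  have "(if z = y then v $ y else gen_apply G (\<lambda>i. v $ i) z) = (if z = y then 0 else b z)" for z
    using v by (simp add: L_def vec_eq_iff)
  then show ?thesis by (intro exI[of _ "\<lambda>i. v $ i"]) metis
qed

text \<open>
  One equation is missing from \<open>solvable_off_point\<close>; as \<open>G g\<close> and \<open>b\<close> both have mean zero, it follows from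
  the others.
\<close>

lemma poisson_solvable:
  assumes irr: "irreducible_gen G" and b: "mean \<pi> b = 0"
  shows "\<exists>g. gen_apply G g = b"
proof -
  obtain y :: 'a where True by blast
  obtain g where g: "\<And>x. x \<noteq> y \<Longrightarrow> gen_apply G g x = b x"
    using solvable_off_point[OF irr, of y b] by blast
  have "0 = (\<Sum>x\<in>UNIV. pmf \<pi> x * gen_apply G g x) - (\<Sum>x\<in>UNIV. pmf \<pi> x * b x)"
    using b by (simp add: stationary mean_def mult.commute)
  also have "\<dots> = (\<Sum>x\<in>UNIV. pmf \<pi> x * (gen_apply G g x - b x))"
    by (simp add: algebra_simps sum_subtractf)
  also have "\<dots> = pmf \<pi> y * (gen_apply G g y - b y)"
    using g by (subst sum.remove[of UNIV y]) auto
  finally have "gen_apply G g y = b y" using positive[of y] by simp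
  then have "gen_apply G g x = b x" for x using g by (cases "x = y") auto
  then show ?thesis by blast
qed

text \<open>
  Symmetry of the form makes the value independent of the solution that \<open>SOME\<close> picks.
\<close>

lemma asym_var_eq:
  assumes "gen_apply G g = h"
  shows "asym_var h G \<pi> = ereal (2 * \<E> g g)"
proof -
  let ?g = "SOME g. gen_apply G g = h"
  have s: "gen_apply G ?g = h" using assms by (rule someI[where P = "\<lambda>g. gen_apply G g = h"])
  have "ip \<pi> h ?g = - \<E> g ?g" "\<E> ?g g = - ip \<pi> h g" "\<E> g g = - ip \<pi> h g"
    using assms s by (simp_all add: dirichlet_def ip_def sum_negf)
  then have "ip \<pi> h ?g = - \<E> g g" using dirichlet_commute[of g ?g] by simp
  then show ?thesis using assms by (auto simp: asym_var_def)
qed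

end

section \<open>Expected hitting times and commute times\<close>

text \<open>
  By convexity of the exponential, its difference quotients \<open>(1 - exp (- l t)) / l\<close> increase as \<open>l = 1 / (n + 1)\<close>
  decreases. At \<open>\<tau> = \<infinity>\<close> the quotient is \<open>n + 1\<close>.
\<close>

lemma exp_neg_quotient_incseq:
  "incseq (\<lambda>n. ennreal (real (Suc n) * (1 - exp_neg (1 / real (Suc n)) \<tau>)))"
proof (rule incseq_SucI, cases \<tau>)
  fix n
  case top
  then show "ennreal (real (Suc n) * (1 - exp_neg (1 / real (Suc n)) \<tau>)) \<le>
      ennreal (real (Suc (Suc n)) * (1 - exp_neg (1 / real (Suc (Suc n))) \<tau>))"
    by (auto simp: exp_neg_def intro!: ennreal_leI)
next
  fix n
  case (real t)
  define a where "a = real (Suc n) / real (Suc (Suc n))"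
  define x where "x = - (1 / real (Suc n)) * t"
  have a: "0 \<le> a" "a \<le> 1" "real (Suc (Suc n)) * a = real (Suc n)"
    by (auto simp: a_def field_simps)
  have ax: "a * x = - (1 / real (Suc (Suc n))) * t"
    by (simp add: a_def x_def del: of_nat_Suc)
  have "exp ((1 - a) * 0 + a * x) \<le> (1 - a) * exp 0 + a * exp x"
    using convex_onD[OF exp_convex, of a 0 x] a by simp
  then have "real (Suc (Suc n)) * (a * (1 - exp x)) \<le> real (Suc (Suc n)) * (1 - exp (a * x))"
    by (intro mult_left_mono) (auto simp: algebra_simps)
  then have "real (Suc n) * (1 - exp x) \<le> real (Suc (Suc n)) * (1 - exp (a * x))"
    using a(3) by (metis mult.assoc)
  then have "real (Suc n) * (1 - exp (- (1 / real (Suc n)) * t)) \<le>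
      real (Suc (Suc n)) * (1 - exp (- (1 / real (Suc (Suc n))) * t))"
    unfolding ax by (simp only: x_def)
  then show "ennreal (real (Suc n) * (1 - exp_neg (1 / real (Suc n)) \<tau>)) \<le>
      ennreal (real (Suc (Suc n)) * (1 - exp_neg (1 / real (Suc (Suc n))) \<tau>))"
    using real by (intro ennreal_leI) (simp add: exp_neg_def)
qed

lemma exp_neg_quotient_tendsto:
  "(\<lambda>n. ennreal (real (Suc n) * (1 - exp_neg (1 / real (Suc n)) \<tau>))) \<longlonglongrightarrow> \<tau>"
proof (cases \<tau>)
  case top
  have "(\<lambda>n. ennreal (real (Suc n))) \<longlonglongrightarrow> \<top>"
    using filterlim_compose[OF ennreal_tendsto_top_eq_at_top[THEN iffD2] filterlim_Suc, OF filterlim_real_sequentially]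
    by simp
  then show ?thesis using top by (simp add: exp_neg_def)
next
  case (real t)
  have "((\<lambda>l. exp (- l * t)) has_real_derivative - t) (at 0)"
    by (auto intro!: derivative_eq_intros)
  then have D: "((\<lambda>l. (exp (- l * t) - 1) / l) \<longlongrightarrow> - t) (at 0)"
    by (simp add: has_field_derivative_iff)
  have "filterlim (\<lambda>n. 1 / real (Suc n)) (at 0) sequentially"
    using LIMSEQ_inverse_real_of_nat by (simp add: filterlim_at inverse_eq_divide)
  then have "(\<lambda>n. (exp (- (1 / real (Suc n)) * t) - 1) / (1 / real (Suc n))) \<longlonglongrightarrow> - t"
    by (rule filterlim_compose[OF D])
  from tendsto_minus[OF this]
  have "(\<lambda>n. real (Suc n) * (1 - exp (- (1 / real (Suc n)) * t))) \<longlonglongrightarrow> t"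
    by (simp add: algebra_simps)
  then have "(\<lambda>n. ennreal (real (Suc n) * (1 - exp (- (1 / real (Suc n)) * t)))) \<longlonglongrightarrow> ennreal t"
    by (rule tendsto_ennrealI)
  then show ?thesis using real by (simp add: exp_neg_def)
qed

text \<open>
  Monotone convergence along \<open>l = 1 / (n + 1)\<close>. This transfers statements about Laplace transforms to
  expectations, including infinite ones.
\<close>

lemma expected_hit_time_limit:
  "(\<lambda>n. ennreal (real (Suc n) * (1 - (\<integral>\<omega>. exp_neg (1 / real (Suc n)) (hit_time G A \<omega>) \<partial>chain G \<nu>))))
    \<longlonglongrightarrow> (\<integral>\<^sup>+\<omega>. hit_time G A \<omega> \<partial>chain G \<nu>)"
proof -
  interpret C: prob_space "chain G \<nu>" by (rule prob_space_chain)
  have "ennreal (real (Suc n) * (1 - (\<integral>\<omega>. exp_neg (1 / real (Suc n)) (hit_time G A \<omega>) \<partial>chain G \<nu>))) =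
      (\<integral>\<^sup>+\<omega>. ennreal (real (Suc n) * (1 - exp_neg (1 / real (Suc n)) (hit_time G A \<omega>))) \<partial>chain G \<nu>)" for n
  proof -
    have "integrable (chain G \<nu>) (\<lambda>\<omega>. exp_neg (1 / real (Suc n)) (hit_time G A \<omega>))"
      by (intro C.integrable_const_bound[of _ 1]) (auto simp: exp_neg_le_1)
    moreover have "0 \<le> 1 - exp_neg (1 / real (Suc n)) \<tau>" for \<tau>
      using exp_neg_le_1[of "1 / real (Suc n)"] by simp
    ultimately show ?thesis
      by (subst nn_integral_eq_integral) (auto simp: C.prob_space[unfolded space_chain])
  qed
  then show ?thesis
    using exp_neg_quotient_incseq exp_neg_quotient_tendsto
    by (simp only:) (rule nn_integral_LIMSEQ, auto simp: incseq_def le_fun_def)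
qed

context generator
begin

lemma minimum_principle:
  assumes "\<And>x. f z \<le> f x"
  shows "0 \<le> gen_apply G f z"
proof -
  have "gen_apply G f z = (\<Sum>x\<in>UNIV. G z x * (f x - f z))"
    using row_sum[of z] by (simp add: gen_apply_def algebra_simps sum_subtractf flip: sum_distrib_left)
  also have "\<dots> \<ge> 0"
  proof (rule sum_nonneg)
    fix x show "0 \<le> G z x * (f x - f z)"
      using assms[of x] off_nonneg[of z x] by (cases "z = x") auto
  qed
  finally show ?thesis .
qed

lemma nonneg_off_point:
  fixes f :: "'a \<Rightarrow> real"
  assumes "0 \<le> f y" and "\<And>z. z \<noteq> y \<Longrightarrow> (\<And>x. f z \<le> f x) \<Longrightarrow> 0 \<le> f z"
  shows "0 \<le> f x"
proof -
  obtain z where z: "\<And>x. f z \<le> f x"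
    using ex_min_if_finite[of "range f"] by (auto simp: not_less) 
  then have "0 \<le> f z" using assms by (cases "z = y") auto
  then show ?thesis using z[of x] by simp
qed

end

context reversible_generator
begin

text \<open>
  The regularised times \<open>v n = (n + 1) (1 - u)\<close>, with \<open>u\<close> the Laplace transform at \<open>1 / (n + 1)\<close>, solve
  \<open>G v = v / (n + 1) - 1\<close> off \<open>y\<close>. A solution \<open>g\<close> of the limit equation dominates all of them by the minimum
  principle, so the increasing limit is finite, and the equation passes to the limit.
\<close>

lemma expected_hit_time_equation:
  assumes irr: "irreducible_gen G"
  shows "\<exists>h. h y = 0 \<and> (\<forall>x. 0 \<le> h x) \<and> (\<forall>x. x \<noteq> y \<longrightarrow> gen_apply G h x = -1) \<and>
    (\<forall>x. (\<integral>\<^sup>+\<omega>. hit_time G {y} \<omega> \<partial>chain_from G x) = ennreal (h x))"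
proof -
  define v where "v n x = real (Suc n) * (1 - laplace_hit (1 / real (Suc n)) {y} x)" for n x
  have v_lim: "(\<lambda>n. ennreal (v n x)) \<longlonglongrightarrow> (\<integral>\<^sup>+\<omega>. hit_time G {y} \<omega> \<partial>chain_from G x)" for x
    unfolding v_def laplace_hit_def by (rule expected_hit_time_limit)
  have v0: "0 \<le> v n x" for n x
    using laplace_hit_bounds(2)[of "1 / real (Suc n)"] by (simp add: v_def)
  have vy: "v n y = 0" for n by (simp add: v_def laplace_hit_start)
  have Gv: "gen_apply G (v n) x = v n x / real (Suc n) - 1" if "x \<noteq> y" for n x
  proof -
    let ?l = "1 / real (Suc n)"
    have "gen_apply G (v n) x = real (Suc n) * gen_apply G (\<lambda>x. 1 - laplace_hit ?l {y} x) x"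
      unfolding v_def[abs_def] by (rule gen_apply_scale)
    also have "\<dots> = real (Suc n) * (- (?l * laplace_hit ?l {y} x))"
      using laplace_hit_equation[of ?l x "{y}"] that by (simp add: gen_apply_diff)
    finally show ?thesis by (simp add: v_def field_simps)
  qed
  \<comment> \<open>a finite solution of the limit equation, used only to bound \<open>v n\<close> uniformly in \<open>n\<close>\<close>
  obtain g where gy: "g y = 0" and g: "\<And>x. x \<noteq> y \<Longrightarrow> gen_apply G g x = -1"
    using solvable_off_point[OF irr, of y "\<lambda>x. -1"] by blast
  have g0: "0 \<le> g x" for x
  proof (rule nonneg_off_point)
    fix z assume "z \<noteq> y" "\<And>x. g z \<le> g x"
    then show "0 \<le> g z" using g[of z] minimum_principle[of g z] by simp
  qed (simp add: gy)
  have vg: "v n x \<le> g x" for n x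
  proof -
    have "0 \<le> g x - v n x"
    proof (rule nonneg_off_point[where f = "\<lambda>x. g x - v n x"])
      fix z assume z: "z \<noteq> y" and min: "\<And>x. g z - v n z \<le> g x - v n x"
      have "0 \<le> gen_apply G (\<lambda>x. g x - v n x) z"
        by (rule minimum_principle) (rule min)
      then have "0 \<le> - v n z / real (Suc n)" using g[OF z] Gv[OF z] by (simp add: gen_apply_diff)
      then have "v n z \<le> 0" by (simp add: field_simps)
      then show "0 \<le> g z - v n z" using g0[of z] by simp
    qed (simp add: gy vy)
    then show ?thesis by simp
  qed
  define h where "h x = enn2real (\<integral>\<^sup>+\<omega>. hit_time G {y} \<omega> \<partial>chain_from G x)" for x
  have h: "(\<integral>\<^sup>+\<omega>. hit_time G {y} \<omega> \<partial>chain_from G x) = ennreal (h x)" for x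
  proof -
    have "(\<integral>\<^sup>+\<omega>. hit_time G {y} \<omega> \<partial>chain_from G x) \<le> ennreal (g x)"
      by (rule LIMSEQ_le_const2[OF v_lim]) (auto intro!: ennreal_leI vg)
    then have "(\<integral>\<^sup>+\<omega>. hit_time G {y} \<omega> \<partial>chain_from G x) < \<top>"
      using ennreal_less_top le_less_trans by blast
    then show ?thesis unfolding h_def by simp
  qed
  have h0: "0 \<le> h x" for x by (simp add: h_def)
  have vh: "(\<lambda>n. v n x) \<longlonglongrightarrow> h x" for x
    using v_lim[of x] unfolding h by (rule tendsto_ennrealD) (auto simp: v0 h0)
  have "h y = 0" using LIMSEQ_unique[OF vh[of y]] by (simp add: vy)
  moreover have "gen_apply G h x = -1" if x: "x \<noteq> y" for x
  proof -
    have "(\<lambda>n. gen_apply G (v n) x) \<longlonglongrightarrow> gen_apply G h x"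
      unfolding gen_apply_def by (intro tendsto_intros vh)
    moreover have "(\<lambda>n. v n x * inverse (real (Suc n)) - 1) \<longlonglongrightarrow> h x * 0 - 1"
      by (intro tendsto_intros vh LIMSEQ_inverse_real_of_nat)
    then have "(\<lambda>n. gen_apply G (v n) x) \<longlonglongrightarrow> -1"
      unfolding Gv[OF x] by (simp add: divide_inverse)
    ultimately show ?thesis by (rule LIMSEQ_unique)
  qed
  ultimately show ?thesis using h h0 by blast
qed

text \<open>
  The difference \<open>w\<close> of the two expected hitting times is the potential of a unit current from \<open>x\<close> to \<open>y\<close>:
  its energy against \<open>f\<close> is \<open>f x - f y\<close> whatever the generator, and its own voltage drop is the commute time.
\<close>

lemma commute_potential:
  assumes irr: "irreducible_gen G" and xy: "x \<noteq> y"
  shows "\<exists>w. t_com G x y = ennreal (w x - w y) \<and> (\<forall>f. \<E> w f = f x - f y)"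
proof -
  obtain h where hy: "h y = 0" and h0: "\<And>z. 0 \<le> h z" and h: "\<And>z. z \<noteq> y \<Longrightarrow> gen_apply G h z = -1"
    and h_hit: "\<And>z. (\<integral>\<^sup>+\<omega>. hit_time G {y} \<omega> \<partial>chain_from G z) = ennreal (h z)"
    using expected_hit_time_equation[OF irr, of y] by blast
  obtain k where kx: "k x = 0" and k0: "\<And>z. 0 \<le> k z" and k: "\<And>z. z \<noteq> x \<Longrightarrow> gen_apply G k z = -1"
    and k_hit: "\<And>z. (\<integral>\<^sup>+\<omega>. hit_time G {x} \<omega> \<partial>chain_from G z) = ennreal (k z)"
    using expected_hit_time_equation[OF irr, of x] by blast
  have total: "pmf \<pi> a * gen_apply G u a = 1 - pmf \<pi> a"
    if u: "\<And>z. z \<noteq> a \<Longrightarrow> gen_apply G u z = -1" for u a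
  proof -
    have "(\<Sum>z\<in>UNIV - {a}. pmf \<pi> z * gen_apply G u z) = (\<Sum>z\<in>UNIV - {a}. - pmf \<pi> z)"
      using u by (intro sum.cong) auto
    moreover have "(\<Sum>z\<in>UNIV. pmf \<pi> z) = 1" by (rule sum_pmf_eq_1) auto
    ultimately show ?thesis
      using stationary[of u] by (simp add: sum.remove[of UNIV a] sum_negf)
  qed
  define w where "w z = h z - k z" for z
  \<comment> \<open>the unit sources \<open>-1\<close> of \<open>h\<close> and \<open>k\<close> cancel; stationarity fixes the charges left at \<open>x\<close> and \<open>y\<close>\<close>
  have Gw: "pmf \<pi> z * gen_apply G w z = (if z = y then 1 else 0) - (if z = x then 1 else 0)" for z
    using total[of y h, OF h] total[of x k, OF k] h[of z] k[of z] xy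
    by (auto simp: w_def[abs_def] gen_apply_diff algebra_simps)
  have "\<E> w f = f x - f y" for f
  proof -
    have "\<E> w f = (\<Sum>z\<in>UNIV. - (pmf \<pi> z * gen_apply G w z) * f z)"
      by (simp add: dirichlet_def ip_def ac_simps)
    also have "\<dots> = (\<Sum>z\<in>UNIV. (if z = x then f z else 0) - (if z = y then f z else 0))"
      unfolding Gw by (intro sum.cong) auto
    finally show ?thesis by (simp add: sum_subtractf)
  qed
  moreover have "t_com G x y = ennreal (w x - w y)"
    unfolding t_com_def h_hit k_hit using hy kx h0[of x] k0[of y] by (simp add: w_def ennreal_plus)
  ultimately show ?thesis by blast
qed

end

section \<open>Large deviations\<close>

text \<open>
  The difference of the two sides is a square over \<open>a b\<close>.
\<close>

lemma weighted_square_ineq: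
  fixes a b p q :: real
  assumes "0 < a" "0 < b"
  shows "(a - b) * (p\<^sup>2 / a - q\<^sup>2 / b) \<le> (p - q)\<^sup>2"
proof -
  have "(p - q)\<^sup>2 - (a - b) * (p\<^sup>2 / a - q\<^sup>2 / b) = (p * b - q * a)\<^sup>2 / (a * b)"
    using assms by (simp add: field_simps power2_eq_square)
  also have "\<dots> \<ge> 0" using assms by simp
  finally show ?thesis by simp
qed

context reversible_generator
begin

text \<open>
  With \<open>\<nu> = \<phi>\<^sup>2 \<pi>\<close>, the expression in the supremum is \<open>\<E>(u, \<phi>\<^sup>2 / u)\<close>. Edge by edge it is at most the
  energy of \<open>\<phi>\<close>, and the choice \<open>u = \<phi>\<close> would give equality.
\<close>

lemma ld_rate_eq: "ld_rate G \<nu> = ereal (\<E> (\<lambda>x. sqrt (pmf \<nu> x / pmf \<pi> x)) (\<lambda>x. sqrt (pmf \<nu> x / pmf \<pi> x)))"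
proof -
  define \<phi> where "\<phi> x = sqrt (pmf \<nu> x / pmf \<pi> x)" for x
  have \<phi>0: "0 \<le> \<phi> x" for x by (simp add: \<phi>_def)
  have \<phi>2: "(\<phi> x)\<^sup>2 * pmf \<pi> x = pmf \<nu> x" for x
    using positive[of x] by (simp add: \<phi>_def)
  have rate: "- (\<Sum>x\<in>UNIV. pmf \<nu> x * (gen_apply G u x / u x)) = \<E> u (\<lambda>x. (\<phi> x)\<^sup>2 / u x)" for u
    by (simp add: dirichlet_def ip_def \<phi>2[symmetric] sum_negf ac_simps)
  have "ld_rate G \<nu> \<le> ereal (\<E> \<phi> \<phi>)"
    unfolding ld_rate_def rate
  proof (intro SUP_least, clarify)
    fix u :: "'a \<Rightarrow> real" assume u: "\<forall>x. 0 < u x"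
    have "\<E> u (\<lambda>x. (\<phi> x)\<^sup>2 / u x) \<le> \<E> \<phi> \<phi>"
      unfolding dirichlet_eq
    proof (intro divide_right_mono sum_mono)
      fix x y
      show "pmf \<pi> x * G x y * ((u x - u y) * ((\<phi> x)\<^sup>2 / u x - (\<phi> y)\<^sup>2 / u y)) \<le>
          pmf \<pi> x * G x y * ((\<phi> x - \<phi> y) * (\<phi> x - \<phi> y))"
        using weighted_square_ineq[of "u x" "u y" "\<phi> x" "\<phi> y"] u off_nonneg[of x y]
        by (cases "x = y") (auto intro!: mult_left_mono simp: power2_eq_square)
    qed simp
    then show "ereal (\<E> u (\<lambda>x. (\<phi> x)\<^sup>2 / u x)) \<le> ereal (\<E> \<phi> \<phi>)" by simp
  qed
  moreover have "ereal (\<E> \<phi> \<phi>) \<le> ld_rate G \<nu>"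
  proof -
    \<comment> \<open>\<open>\<phi>\<close> is optimal but may vanish, so it is approached through strictly positive functions\<close>
    define u where "u n x = \<phi> x + inverse (real (Suc n))" for n x
    have u_pos: "0 < u n x" for n x using \<phi>0[of x] by (simp add: u_def add_nonneg_pos)
    have u_lim: "(\<lambda>n. u n x) \<longlonglongrightarrow> \<phi> x" for x
      unfolding u_def using tendsto_add[OF tendsto_const[of "\<phi> x"] LIMSEQ_inverse_real_of_nat] by simp
    have g_lim: "(\<lambda>n. (\<phi> x)\<^sup>2 / u n x) \<longlonglongrightarrow> \<phi> x" for x
    proof (cases "\<phi> x = 0")
      case False
      then have "(\<lambda>n. (\<phi> x)\<^sup>2 / u n x) \<longlonglongrightarrow> (\<phi> x)\<^sup>2 / \<phi> x"
        by (intro tendsto_intros u_lim)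
      then show ?thesis using False by (simp add: power2_eq_square)
    qed simp
    have "(\<lambda>n. \<E> (u n) (\<lambda>x. (\<phi> x)\<^sup>2 / u n x)) \<longlonglongrightarrow> \<E> \<phi> \<phi>"
      unfolding dirichlet_eq by (intro tendsto_intros u_lim g_lim) simp
    then have "(\<lambda>n. ereal (\<E> (u n) (\<lambda>x. (\<phi> x)\<^sup>2 / u n x))) \<longlonglongrightarrow> ereal (\<E> \<phi> \<phi>)"
      by simp
    then show ?thesis
    proof (rule LIMSEQ_le_const2, intro exI allI impI)
      fix n
      show "ereal (\<E> (u n) (\<lambda>x. (\<phi> x)\<^sup>2 / u n x)) \<le> ld_rate G \<nu>"
        unfolding ld_rate_def rate by (intro SUP_upper) (simp add: u_pos)
    qed
  qed
  ultimately show ?thesis unfolding \<phi>_def by simp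
qed

end

section \<open>Mixing\<close>

text \<open>
  The flows below are differentiable only from the right at \<open>0\<close>, hence the restricted filter.
\<close>

lemma nonincreasing_from_derivative:
  fixes F :: "real \<Rightarrow> real"
  assumes D: "\<And>t. 0 \<le> t \<Longrightarrow> (F has_real_derivative F' t) (at t within {0..})"
    and F': "\<And>t. 0 \<le> t \<Longrightarrow> F' t \<le> 0" and t: "0 \<le> t"
  shows "F t \<le> F 0"
proof (rule DERIV_nonpos_imp_decreasing_open[OF t])
  fix s :: real assume s: "0 < s"
  then have "at s within {0..} = at s" by (intro at_within_interior) simp
  then show "\<exists>y. DERIV F s :> y \<and> y \<le> 0" using D[of s] F'[of s] s by auto
next
  show "continuous_on {0..t} F"
    unfolding continuous_on_eq_continuous_within
    by (auto intro!: DERIV_continuous[OF DERIV_subset[OF D]])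
qed

context generator
begin

text \<open>
  Solutions of the backward equation \<open>u' = G u\<close> on \<open>[0, \<infinity>)\<close>. Stating the energy estimates for all of them
  yields uniqueness, from which the semigroup law of the transition operators follows.
\<close>

definition flow :: "(real \<Rightarrow> 'a \<Rightarrow> real) \<Rightarrow> bool" where
  "flow u \<longleftrightarrow> (\<forall>t x. 0 \<le> t \<longrightarrow>
     ((\<lambda>t. u t x) has_real_derivative gen_apply G (u t) x) (at t within {0..}))"

lemma flowD: "flow u \<Longrightarrow> 0 \<le> t \<Longrightarrow>
    ((\<lambda>t. u t x) has_real_derivative gen_apply G (u t) x) (at t within {0..})"
  by (simp add: flow_def)

lemma flow_diff: "flow u \<Longrightarrow> flow v \<Longrightarrow> flow (\<lambda>t x. u t x - v t x)"
  unfolding flow_def gen_apply_diff by (auto intro!: derivative_eq_intros)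

lemma flow_shift:
  assumes "flow u" "0 \<le> s"
  shows "flow (\<lambda>t. u (s + t))"
  unfolding flow_def
proof (intro allI impI)
  fix t :: real and x assume t: "0 \<le> t"
  have "((\<lambda>t. u t x) has_real_derivative gen_apply G (u (s + t)) x) (at (s + t) within (+) s ` {0..})"
    by (rule DERIV_subset[OF flowD[OF assms(1)]]) (use assms t in auto)
  then have "((\<lambda>t. u t x) \<circ> (+) s has_real_derivative gen_apply G (u (s + t)) x * 1) (at t within {0..})"
    by (rule DERIV_image_chain) (auto intro!: derivative_eq_intros)
  then show "((\<lambda>t. u (s + t) x) has_real_derivative gen_apply G (u (s + t)) x) (at t within {0..})"
    by (simp add: o_def)
qed

definition transition_op :: "real \<Rightarrow> ('a \<Rightarrow> real) \<Rightarrow> 'a \<Rightarrow> real" where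
  "transition_op t f x = (\<Sum>y\<in>UNIV. trans_prob G t x y * f y)"

lemma transition_op_0: "transition_op 0 f = f"
proof
  fix x
  have "transition_op 0 f x = (\<Sum>y\<in>UNIV. if x = y then f y else 0)"
    unfolding transition_op_def trans_prob_0 by (intro sum.cong) auto
  then show "transition_op 0 f x = f x" by simp
qed

lemma flow_transition_op: "flow (\<lambda>t. transition_op t f)"
  unfolding flow_def
proof (intro allI impI)
  fix t :: real and x assume t: "0 \<le> t"
  have "((\<lambda>t. transition_op t f x) has_real_derivative
      (\<Sum>y\<in>UNIV. gen_apply G (\<lambda>z. trans_prob G t z y) x * f y)) (at t within {0..})"
    unfolding transition_op_def by (auto intro!: derivative_eq_intros kolmogorov_backward t)
  also have "(\<Sum>y\<in>UNIV. gen_apply G (\<lambda>z. trans_prob G t z y) x * f y) = gen_apply G (transition_op t f) x"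
    unfolding gen_apply_def transition_op_def sum_distrib_left sum_distrib_right
    by (subst sum.swap) (simp add: ac_simps)
  finally show "((\<lambda>t. transition_op t f x) has_real_derivative gen_apply G (transition_op t f) x) (at t within {0..})" .
qed

lemma transition_op_minus_mean:
  assumes f: "\<And>y. \<bar>f y\<bar> \<le> M"
  shows "\<bar>transition_op t f x - mean \<pi> f\<bar> \<le> 2 * tv_dist (trans_prob G t x) (pmf \<pi>) * M"
proof -
  have "transition_op t f x - mean \<pi> f = (\<Sum>y\<in>UNIV. (trans_prob G t x y - pmf \<pi> y) * f y)"
    by (simp add: transition_op_def mean_def algebra_simps sum_subtractf)
  also have "\<bar>\<dots>\<bar> \<le> (\<Sum>y\<in>UNIV. \<bar>(trans_prob G t x y - pmf \<pi> y) * f y\<bar>)" by (rule sum_abs)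
  also have "\<dots> \<le> (\<Sum>y\<in>UNIV. \<bar>trans_prob G t x y - pmf \<pi> y\<bar> * M)"
    unfolding abs_mult using f by (intro sum_mono mult_left_mono) auto
  also have "\<dots> = 2 * tv_dist (trans_prob G t x) (pmf \<pi>) * M"
    by (simp add: tv_dist_def sum_distrib_right)
  finally show ?thesis .
qed

text \<open>
  Duality: the distance is attained by testing against the sign of the difference of the two laws.
\<close>

lemma tv_dist_eq_transition_op:
  "\<exists>g. (\<forall>y. \<bar>g y\<bar> \<le> 1) \<and> 2 * tv_dist (trans_prob G t x) (pmf \<pi>) = transition_op t (\<lambda>y. g y - mean \<pi> g) x"
proof (intro exI conjI allI)
  let ?g = "\<lambda>y. sgn (trans_prob G t x y - pmf \<pi> y)"
  show "\<bar>?g y\<bar> \<le> 1" for y by (simp add: sgn_if)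
  have "2 * tv_dist (trans_prob G t x) (pmf \<pi>) = (\<Sum>y\<in>UNIV. (trans_prob G t x y - pmf \<pi> y) * ?g y)"
    by (simp add: tv_dist_def abs_sgn)
  also have "\<dots> = transition_op t ?g x - mean \<pi> ?g * (\<Sum>y\<in>UNIV. trans_prob G t x y)"
    by (simp add: trans_prob_sum transition_op_def mean_def algebra_simps sum_subtractf)
  also have "\<dots> = transition_op t (\<lambda>y. ?g y - mean \<pi> ?g) x"
    by (simp add: transition_op_def algebra_simps sum_subtractf sum_distrib_right)
  finally show "2 * tv_dist (trans_prob G t x) (pmf \<pi>) = transition_op t (\<lambda>y. ?g y - mean \<pi> ?g) x" .
qed

end

context reversible_generator
begin

lemma flow_mean:
  assumes u: "flow u" and t: "0 \<le> t"
  shows "mean \<pi> (u t) = mean \<pi> (u 0)"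
proof -
  have D: "((\<lambda>t. mean \<pi> (u t)) has_real_derivative 0) (at t within {0..})" if "0 \<le> t" for t
  proof -
    have "((\<lambda>t. mean \<pi> (u t)) has_real_derivative (\<Sum>x\<in>UNIV. gen_apply G (u t) x * pmf \<pi> x)) (at t within {0..})"
      unfolding mean_def by (auto intro!: derivative_eq_intros flowD u that)
    then show ?thesis using stationary[of "u t"] by (simp add: mult.commute)
  qed
  have "mean \<pi> (u t) \<le> mean \<pi> (u 0)"
    by (rule nonincreasing_from_derivative[OF D _ t]) auto
  moreover have "- mean \<pi> (u t) \<le> - mean \<pi> (u 0)"
    by (rule nonincreasing_from_derivative[where F' = "\<lambda>_. 0", OF _ _ t]) (auto intro!: derivative_eq_intros D)
  ultimately show ?thesis by simp
qed

lemma flow_norm_derivative: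
  assumes u: "flow u" and t: "0 \<le> t"
  shows "((\<lambda>t. ip \<pi> (u t) (u t)) has_real_derivative - 2 * \<E> (u t) (u t)) (at t within {0..})"
proof -
  have "((\<lambda>t. ip \<pi> (u t) (u t)) has_real_derivative
      (\<Sum>x\<in>UNIV. (gen_apply G (u t) x * u t x + gen_apply G (u t) x * u t x) * pmf \<pi> x)) (at t within {0..})"
    unfolding ip_def by (auto intro!: derivative_eq_intros flowD u t simp: algebra_simps)
  then show ?thesis by (simp add: dirichlet_def ip_def sum_distrib_left algebra_simps sum_negf)
qed

text \<open>
  Symmetry of the form turns the second-order term into \<open>- 2 \<langle>G u, G u\<rangle>\<close>, which gives the monotonicity of
  the energy.
\<close>

lemma flow_energy_derivative:
  assumes u: "flow u" and t: "0 \<le> t"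
  shows "((\<lambda>t. \<E> (u t) (u t)) has_real_derivative
    - 2 * ip \<pi> (gen_apply G (u t)) (gen_apply G (u t))) (at t within {0..})"
proof -
  let ?Gu = "gen_apply G (u t)"
  have "((\<lambda>t. gen_apply G (u t) x) has_real_derivative gen_apply G ?Gu x) (at t within {0..})" for x
    unfolding gen_apply_def[of G "u _"] by (auto intro!: derivative_eq_intros flowD u t simp: gen_apply_def ac_simps)
  then have "((\<lambda>t. \<E> (u t) (u t)) has_real_derivative
      (\<Sum>x\<in>UNIV. (- gen_apply G ?Gu x * u t x + - ?Gu x * ?Gu x) * pmf \<pi> x)) (at t within {0..})"
    unfolding dirichlet_def ip_def by (auto intro!: derivative_eq_intros flowD u t simp: algebra_simps)
  also have "(\<Sum>x\<in>UNIV. (- gen_apply G ?Gu x * u t x + - ?Gu x * ?Gu x) * pmf \<pi> x) = \<E> ?Gu (u t) + \<E> (u t) ?Gu"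
    by (simp add: dirichlet_def ip_def algebra_simps sum.distrib sum_negf sum_subtractf)
  also have "\<dots> = - 2 * ip \<pi> ?Gu ?Gu"
    by (subst dirichlet_commute) (simp add: dirichlet_def ip_def sum_negf)
  finally show ?thesis .
qed

lemma flow_norm_le:
  assumes u: "flow u" and t: "0 \<le> t"
  shows "ip \<pi> (u t) (u t) \<le> ip \<pi> (u 0) (u 0)"
  by (rule nonincreasing_from_derivative[OF flow_norm_derivative[OF u] _ t]) (simp_all add: dirichlet_nonneg)

lemma flow_energy_le:
  assumes u: "flow u" and t: "0 \<le> t"
  shows "\<E> (u t) (u t) \<le> \<E> (u 0) (u 0)"
  by (rule nonincreasing_from_derivative[OF flow_energy_derivative[OF u] _ t]) (simp_all add: ip_nonneg)

text \<open>
  The norm cannot decay too fast: its rate of decay \<open>2 \<E>(u\<^sub>t, u\<^sub>t)\<close> never exceeds the initial rate.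
\<close>

lemma flow_norm_ge:
  assumes u: "flow u" and t: "0 \<le> t"
  shows "ip \<pi> (u 0) (u 0) - 2 * t * \<E> (u 0) (u 0) \<le> ip \<pi> (u t) (u t)"
proof -
  have "- ip \<pi> (u t) (u t) - 2 * t * \<E> (u 0) (u 0) \<le> - ip \<pi> (u 0) (u 0) - 2 * 0 * \<E> (u 0) (u 0)"
    by (rule nonincreasing_from_derivative[where F' = "\<lambda>t. 2 * \<E> (u t) (u t) - 2 * \<E> (u 0) (u 0)", OF _ _ t])
      (auto intro!: derivative_eq_intros flow_norm_derivative[OF u] simp: flow_energy_le[OF u])
  then show ?thesis by simp
qed

lemma point_square_le:
  assumes "c \<le> pmf \<pi> x"
  shows "c * (f x)\<^sup>2 \<le> ip \<pi> f f"
proof -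
  have "c * (f x)\<^sup>2 \<le> f x * f x * pmf \<pi> x"
    using mult_right_mono[OF assms, of "(f x)\<^sup>2"] by (simp add: power2_eq_square mult.commute)
  also have "\<dots> \<le> ip \<pi> f f"
    unfolding ip_def by (rule member_le_sum) auto
  finally show ?thesis .
qed

lemma flow_unique:
  assumes "flow u" "flow v" "u 0 = v 0" "0 \<le> t"
  shows "u t = v t"
proof
  fix x
  let ?w = "\<lambda>t x. u t x - v t x"
  have "pmf \<pi> x * (?w t x)\<^sup>2 \<le> ip \<pi> (?w t) (?w t)" by (rule point_square_le) simp
  also have "\<dots> \<le> ip \<pi> (?w 0) (?w 0)"
    by (rule flow_norm_le[where u = ?w]) (use assms flow_diff in auto)
  also have "\<dots> = 0" using assms(3) by (simp add: ip_def)
  finally show "u t x = v t x"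
    using positive[of x] by (simp add: mult_le_0_iff)
qed

text \<open>
  Both sides solve the backward equation in \<open>t\<close> with the same initial value.
\<close>

lemma transition_op_add:
  assumes "0 \<le> s" "0 \<le> t"
  shows "transition_op (s + t) f = transition_op t (transition_op s f)"
  using flow_unique[of "\<lambda>t. transition_op (s + t) f" "\<lambda>t. transition_op t (transition_op s f)" t]
    flow_shift[OF flow_transition_op assms(1)] flow_transition_op assms(2) by (simp add: transition_op_0)

lemma transition_op_mean: "0 \<le> t \<Longrightarrow> mean \<pi> (transition_op t f) = mean \<pi> f"
  using flow_mean[OF flow_transition_op, of t f] by (simp add: transition_op_0)

text \<open>
  Within distance \<open>1/4\<close> of equilibrium, one step of length \<open>t\<close> halves the sup norm of a centred function.
\<close>

lemma iterated_contraction: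
  assumes t: "0 \<le> t" and tv: "\<And>x. tv_dist (trans_prob G t x) (pmf \<pi>) < 1 / 4"
    and f: "mean \<pi> f = 0" "\<And>x. \<bar>f x\<bar> \<le> M"
  shows "\<bar>transition_op (real n * t) f x\<bar> \<le> M / 2 ^ n"
proof (induction n arbitrary: x)
  case 0
  then show ?case using f by (simp add: transition_op_0)
next
  case (Suc n)
  let ?g = "transition_op (real n * t) f"
  have g: "mean \<pi> ?g = 0" using t f by (simp add: transition_op_mean)
  have M: "0 \<le> M / 2 ^ n" using Suc[of x] abs_ge_zero order_trans by blast
  have "transition_op (real (Suc n) * t) f x = transition_op t ?g x"
    using t transition_op_add[of "real n * t" t f] by (simp add: algebra_simps)
  also have "\<bar>\<dots>\<bar> \<le> 2 * tv_dist (trans_prob G t x) (pmf \<pi>) * (M / 2 ^ n)"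
    using transition_op_minus_mean[where f = ?g and t = t and x = x and \<pi> = \<pi>, OF Suc] g by simp
  also have "\<dots> \<le> 1 / 2 * (M / 2 ^ n)"
    using tv[of x] M by (intro mult_right_mono) auto
  finally show ?case by simp
qed

text \<open>
  Mixing at time \<open>t\<close> bounds the gap from below. After \<open>n\<close> steps the sup norm has shrunk by \<open>2\<^sup>n\<close>, and \<open>n\<close> is so
  large that this beats the factor \<open>1 / c\<close> lost in comparing the sup norm with the \<open>\<ell>\<^sup>2\<close> norm: the squared
  \<open>\<ell>\<^sup>2\<close> norm has at least halved by time \<open>n t\<close>. By \<open>flow_norm_ge\<close> it cannot drop by more than \<open>2 n t \<E>(f, f)\<close>.
\<close>

lemma poincare_of_mixing:
  assumes t: "0 \<le> t" and tv: "\<And>x. tv_dist (trans_prob G t x) (pmf \<pi>) < 1 / 4"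
    and c: "0 < c" "\<And>x. c \<le> pmf \<pi> x" and n: "2 \<le> c * 4 ^ n"
    and f: "mean \<pi> f = 0"
  shows "ip \<pi> f f \<le> 4 * real n * t * \<E> f f"
proof -
  let ?N = "ip \<pi> f f"
  let ?g = "transition_op (real n * t) f"
  define M where "M = sqrt (?N / c)"
  have M: "M\<^sup>2 = ?N / c" using ip_nonneg[of f] c(1) by (simp add: M_def)
  have fM: "\<bar>f x\<bar> \<le> M" for x
  proof -
    have "(f x)\<^sup>2 \<le> ?N / c" using point_square_le[where f = f and x = x, OF c(2)] c(1) by (simp add: field_simps)
    then show ?thesis unfolding M_def by (rule real_le_rsqrt[of "\<bar>f x\<bar>", simplified])
  qed
  have "ip \<pi> ?g ?g \<le> (\<Sum>x\<in>UNIV. (M / 2 ^ n)\<^sup>2 * pmf \<pi> x)"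
    unfolding ip_def
  proof (intro sum_mono mult_right_mono)
    fix x
    have "\<bar>?g x\<bar> \<le> M / 2 ^ n" by (rule iterated_contraction[OF t tv f fM])
    then show "?g x * ?g x \<le> (M / 2 ^ n)\<^sup>2"
      by (metis abs_ge_zero abs_mult_self_eq mult_mono' power2_eq_square)
  qed simp
  also have "\<dots> = (M / 2 ^ n)\<^sup>2 * (\<Sum>x\<in>UNIV. pmf \<pi> x)" by (simp only: sum_distrib_left)
  also have "(\<Sum>x\<in>UNIV. pmf \<pi> x) = 1" by (rule sum_pmf_eq_1) auto
  also have "(M / 2 ^ n)\<^sup>2 * 1 = ?N / (c * 4 ^ n)"
  proof -
    have "((2::real) ^ n)\<^sup>2 = 4 ^ n" by (simp add: power2_eq_square flip: power_mult_distrib)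
    then show ?thesis by (simp add: power_divide M)
  qed
  also have "\<dots> \<le> ?N / 2"
    using n ip_nonneg[of f] by (intro divide_left_mono) auto
  finally have "ip \<pi> ?g ?g \<le> ?N / 2" .
  moreover have "?N - 2 * (real n * t) * \<E> f f \<le> ip \<pi> ?g ?g"
    using flow_norm_ge[OF flow_transition_op, of "real n * t" f] t by (simp add: transition_op_0)
  ultimately show ?thesis by simp
qed

lemma variance_decay:
  assumes K: "0 \<le> K" "\<And>f. mean \<pi> f = 0 \<Longrightarrow> ip \<pi> f f \<le> K * \<E> f f"
    and a: "0 \<le> a" and f: "mean \<pi> f = 0"
  shows "ip \<pi> (transition_op (a * K) f) (transition_op (a * K) f) \<le> exp (- 2 * a) * ip \<pi> f f"
proof (cases "K = 0")
  case True
  then have "ip \<pi> (transition_op (a * K) f) (transition_op (a * K) f) \<le> 0"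
    using K(2)[OF f] by (simp add: transition_op_0)
  then show ?thesis using ip_nonneg[of f] by (meson exp_ge_zero mult_nonneg_nonneg order_trans)
next
  case False
  then have K0: "0 < K" using K(1) by simp
  let ?u = "\<lambda>t. transition_op t f"
  \<comment> \<open>Gronwall: \<open>u\<close> stays centred, so the inequality applies at all times and makes \<open>?F\<close> nonincreasing\<close>
  let ?F = "\<lambda>t. exp (2 / K * t) * ip \<pi> (?u t) (?u t)"
  have "?F (a * K) \<le> ?F 0"
  proof (rule nonincreasing_from_derivative[where F = ?F])
    fix t :: real assume t: "0 \<le> t"
    show "(?F has_real_derivative exp (2 / K * t) * (2 / K * ip \<pi> (?u t) (?u t) - 2 * \<E> (?u t) (?u t))) (at t within {0..})"
      using K0 by (auto intro!: derivative_eq_intros flow_norm_derivative[OF flow_transition_op t] simp: algebra_simps)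
    have "ip \<pi> (?u t) (?u t) \<le> K * \<E> (?u t) (?u t)" using t f by (intro K(2)) (simp add: transition_op_mean)
    then have "2 / K * ip \<pi> (?u t) (?u t) \<le> 2 * \<E> (?u t) (?u t)"
      using K0 by (simp add: field_simps)
    then show "exp (2 / K * t) * (2 / K * ip \<pi> (?u t) (?u t) - 2 * \<E> (?u t) (?u t)) \<le> 0"
      by (intro mult_nonneg_nonpos) auto
  qed (use a K0 in auto)
  then have "exp (2 * a) * ip \<pi> (?u (a * K)) (?u (a * K)) \<le> ip \<pi> f f"
    using K0 by (simp add: transition_op_0)
  then show ?thesis by (simp add: exp_minus field_simps)
qed

text \<open>
  A test function for the total variation distance is bounded by \<open>2\<close> after centring, so its variance is at
  most \<open>4\<close>; the decay of the variance gives a pointwise bound through the mass \<open>c\<close> of a single point.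
\<close>

lemma mixing_of_poincare:
  assumes K: "0 \<le> K" "\<And>f. mean \<pi> f = 0 \<Longrightarrow> ip \<pi> f f \<le> K * \<E> f f"
    and a: "0 \<le> a" "exp (- 2 * a) < c / 16" and c: "c \<le> pmf \<pi> x"
  shows "tv_dist (trans_prob G (a * K) x) (pmf \<pi>) < 1 / 4"
proof -
  let ?d = "tv_dist (trans_prob G (a * K) x) (pmf \<pi>)"
  have p1: "(\<Sum>x\<in>UNIV. pmf \<pi> x) = 1" by (rule sum_pmf_eq_1) auto
  obtain g where g: "\<And>y. \<bar>g y\<bar> \<le> 1" "2 * ?d = transition_op (a * K) (\<lambda>y. g y - mean \<pi> g) x"
    using tv_dist_eq_transition_op by blast
  let ?f = "\<lambda>y. g y - mean \<pi> g"
  have "mean \<pi> (\<lambda>y. g y - m) = mean \<pi> g - m" for m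
    using p1 by (simp add: mean_def left_diff_distrib sum_subtractf flip: sum_distrib_left)
  then have f: "mean \<pi> ?f = 0" by simp
  have "\<bar>mean \<pi> g\<bar> \<le> (\<Sum>x\<in>UNIV. \<bar>g x * pmf \<pi> x\<bar>)" unfolding mean_def by (rule sum_abs)
  also have "\<dots> \<le> (\<Sum>x\<in>UNIV. 1 * pmf \<pi> x)"
    using g(1) by (intro sum_mono) (simp add: abs_mult mult_left_le_one_le)
  finally have "\<bar>mean \<pi> g\<bar> \<le> 1" using p1 by simp
  then have f2: "\<bar>?f y\<bar> \<le> 2" for y using g(1)[of y] by linarith
  have "ip \<pi> ?f ?f \<le> (\<Sum>x\<in>UNIV. 4 * pmf \<pi> x)"
    unfolding ip_def
  proof (intro sum_mono mult_right_mono)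
    fix y show "?f y * ?f y \<le> 4"
      using mult_mono[OF f2 f2, of y y] by simp
  qed simp
  also have "\<dots> = 4" using p1 by (simp flip: sum_distrib_left)
  finally have f4: "ip \<pi> ?f ?f \<le> 4" .
  have c0: "0 < c" using a(2) exp_gt_zero[of "- 2 * a"] by linarith
  have "c * (2 * ?d)\<^sup>2 \<le> exp (- 2 * a) * ip \<pi> ?f ?f"
    unfolding g(2) using point_square_le[OF c] variance_decay[OF K a(1) f] by (rule order_trans)
  also have "\<dots> \<le> exp (- 2 * a) * 4" using f4 by simp
  also have "\<dots> < c / 16 * 4" using a(2) by simp
  finally have "(2 * ?d)\<^sup>2 < (1 / 2)\<^sup>2" using c0 by (simp add: power2_eq_square)
  then have "2 * ?d < 1 / 2" by (rule power2_less_imp_less) simp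
  then show ?thesis by simp
qed

end

section \<open>Comparison of ordered reversible generators\<close>

text \<open>
  The Peskun order. The Metropolis--Hastings pair is an instance, since a minimum is at most a maximum.
\<close>

locale peskun_ordered =
  lo: reversible_generator G\<^sub>1 \<pi> + hi: reversible_generator G\<^sub>2 \<pi>
  for G\<^sub>1 G\<^sub>2 :: "'a::finite \<Rightarrow> 'a \<Rightarrow> real" and \<pi> :: "'a pmf" +
  assumes rates_le: "\<And>x y. x \<noteq> y \<Longrightarrow> G\<^sub>1 x y \<le> G\<^sub>2 x y"
begin

lemma dirichlet_le: "dirichlet G\<^sub>1 \<pi> f f \<le> dirichlet G\<^sub>2 \<pi> f f"
  unfolding lo.dirichlet_off_diagonal hi.dirichlet_off_diagonal
  by (intro divide_right_mono sum_mono) (auto intro!: mult_right_mono mult_left_mono rates_le)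

text \<open>
  The two hypotheses on \<open>g\<close> and \<open>g'\<close> are one Poisson equation in weak form with a common source. Testing the
  maximum principle for \<open>g\<close> with \<open>g'\<close> reverses the order of the forms.
\<close>

lemma energy_dual:
  assumes "\<And>f. dirichlet G\<^sub>1 \<pi> g f = dirichlet G\<^sub>2 \<pi> g' f"
  shows "dirichlet G\<^sub>2 \<pi> g' g' \<le> dirichlet G\<^sub>1 \<pi> g g"
  using lo.energy_ge[of g g'] assms[of g'] dirichlet_le[of g'] by simp

text \<open>
  The solution for \<open>G\<^sub>2\<close> is an admissible competitor in the minimisation for \<open>G\<^sub>1\<close>.
\<close>

lemma laplace_le:
  assumes "0 < l"
  shows "(\<integral>\<omega>. exp_neg l (hit_time G\<^sub>1 A \<omega>) \<partial>chain G\<^sub>1 \<pi>) \<le> (\<integral>\<omega>. exp_neg l (hit_time G\<^sub>2 A \<omega>) \<partial>chain G\<^sub>2 \<pi>)"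
proof -
  let ?u1 = "lo.laplace_hit l A" and ?u2 = "hi.laplace_hit l A"
  have "l * mean \<pi> ?u1 \<le> l * ip \<pi> ?u2 ?u2 + dirichlet G\<^sub>1 \<pi> ?u2 ?u2"
    using assms
    by (intro lo.killed_energy_minimal[where A = A])
      (auto simp: lo.laplace_hit_equation lo.laplace_hit_start hi.laplace_hit_start)
  also have "\<dots> \<le> l * ip \<pi> ?u2 ?u2 + dirichlet G\<^sub>2 \<pi> ?u2 ?u2"
    using dirichlet_le by simp
  also have "\<dots> = l * mean \<pi> ?u2"
    using assms
    by (intro hi.killed_energy[where A = A]) (auto simp: hi.laplace_hit_equation hi.laplace_hit_start)
  finally have "mean \<pi> ?u1 \<le> mean \<pi> ?u2" using assms by simp
  moreover have "(\<integral>\<omega>. exp_neg l (hit_time G\<^sub>1 A \<omega>) \<partial>chain G\<^sub>1 \<pi>) = mean \<pi> ?u1"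
    using assms by (subst integral_chain) (auto simp: exp_neg_le_1 mean_def lo.laplace_hit_def mult.commute)
  moreover have "(\<integral>\<omega>. exp_neg l (hit_time G\<^sub>2 A \<omega>) \<partial>chain G\<^sub>2 \<pi>) = mean \<pi> ?u2"
    using assms by (subst integral_chain) (auto simp: exp_neg_le_1 mean_def hi.laplace_hit_def mult.commute)
  ultimately show ?thesis by simp
qed

lemma expected_hit_time_ge:
  "(\<integral>\<^sup>+\<omega>. hit_time G\<^sub>1 A \<omega> \<partial>chain G\<^sub>1 \<pi>) \<ge> (\<integral>\<^sup>+\<omega>. hit_time G\<^sub>2 A \<omega> \<partial>chain G\<^sub>2 \<pi>)"
  by (rule LIMSEQ_le[OF expected_hit_time_limit expected_hit_time_limit])
    (auto intro!: exI[of _ 0] ennreal_leI mult_left_mono laplace_le)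

text \<open>
  Averaging first over the starting point expresses \<open>t_av\<close> through hitting times of single points from the
  stationary law.
\<close>

lemma t_av_ge: "t_av G\<^sub>1 \<pi> \<ge> t_av G\<^sub>2 \<pi>"
proof -
  have "t_av G \<pi> = (\<Sum>y\<in>UNIV. (\<integral>\<^sup>+\<omega>. hit_time G {y} \<omega> \<partial>chain G \<pi>) * ennreal (pmf \<pi> y))" for G
    unfolding t_av_def
    by (subst sum.swap) (simp add: nn_integral_chain[of "hit_time G _" _ \<pi>] sum_distrib_left ac_simps)
  then show ?thesis by (auto intro!: sum_mono mult_right_mono expected_hit_time_ge)
qed

lemma spectral_gap_le: "spectral_gap G\<^sub>1 \<pi> \<le> spectral_gap G\<^sub>2 \<pi>"
  unfolding spectral_gap_def dirichlet_def[symmetric] by (intro INF_mono) (use dirichlet_le in auto)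

lemma t_rel_ge: "t_rel G\<^sub>1 \<pi> \<ge> t_rel G\<^sub>2 \<pi>"
proof -
  have "0 \<le> spectral_gap G\<^sub>1 \<pi>"
    unfolding spectral_gap_def dirichlet_def[symmetric] by (intro INF_greatest) (simp add: lo.dirichlet_nonneg)
  then have "inverse (spectral_gap G\<^sub>2 \<pi>) \<le> inverse (spectral_gap G\<^sub>1 \<pi>)"
    by (intro ereal_inverse_antimono spectral_gap_le)
  then show ?thesis by (simp add: t_rel_def divide_ereal_def)
qed

text \<open>
  Without a solution for \<open>G\<^sub>1\<close> the left side is infinite; irreducibility provides one for \<open>G\<^sub>2\<close>.
\<close>

lemma asym_var_ge:
  assumes irr: "irreducible_gen G\<^sub>2" and h: "mean \<pi> h = 0"
  shows "asym_var h G\<^sub>1 \<pi> \<ge> asym_var h G\<^sub>2 \<pi>"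
proof (cases "\<exists>g. gen_apply G\<^sub>1 g = h")
  case True
  then obtain g where g: "gen_apply G\<^sub>1 g = h" by blast
  obtain g' where g': "gen_apply G\<^sub>2 g' = h" using hi.poisson_solvable[OF irr h] by blast
  have "dirichlet G\<^sub>2 \<pi> g' g' \<le> dirichlet G\<^sub>1 \<pi> g g"
    by (rule energy_dual) (simp add: dirichlet_def g g')
  then show ?thesis using lo.asym_var_eq[OF g] hi.asym_var_eq[OF g'] by simp
qed (simp add: asym_var_def)

lemma cap_le: "A \<inter> B = {} \<Longrightarrow> cap A B G\<^sub>1 \<pi> \<le> cap A B G\<^sub>2 \<pi>"
proof -
  assume AB: "A \<inter> B = {}"
  let ?u = "hi.hits_before B A"
  have "cap A B G\<^sub>1 \<pi> \<le> dirichlet G\<^sub>1 \<pi> ?u ?u"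
    using AB by (intro lo.cap_minimal) (auto intro!: hi.hits_before_start)
  also have "\<dots> \<le> dirichlet G\<^sub>2 \<pi> ?u ?u" by (rule dirichlet_le)
  also have "\<dots> = cap A B G\<^sub>2 \<pi>"
    using AB by (rule hi.cap_eq_dirichlet[symmetric])
  finally show ?thesis .
qed

lemma t_com_ge:
  assumes "irreducible_gen G\<^sub>1" "irreducible_gen G\<^sub>2"
  shows "t_com G\<^sub>1 x y \<ge> t_com G\<^sub>2 x y"
proof (cases "x = y")
  case True
  obtain h where "h y = 0" "\<And>x. (\<integral>\<^sup>+\<omega>. hit_time G\<^sub>2 {y} \<omega> \<partial>chain_from G\<^sub>2 x) = ennreal (h x)"
    using hi.expected_hit_time_equation[OF assms(2), of y] by blast
  then show ?thesis using True by (simp add: t_com_def)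
next
  case False
  obtain w where w: "t_com G\<^sub>1 x y = ennreal (w x - w y)" "\<And>f. dirichlet G\<^sub>1 \<pi> w f = f x - f y"
    using lo.commute_potential[OF assms(1) False] by blast
  obtain w' where w': "t_com G\<^sub>2 x y = ennreal (w' x - w' y)" "\<And>f. dirichlet G\<^sub>2 \<pi> w' f = f x - f y"
    using hi.commute_potential[OF assms(2) False] by blast
  have "w' x - w' y \<le> w x - w y" using energy_dual[of w w'] w(2) w'(2) by simp
  then show ?thesis unfolding w(1) w'(1) by (rule ennreal_leI)
qed

lemma ld_rate_le: "ld_rate G\<^sub>1 \<nu> \<le> ld_rate G\<^sub>2 \<nu>"
  unfolding lo.ld_rate_eq hi.ld_rate_eq by (simp add: dirichlet_le)

text \<open>
  The Poincare constant \<open>4 n t\<close> obtained from the mixing of \<open>G\<^sub>1\<close> at time \<open>t\<close> is inherited by \<open>G\<^sub>2\<close>, and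
  running \<open>G\<^sub>2\<close> for \<open>ln (16 / c)\<close> times that long shrinks variances by \<open>(c / 16)\<^sup>2\<close>, below the \<open>c / 16\<close> that
  suffices.
\<close>

lemma t_mix_le:
  assumes c: "0 < c" "\<And>x. c \<le> pmf \<pi> x" and n: "2 \<le> c * 4 ^ n"
  shows "t_mix G\<^sub>2 \<pi> (1 / 4) \<le> ennreal (4 * real n * ln (16 / c)) * t_mix G\<^sub>1 \<pi> (1 / 4)"
proof -
  define a where "a = ln (16 / c)"
  have c1: "c \<le> 1" using c(2)[of undefined] pmf_le_1[of \<pi> undefined] by linarith
  have a0: "0 < a" using c c1 by (simp add: a_def)
  have "exp (- 2 * a) = (c / 16)\<^sup>2"
    using c(1) by (simp add: a_def exp_minus exp_of_nat_mult[of 2, simplified] exp_ln power_divide field_simps)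
  also have "\<dots> < c / 16" using c c1 by (simp add: power2_eq_square)
  finally have ea: "exp (- 2 * a) < c / 16" .
  have n0: "0 < n" using n c1 c(1) by (cases n) auto
  define C where "C = 4 * real n * a"
  have C0: "0 < C" using n0 a0 by (simp add: C_def)
  have main: "t_mix G\<^sub>2 \<pi> (1 / 4) \<le> ennreal (C * t)"
    if t: "0 \<le> t" and mix: "(SUP x. tv_dist (trans_prob G\<^sub>1 t x) (pmf \<pi>)) < 1 / 4" for t
  proof -
    have tv: "tv_dist (trans_prob G\<^sub>1 t x) (pmf \<pi>) < 1 / 4" for x
      using mix by (rule le_less_trans[rotated]) (auto intro!: cSUP_upper)
    have K: "ip \<pi> f f \<le> 4 * real n * t * dirichlet G\<^sub>2 \<pi> f f" if "mean \<pi> f = 0" for f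
    proof -
      have "ip \<pi> f f \<le> 4 * real n * t * dirichlet G\<^sub>1 \<pi> f f"
        by (rule lo.poincare_of_mixing[OF t tv c n that])
      also have "\<dots> \<le> 4 * real n * t * dirichlet G\<^sub>2 \<pi> f f"
        using t by (intro mult_left_mono dirichlet_le) auto
      finally show ?thesis .
    qed
    \<comment> \<open>for \<open>t = 0\<close> the constant is \<open>0\<close> and centred functions vanish, so both chains are mixed at time \<open>0\<close>\<close>
    have eq: "a * (4 * real n * t) = C * t" by (simp add: C_def)
    have "tv_dist (trans_prob G\<^sub>2 (C * t) x) (pmf \<pi>) < 1 / 4" for x
      unfolding eq[symmetric] using t a0
      by (intro hi.mixing_of_poincare[OF _ K _ ea c(2)]) auto
    then have "(SUP x. tv_dist (trans_prob G\<^sub>2 (C * t) x) (pmf \<pi>)) < 1 / 4"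
      by (subst finite_imp_Sup_less) auto
    then show ?thesis
      unfolding t_mix_def using t C0 by (intro Inf_lower) auto
  qed
  \<comment> \<open>dividing by \<open>C\<close> turns the bound into one against each element of the infimum\<close>
  have "t_mix G\<^sub>2 \<pi> (1 / 4) / ennreal C \<le> t_mix G\<^sub>1 \<pi> (1 / 4)"
    unfolding t_mix_def[of G\<^sub>1]
  proof (intro Inf_greatest, clarify)
    fix t assume "0 \<le> t" "(SUP x. tv_dist (trans_prob G\<^sub>1 t x) (pmf \<pi>)) < 1 / 4"
    then have "t_mix G\<^sub>2 \<pi> (1 / 4) / ennreal C \<le> ennreal (C * t) / ennreal C"
      by (intro divide_right_mono_ennreal main)
    also have "\<dots> = ennreal t" using C0 \<open>0 \<le> t\<close> by (simp add: divide_ennreal)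
    finally show "t_mix G\<^sub>2 \<pi> (1 / 4) / ennreal C \<le> ennreal t" .
  qed
  then have "ennreal C * (t_mix G\<^sub>2 \<pi> (1 / 4) / ennreal C) \<le> ennreal C * t_mix G\<^sub>1 \<pi> (1 / 4)"
    by (rule mult_left_mono) simp
  also have "ennreal C * (t_mix G\<^sub>2 \<pi> (1 / 4) / ennreal C) = t_mix G\<^sub>2 \<pi> (1 / 4)"
  proof -
    have "ennreal C * (t_mix G\<^sub>2 \<pi> (1 / 4) / ennreal C) = t_mix G\<^sub>2 \<pi> (1 / 4) * ennreal C / ennreal C"
      by (simp add: ennreal_times_divide mult.commute)
    also have "\<dots> = t_mix G\<^sub>2 \<pi> (1 / 4)"
      using C0 by (intro mult_divide_eq_ennreal) auto
    finally show ?thesis .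
  qed
  finally show ?thesis by (simp add: C_def a_def)
qed

end

section \<open>The Metropolis--Hastings generators\<close>

text \<open>
  Multiplied by \<open>\<mu> x\<close>, both rates become a symmetric function (minimum or maximum) of \<open>\<mu> x Q x y\<close> and
  \<open>\<mu> y Q y x\<close>.
\<close>

lemma MH_reversible:
  fixes \<mu> :: "'a::finite pmf"
  assumes pos: "\<And>x. pmf \<mu> x > 0" and Q: "is_generator Q"
  shows "reversible_generator (MH1 Q \<mu>) \<mu>" "reversible_generator (MH2 Q \<mu>) \<mu>"
proof -
  have Q0: "0 \<le> Q x y" if "x \<noteq> y" for x y using Q that by (auto simp: is_generator_def)
  have gen: "is_generator (\<lambda>x y. if x = y then - (\<Sum>z\<in>UNIV - {x}. R x z) else R x y)"
    if "\<And>x y. x \<noteq> y \<Longrightarrow> 0 \<le> R x y" for R :: "'a \<Rightarrow> 'a \<Rightarrow> real"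
    unfolding is_generator_def
  proof (intro conjI allI)
    fix x
    show "(\<Sum>y\<in>UNIV. if x = y then - (\<Sum>z\<in>UNIV - {x}. R x z) else R x y) = 0"
      by (subst sum.remove[of UNIV x]) (auto intro!: sum.cong)
  qed (use that in auto)
  have R1: "0 \<le> MH1_rate Q \<mu> x y" and R2: "0 \<le> MH2_rate Q \<mu> x y" if "x \<noteq> y" for x y
    using that Q0[of x y] Q0[of y x] pos by (auto simp: MH1_rate_def MH2_rate_def less_imp_le le_max_iff_disj)
  have B1: "pmf \<mu> x * MH1_rate Q \<mu> x y = pmf \<mu> y * MH1_rate Q \<mu> y x"
    and B2: "pmf \<mu> x * MH2_rate Q \<mu> x y = pmf \<mu> y * MH2_rate Q \<mu> y x" for x y
    using pos[of x] pos[of y]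
    by (simp_all add: MH1_rate_def MH2_rate_def min_mult_distrib_left max_mult_distrib_left min.commute max.commute)
  show "reversible_generator (MH1 Q \<mu>) \<mu>"
    by unfold_locales (use gen[OF R1] B1 pos in \<open>auto simp: MH1_def[abs_def]\<close>)
  show "reversible_generator (MH2 Q \<mu>) \<mu>"
    by unfold_locales (use gen[OF R2] B2 pos in \<open>auto simp: MH2_def[abs_def]\<close>)
qed

lemma MH_ordered:
  fixes \<mu> :: "'a::finite pmf"
  assumes "\<And>x. pmf \<mu> x > 0" "is_generator Q"
  shows "peskun_ordered (MH1 Q \<mu>) (MH2 Q \<mu>) \<mu>"
proof -
  interpret M1: reversible_generator "MH1 Q \<mu>" \<mu> by (rule MH_reversible) fact+
  interpret M2: reversible_generator "MH2 Q \<mu>" \<mu> by (rule MH_reversible) fact+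
  show ?thesis by unfold_locales (auto simp: MH1_def MH2_def MH1_rate_def MH2_rate_def)
qed

lemma irreducible_MH2:
  fixes Q :: "'a::finite \<Rightarrow> 'a \<Rightarrow> real"
  assumes "is_generator Q" "irreducible_gen Q"
  shows "irreducible_gen (MH2 Q \<mu>)"
proof -
  have "Q x x \<le> 0" for x using generator.diag_nonpos[of Q] assms(1) by (simp add: generator_def)
  then have "x \<noteq> y" if "0 < Q x y" for x y using that not_less by blast
  then have "{(a, b). 0 < Q a b} \<subseteq> {(a, b). 0 < MH2 Q \<mu> a b}"
    by (auto simp: MH2_def MH2_rate_def less_max_iff_disj)
  then show ?thesis using assms(2) rtrancl_mono unfolding irreducible_gen_def by blast
qed

theorem theorem4p1:
  fixes \<mu> :: "'a::finite pmf"
  assumes pos: "\<And>x. pmf \<mu> x > 0"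
  shows "\<exists>C::real. C > 0 \<and>
    (\<forall>Q :: 'a \<Rightarrow> 'a \<Rightarrow> real. is_generator Q \<and> irreducible_gen Q \<longrightarrow>
      \<comment> \<open>hitting times\<close>
      (\<forall>l A. l > 0 \<longrightarrow>
         (\<integral>\<omega>. exp_neg l (hit_time (MH1 Q \<mu>) A \<omega>) \<partial>chain (MH1 Q \<mu>) \<mu>)
         \<le> (\<integral>\<omega>. exp_neg l (hit_time (MH2 Q \<mu>) A \<omega>) \<partial>chain (MH2 Q \<mu>) \<mu>)) \<and>
      (\<forall>A. (\<integral>\<^sup>+\<omega>. hit_time (MH1 Q \<mu>) A \<omega> \<partial>chain (MH1 Q \<mu>) \<mu>)
         \<ge> (\<integral>\<^sup>+\<omega>. hit_time (MH2 Q \<mu>) A \<omega> \<partial>chain (MH2 Q \<mu>) \<mu>)) \<and>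
      t_av (MH1 Q \<mu>) \<mu> \<ge> t_av (MH2 Q \<mu>) \<mu> \<and>
      \<comment> \<open>total variation mixing time\<close>
      t_mix (MH2 Q \<mu>) \<mu> (1/4) \<le> ennreal C * t_mix (MH1 Q \<mu>) \<mu> (1/4) \<and>
      \<comment> \<open>spectral gap\<close>
      spectral_gap (MH1 Q \<mu>) \<mu> \<le> spectral_gap (MH2 Q \<mu>) \<mu> \<and>
      t_rel (MH1 Q \<mu>) \<mu> \<ge> t_rel (MH2 Q \<mu>) \<mu> \<and>
      \<comment> \<open>asymptotic variance\<close>
      (\<forall>h. mean \<mu> h = 0 \<longrightarrow> asym_var h (MH1 Q \<mu>) \<mu> \<ge> asym_var h (MH2 Q \<mu>) \<mu>) \<and>
      \<comment> \<open>large deviations\<close>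
      (\<forall>\<nu> :: 'a pmf. ld_rate (MH1 Q \<mu>) \<nu> \<le> ld_rate (MH2 Q \<mu>) \<nu>) \<and>
      \<comment> \<open>capacity\<close>
      (\<forall>A B. A \<inter> B = {} \<longrightarrow> cap A B (MH1 Q \<mu>) \<mu> \<le> cap A B (MH2 Q \<mu>) \<mu>) \<and>
      \<comment> \<open>for reducible \<open>M\<^sub>1\<close> commute times are governed by the mass of a component, and this can fail\<close>
      (irreducible_gen (MH1 Q \<mu>) \<longrightarrow>
         (\<forall>x y. t_com (MH1 Q \<mu>) x y \<ge> t_com (MH2 Q \<mu>) x y)))"
proof -
  define c where "c = Min (range (pmf \<mu>))"
  have c: "0 < c" "c \<le> pmf \<mu> x" for x
    using pos by (auto simp: c_def Min_gr_iff)
  \<comment> \<open>both \<open>c\<close> and \<open>n\<close>, and hence the constant, are chosen from \<open>\<mu>\<close> before \<open>Q\<close> is given\<close>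
  obtain n :: nat where "2 / c < 4 ^ n" using real_arch_pow[of 4 "2 / c"] by auto
  then have n: "2 \<le> c * 4 ^ n" using c(1) by (simp add: field_simps less_imp_le)
  have c1: "c \<le> 1" using c(2)[of undefined] pmf_le_1[of \<mu> undefined] by linarith
  have n0: "0 < n" using n c1 c(1) by (cases n) auto
  show ?thesis
  proof (rule exI[of _ "4 * real n * ln (16 / c)"], rule conjI, goal_cases)
    case 1
    then show ?case using n0 c(1) c1 by simp
  next
    case 2
    show ?case
    proof (rule allI, rule impI, elim conjE, goal_cases)
      case (1 Q)
      interpret peskun_ordered "MH1 Q \<mu>" "MH2 Q \<mu>" \<mu>
        using pos 1(1) by (rule MH_ordered)
      have irr: "irreducible_gen (MH2 Q \<mu>)" using 1 by (rule irreducible_MH2)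
      show ?case
        by (intro conjI allI impI laplace_le expected_hit_time_ge t_av_ge t_mix_le[OF c n]
            spectral_gap_le t_rel_ge asym_var_ge[OF irr] ld_rate_le cap_le t_com_ge[OF _ irr])
    qed
  qed
qed

end
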